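(* Let $X$ be a complete ordered metric space. Then $PX$, with the Wasserstein metric and the stochastic order, is the colimit in the category $\mathsf{COMet}$ of the functor $X^{(-)}:\mathsf{FinUnif}^{\mathrm{op}}\to\mathsf{COMet}$, with colimit components given by the empirical distribution maps $i_N:X^N\to PX$.
   Context: An ordered metric space is a metric space $X$ equipped with a partial order $\le$ whose graph $\{\le\}=\{(x,y): x\le y\}\subseteq X\times X$ is closed. A map between metric spaces is short if it is 1-Lipschitz. $\mathsf{COMet}$ is the category of ordered metric spaces that are complete as metric spaces, with short monotone maps as morphisms. $\mathsf{FinUnif}$ is the category of nonempty finite sets, with morphisms the functions whose fibers all have the same cardinality. For a finite nonempty set $N$, $X^N$ is the set of tuples $(x_n)_{n\in N}$ with metric $d((x_n),(y_n))=\frac1{|N|}\sum_{n\in N}d(x_n,y_n)$ and the product order. A morphism $\phi:M\to N$ of $\mathsf{FinUnif}$ induces $X^\phi:X^N\to X^M$, $X^\phi((x_n)_{n\in N})=(x_{\phi(m)})_{m\in M}$. $PX$ is the set of Radon probability measures $p$ on $X$ of finite first moment, i.e. such that $\int f\,dp$ exists and is finite for every short $f:X\to\mathbb{R}$. With $\Gamma(p,q)$ the set of couplings (probability measures on $X\times X$ with marginals $p$ and $q$), the Kantorovich–Wasserstein metric is $d(p,q)=\inf_{r\in\Gamma(p,q)}\int d(x,y)\,dr(x,y)$. Stochastic order: $p\le q$ iff some $r\in\Gamma(p,q)$ is supported on the closed set $\{\le\}$ (i.e. the complement of $\{\le\}$ has $r$-measure zero). The empirical distribution map is $i_N((x_n)_{n\in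 N})=\frac1{|N|}\sum_{n\in N}\delta_{x_n}$. *)

theory Defs
  imports "HOL-Probability.Probability" "HOL-Library.Infinite_Typeclass"
begin

section \<open>Ordered metric spaces and the category COMet\<close>

record 'a omet =
  pts :: "'a set"
  dst :: "'a \<Rightarrow> 'a \<Rightarrow> real"
  leq :: "'a rel"

definition omet_topology :: "'a omet \<Rightarrow> 'a topology" where
  "omet_topology A = Metric_space.mtopology (pts A) (dst A)"

definition ordered_metric_space :: "'a omet \<Rightarrow> bool" where
  "ordered_metric_space A \<longleftrightarrow>
     Metric_space (pts A) (dst A) \<and>
     partial_order_on (pts A) (leq A) \<and>
     closedin (prod_topology (omet_topology A) (omet_topology A)) (leq A)"

definition complete_ordered_metric_space :: "'a omet \<Rightarrow> bool" where
  "complete_ordered_metric_space A \<longleftrightarrow>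
     ordered_metric_space A \<and> Metric_space.mcomplete (pts A) (dst A)"

text \<open>Morphisms are extensional (\<open>undefined\<close> outside the points of the domain), so that equality
  of morphisms is equality in HOL and composition is \<^const>\<open>compose\<close>.\<close>

definition comet_hom :: "'a omet \<Rightarrow> 'b omet \<Rightarrow> ('a \<Rightarrow> 'b) set" where
  "comet_hom A B =
     {f \<in> pts A \<rightarrow>\<^sub>E pts B.
        (\<forall>x\<in>pts A. \<forall>y\<in>pts A. dst B (f x) (f y) \<le> dst A x y) \<and>
        (\<forall>x\<in>pts A. \<forall>y\<in>pts A. (x, y) \<in> leq A \<longrightarrow> (f x, f y) \<in> leq B)}"


section \<open>The category FinUnif\<close>

text \<open>The finite sets are those of an arbitrary type \<open>'n\<close>; the type is required to be infinite only
  where all cardinalities have to be available.\<close>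

definition finunif_obj :: "'n set set" where
  "finunif_obj = {N. finite N \<and> N \<noteq> {}}"

definition finunif_hom :: "'n set \<Rightarrow> 'n set \<Rightarrow> ('n \<Rightarrow> 'n) set" where
  "finunif_hom M N =
     {\<phi> \<in> M \<rightarrow>\<^sub>E N. \<forall>n\<in>N. \<forall>n'\<in>N. card {m \<in> M. \<phi> m = n} = card {m \<in> M. \<phi> m = n'}}"


section \<open>Functors from the opposite of FinUnif to COMet, cocones and colimits\<close>

text \<open>In a functor \<open>(D, Dm)\<close>, the map \<open>Dm M N \<phi>\<close> is the image \<open>D N \<rightarrow> D M\<close> of \<open>\<phi> : M \<rightarrow> N\<close>.\<close>

definition finunif_op_functor ::
  "('n set \<Rightarrow> 'd omet) \<Rightarrow> ('n set \<Rightarrow> 'n set \<Rightarrow> ('n \<Rightarrow> 'n) \<Rightarrow> 'd \<Rightarrow> 'd) \<Rightarrow> bool" where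
  "finunif_op_functor D Dm \<longleftrightarrow>
     (\<forall>N\<in>finunif_obj. complete_ordered_metric_space (D N)) \<and>
     (\<forall>M\<in>finunif_obj. \<forall>N\<in>finunif_obj. \<forall>\<phi>\<in>finunif_hom M N. Dm M N \<phi> \<in> comet_hom (D N) (D M)) \<and>
     (\<forall>N\<in>finunif_obj. Dm N N (\<lambda>n\<in>N. n) = (\<lambda>x\<in>pts (D N). x)) \<and>
     (\<forall>L\<in>finunif_obj. \<forall>M\<in>finunif_obj. \<forall>N\<in>finunif_obj.
        \<forall>\<psi>\<in>finunif_hom L M. \<forall>\<phi>\<in>finunif_hom M N.
          Dm L N (compose L \<phi> \<psi>) = compose (pts (D N)) (Dm L M \<psi>) (Dm M N \<phi>))"

definition comet_cocone ::
  "('n set \<Rightarrow> 'd omet) \<Rightarrow> ('n set \<Rightarrow> 'n set \<Rightarrow> ('n \<Rightarrow> 'n) \<Rightarrow> 'd \<Rightarrow> 'd) \<Rightarrow>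
   'c omet \<Rightarrow> ('n set \<Rightarrow> 'd \<Rightarrow> 'c) \<Rightarrow> bool" where
  "comet_cocone D Dm C i \<longleftrightarrow>
     complete_ordered_metric_space C \<and>
     (\<forall>N\<in>finunif_obj. i N \<in> comet_hom (D N) C) \<and>
     (\<forall>M\<in>finunif_obj. \<forall>N\<in>finunif_obj. \<forall>\<phi>\<in>finunif_hom M N.
        compose (pts (D N)) (i M) (Dm M N \<phi>) = i N)"

text \<open>HOL cannot quantify over types inside a formula, so the type \<open>'y\<close> of the points of the test
  objects is a parameter; a theorem that is polymorphic in \<open>'y\<close> covers all of them.\<close>

definition comet_colimit ::
  "'y itself \<Rightarrow> ('n set \<Rightarrow> 'd omet) \<Rightarrow> ('n set \<Rightarrow> 'n set \<Rightarrow> ('n \<Rightarrow> 'n) \<Rightarrow> 'd \<Rightarrow> 'd) \<Rightarrow>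
   'c omet \<Rightarrow> ('n set \<Rightarrow> 'd \<Rightarrow> 'c) \<Rightarrow> bool" where
  "comet_colimit TY D Dm C i \<longleftrightarrow>
     comet_cocone D Dm C i \<and>
     (\<forall>(Y :: 'y omet) g. comet_cocone D Dm Y g \<longrightarrow>
        (\<exists>!u. u \<in> comet_hom C Y \<and> (\<forall>N\<in>finunif_obj. compose (pts (D N)) u (i N) = g N)))"


section \<open>The power functor\<close>

definition omet_power :: "'a omet \<Rightarrow> 'n set \<Rightarrow> ('n \<Rightarrow> 'a) omet" where
  "omet_power X N =
     \<lparr> pts = N \<rightarrow>\<^sub>E pts X,
       dst = (\<lambda>x y. (\<Sum>n\<in>N. dst X (x n) (y n)) / real (card N)),
       leq = {(x, y). x \<in> N \<rightarrow>\<^sub>E pts X \<and> y \<in> N \<rightarrow>\<^sub>E pts X \<and> (\<forall>n\<in>N. (x n, y n) \<in> leq X)} \<rparr>"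

definition omet_power_map ::
  "'a omet \<Rightarrow> 'n set \<Rightarrow> 'n set \<Rightarrow> ('n \<Rightarrow> 'n) \<Rightarrow> ('n \<Rightarrow> 'a) \<Rightarrow> ('n \<Rightarrow> 'a)" where
  "omet_power_map X M N \<phi> = (\<lambda>x \<in> pts (omet_power X N). \<lambda>m\<in>M. x (\<phi> m))"


section \<open>The ordered Wasserstein space\<close>

definition borel_of :: "'a topology \<Rightarrow> 'a measure" where
  "borel_of T = sigma (topspace T) {U. openin T U}"

definition radon_prob :: "'a topology \<Rightarrow> 'a measure \<Rightarrow> bool" where
  "radon_prob T p \<longleftrightarrow>
     sets p = sets (borel_of T) \<and> prob_space p \<and>
     (\<forall>A\<in>sets p. emeasure p A = (SUP K \<in> {K. compactin T K \<and> K \<subseteq> A}. emeasure p K))"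

definition finite_first_moment :: "'a omet \<Rightarrow> 'a measure \<Rightarrow> bool" where
  "finite_first_moment X p \<longleftrightarrow>
     (\<forall>f :: 'a \<Rightarrow> real. (\<forall>x\<in>pts X. \<forall>y\<in>pts X. \<bar>f x - f y\<bar> \<le> dst X x y) \<longrightarrow> integrable p f)"

definition wasserstein_pts :: "'a omet \<Rightarrow> 'a measure set" where
  "wasserstein_pts X = {p. radon_prob (omet_topology X) p \<and> finite_first_moment X p}"

text \<open>Couplings live on the Borel sets of the product topology, which for non-separable spaces may
  be more than the product of the Borel sigma-algebras: the distance and the graph of the order are
  in general measurable only for the former.\<close>

definition couplings :: "'a omet \<Rightarrow> 'a measure \<Rightarrow> 'a measure \<Rightarrow> ('a \<times> 'a) measure set" where
  "couplings X p q =
     {r. sets r = sets (borel_of (prod_topology (omet_topology X) (omet_topology X))) \<and>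
         prob_space r \<and>
         distr r (borel_of (omet_topology X)) fst = p \<and>
         distr r (borel_of (omet_topology X)) snd = q}"

definition wasserstein_dist :: "'a omet \<Rightarrow> 'a measure \<Rightarrow> 'a measure \<Rightarrow> real" where
  "wasserstein_dist X p q =
     enn2real (INF r \<in> couplings X p q. \<integral>\<^sup>+ z. ennreal (dst X (fst z) (snd z)) \<partial>r)"

definition stochastic_order :: "'a omet \<Rightarrow> 'a measure rel" where
  "stochastic_order X =
     {(p, q). p \<in> wasserstein_pts X \<and> q \<in> wasserstein_pts X \<and>
              (\<exists>r\<in>couplings X p q. emeasure r (pts X \<times> pts X - leq X) = 0)}"

definition wasserstein_space :: "'a omet \<Rightarrow> 'a measure omet" where
  "wasserstein_space X =
     \<lparr> pts = wasserstein_pts X, dst = wasserstein_dist X, leq = stochastic_order X \<rparr>"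

text \<open>Here \<^term>\<open>return B a\<close> is the Dirac measure at \<open>a\<close> on the measurable space \<open>B\<close>.\<close>

definition empirical :: "'a omet \<Rightarrow> 'n set \<Rightarrow> ('n \<Rightarrow> 'a) \<Rightarrow> 'a measure" where
  "empirical X N =
     (\<lambda>x \<in> pts (omet_power X N).
        let B = borel_of (omet_topology X)
        in measure_of (space B) (sets B)
             (\<lambda>A. (\<Sum>n\<in>N. emeasure (return B (x n)) A) / of_nat (card N)))"

end

theory Submission
  imports Defs
begin

text \<open>A functional that is additive in each of two arguments and has Radon marginals is automatically
  a measure on the product, because the marginals supply the compact sets of the usual extension
  argument. Applied to integrals of products of conditional densities this glues couplings, which
  gives the triangle inequality and transitivity of the stochastic order. Applied to a cluster point
  of couplings it gives compactness of the set of couplings, hence closedness of the stochastic order.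

  Rounding a coupling of two empirical measures to a matrix of rationals with the correct margins
  realizes it, up to \<open>\<epsilon>\<close>, by two tuples with a common index set, both obtained by pulling back
  along morphisms of FinUnif. Therefore every cocone is short for the Wasserstein distance between
  empirical measures. For completeness, the same matching turns a fast Cauchy sequence of empirical
  measures into a sequence of step functions on the unit interval that converges in \<open>L1\<close>; the law of
  its limit is the limit of the measures. As empirical measures are dense, a cocone extends uniquely
  to a short map. It is monotone because a coupling supported on the order can itself be approximated
  by empirical measures of tuples of comparable pairs.\<close>

section \<open>Borel sets and Radon measures on metrizable spaces\<close>

text \<open>The space \<open>X\<close> may be nonseparable. Then the Borel sets of
  \<open>X \<times> X\<close> can go beyond the product of the Borel sigma-algebras, and the
  distance and the order live on the larger sigma-algebra. The remedy is that a Radon probability is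
  carried by a sigma-compact set and that both sigma-algebras have the same trace on a rectangle of
  sigma-compact sets. Hence a coupling of Radon measures is determined by its values on rectangles
  and is itself Radon; gluing works with one density per set, and limits of couplings are taken on
  each rectangle separately, along a filter finer than \<open>sequentially\<close>. Such limits need
  fixed marginals, whereas couplings of converging measures have varying ones. These couplings are
  therefore first glued on both sides to nearly optimal couplings with the limit measures, which by
  Markov's inequality moves little mass between separated balls. Both \<open>W_zero_imp_eq\<close>
  and \<open>closed_stochastic\<close> are obtained in this way, as statements about being carried
  by a closed set.\<close>

lemma space_borel_of [simp]: "space (borel_of T) = topspace T"
  by (simp add: borel_of_def space_measure_of_conv)

lemma sets_borel_of: "sets (borel_of T) = sigma_sets (topspace T) {U. openin T U}"
  by (simp add: borel_of_def sets_measure_of_conv openin_subset PowI subsetI)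
    (use openin_subset in blast)

lemma borel_of_open [intro]: "openin T U \<Longrightarrow> U \<in> sets (borel_of T)"
  by (simp add: sets_borel_of)

lemma borel_of_closed [intro]: "closedin T F \<Longrightarrow> F \<in> sets (borel_of T)"
proof -
  assume F: "closedin T F"
  then have "topspace T - (topspace T - F) \<in> sets (borel_of T)"
    using borel_of_open[of T "topspace T - F"] sets.compl_sets[of "topspace T - F" "borel_of T"]
    by (simp add: closedin_def)
  then show ?thesis
    using closedin_subset[OF F] by (simp add: double_diff)
qed

lemma borel_of_compact:
  "metrizable_space T \<Longrightarrow> compactin T K \<Longrightarrow> K \<in> sets (borel_of T)"
  by (simp add: borel_of_closed compactin_imp_closedin metrizable_imp_Hausdorff_space)

lemma borel_of_singleton:
  "metrizable_space T \<Longrightarrow> x \<in> topspace T \<Longrightarrow> {x} \<in> sets (borel_of T)"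
  by (simp add: borel_of_compact)

lemma measurable_borel_ofI:
  assumes "\<And>x. x \<in> space M \<Longrightarrow> f x \<in> topspace T"
    and "\<And>U. openin T U \<Longrightarrow> f -` U \<inter> space M \<in> sets M"
  shows "f \<in> measurable M (borel_of T)"
  unfolding borel_of_def
  by (rule measurable_measure_of) (use assms in \<open>auto dest: openin_subset\<close>)

lemma continuous_map_measurable:
  assumes "continuous_map S T f"
  shows "f \<in> measurable (borel_of S) (borel_of T)"
proof (rule measurable_borel_ofI)
  fix U assume "openin T U"
  then have "openin S {x \<in> topspace S. f x \<in> U}"
    using assms by (simp add: continuous_map)
  then show "f -` U \<inter> space (borel_of S) \<in> sets (borel_of S)"
    by (auto simp: vimage_def Int_def conj_commute)
qed (use assms in \<open>auto simp: continuous_map_def\<close>)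

lemma sets_borel_of_euclidean: "sets (borel_of euclidean) = sets borel"
  by (simp add: sets_borel_of borel_def)

lemma continuous_map_borel_measurable:
  assumes "continuous_map S euclideanreal f"
  shows "f \<in> borel_measurable (borel_of S)"
  using continuous_map_measurable[OF assms] measurable_cong_sets[OF refl sets_borel_of_euclidean]
  by blast

lemma radon_probD:
  assumes "radon_prob T p"
  shows "sets p = sets (borel_of T)" "prob_space p" "space p = topspace T"
  using assms sets_eq_imp_space_eq[of p "borel_of T"] by (auto simp: radon_prob_def)

lemma radon_prob_inner:
  assumes "radon_prob T p" "A \<in> sets p" "0 < e"
  obtains K where "compactin T K" "K \<subseteq> A" "measure p A - e < measure p K"
proof -
  interpret prob_space p using assms(1) by (rule radon_probD)
  have SUP: "emeasure p A = (SUP K \<in> {K. compactin T K \<and> K \<subseteq> A}. emeasure p K)"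
    using assms by (auto simp: radon_prob_def)
  show ?thesis
  proof (cases "measure p A < e")
    \<comment> \<open>A negative number is sent to 0 by \<open>ennreal\<close>, so the strict
      inequality that selects \<open>K\<close> in the other case could fail here; the empty set
      serves instead.\<close>
    case True
    then show ?thesis by (intro that[of "{}"]) auto
  next
    case False
    then have "ennreal (measure p A - e) < emeasure p A"
      using assms(3) by (simp add: emeasure_eq_measure ennreal_less_iff)
    then obtain K where "compactin T K" "K \<subseteq> A" "ennreal (measure p A - e) < emeasure p K"
      unfolding SUP less_SUP_iff by auto
    then show ?thesis
      using False by (intro that[of K]) (auto simp: emeasure_eq_measure ennreal_less_iff)
  qed
qed

lemma radon_prob_inner_diff:
  assumes T: "metrizable_space T" and p: "radon_prob T p" and A: "A \<in> sets p" and e: "0 < e"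
  obtains K where "compactin T K" "K \<subseteq> A" "K \<in> sets p" "measure p (A - K) < e"
proof -
  interpret prob_space p using p by (rule radon_probD)
  obtain K where K: "compactin T K" "K \<subseteq> A" "measure p A - e < measure p K"
    using radon_prob_inner[OF p A e] .
  moreover have "K \<in> sets p"
    using borel_of_compact[OF T K(1)] radon_probD[OF p] by simp
  ultimately show ?thesis
    using A by (intro that[of K]) (auto simp: finite_measure_Diff)
qed

text \<open>Outer regularity is inner regularity of the complement: a compact set is closed in a
  Hausdorff space, so its complement is open.\<close>

lemma radon_prob_outer_diff:
  assumes T: "metrizable_space T" and p: "radon_prob T p" and A: "A \<in> sets p" and e: "0 < e"
  obtains U where "openin T U" "A \<subseteq> U" "U \<in> sets p" "measure p (U - A) < e"
proof -
  obtain K where K: "compactin T K" "K \<subseteq> space p - A" "measure p ((space p - A) - K) < e"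
    using radon_prob_inner_diff[OF T p sets.compl_sets[OF A] e] .
  have "closedin T K"
    by (simp add: K(1) T compactin_imp_closedin metrizable_imp_Hausdorff_space)
  then have U: "openin T (topspace T - K)" by blast
  moreover have "(topspace T - K) - A = (space p - A) - K"
    by (auto simp: radon_probD[OF p])
  moreover have "A \<subseteq> topspace T - K"
    using sets.sets_into_space[OF A] K(2) by (auto simp: radon_probD[OF p])
  ultimately show ?thesis
    using K(3) that[of "topspace T - K"] borel_of_open[OF U] radon_probD[OF p] by auto
qed

lemma radon_probI_diff:
  assumes T: "metrizable_space T" and s: "sets p = sets (borel_of T)" and p: "prob_space p"
    and *: "\<And>A e. A \<in> sets p \<Longrightarrow> 0 < e \<Longrightarrow> \<exists>K. compactin T K \<and> K \<subseteq> A \<and> measure p (A - K) \<le> e"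
  shows "radon_prob T p"
  unfolding radon_prob_def
proof (intro conjI s p ballI)
  interpret prob_space p by (rule p)
  fix A assume A: "A \<in> sets p"
  show "emeasure p A = (SUP K \<in> {K. compactin T K \<and> K \<subseteq> A}. emeasure p K)"
  proof (rule antisym)
    show "(SUP K \<in> {K. compactin T K \<and> K \<subseteq> A}. emeasure p K) \<le> emeasure p A"
      using A by (auto intro!: SUP_least emeasure_mono)
    show "emeasure p A \<le> (SUP K \<in> {K. compactin T K \<and> K \<subseteq> A}. emeasure p K)"
    proof (rule ennreal_le_epsilon)
      fix e :: real assume "0 < e"
      then obtain K where K: "compactin T K" "K \<subseteq> A" "measure p (A - K) \<le> e"
        using *[OF A] by auto
      have Ks: "K \<in> sets p"
        using borel_of_compact[OF T K(1)] s by simp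
      have "measure p A = measure p K + measure p (A - K)"
        using A Ks K(2) by (simp add: finite_measure_Diff)
      then have "emeasure p A \<le> emeasure p K + ennreal e"
        using K(3) \<open>0 < e\<close> by (simp add: emeasure_eq_measure flip: ennreal_plus)
      also have "\<dots> \<le> (SUP K \<in> {K. compactin T K \<and> K \<subseteq> A}. emeasure p K) + ennreal e"
        using K by (intro add_right_mono SUP_upper) auto
      finally show "emeasure p A \<le> (SUP K \<in> {K. compactin T K \<and> K \<subseteq> A}. emeasure p K) + ennreal e" .
    qed
  qed
qed

section \<open>Regularity of finite Borel measures on metrizable spaces, and tightness\<close>

lemma closedin_decseq_open:
  assumes T: "metrizable_space T" and F: "closedin T F"
  obtains U :: "nat \<Rightarrow> 'a set" where "\<And>n. openin T (U n)" "decseq U" "(\<Inter>n. U n) = F"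
proof -
  obtain M d where "Metric_space M d" and Teq: "T = Metric_space.mtopology M d"
    using T metrizable_space_def by blast
  interpret Metric_space M d by fact
  define U where "U n = (\<Union>x\<in>F. mball x (inverse (Suc n)))" for n
  have FM: "F \<subseteq> M"
    using closedin_subset[OF F] by (simp add: Teq)
  show ?thesis
  proof
    show "openin T (U n)" for n
      by (auto simp: U_def Teq)
    show "decseq U"
    proof (rule decseq_SucI)
      show "U (Suc n) \<le> U n" for n
        unfolding U_def by (intro UN_mono order_refl mball_subset_concentric) (auto simp: field_simps)
    qed
    show "(\<Inter>n. U n) = F"
    proof
      show "F \<subseteq> (\<Inter>n. U n)"
        using FM by (auto simp: U_def intro!: bexI)
      show "(\<Inter>n. U n) \<subseteq> F"
      proof
        fix x assume x: "x \<in> (\<Inter>n. U n)"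
        show "x \<in> F"
        proof (rule ccontr)
          assume "x \<notin> F"
          moreover have "x \<in> M" using x by (auto simp: U_def)
          ultimately obtain r where r: "r > 0" "disjnt F (mball x r)"
            using F by (auto simp: Teq closedin_metric)
          obtain n where n: "inverse (Suc n) < r"
            using r(1) reals_Archimedean by auto
          obtain y where "y \<in> F" "x \<in> mball y (inverse (Suc n))"
            using x by (auto simp: U_def)
          then have "y \<in> mball x r" using n by (auto simp: commute)
          with \<open>y \<in> F\<close> r(2) show False by (auto simp: disjnt_iff)
        qed
      qed
    qed
  qed
qed

text \<open>The sets that can be squeezed, up to every \<open>e\<close>, between a closed and an
  open set form a sigma-algebra. It contains the open sets, because these are increasing unions of
  closed sets; complementation exchanges the two bounds.\<close>

lemma metrizable_closed_open_regular:
  assumes T: "metrizable_space T" and s: "sets p = sets (borel_of T)" and p: "finite_measure p"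
    and A: "A \<in> sets p" and e: "0 < e"
  obtains F U where "closedin T F" "openin T U" "F \<subseteq> A" "A \<subseteq> U" "measure p (U - F) < e"
proof -
  interpret finite_measure p by (rule p)
  have op: "U \<in> sets p" if "openin T U" for U using that s by auto
  have cl: "F \<in> sets p" if "closedin T F" for F using that s by auto
  have sp: "space p = topspace T" using sets_eq_imp_space_eq[OF s] by simp
  have "\<forall>e>0. \<exists>F U. closedin T F \<and> openin T U \<and> F \<subseteq> A \<and> A \<subseteq> U \<and> measure p (U - F) < e"
    if "A \<in> sigma_sets (topspace T) {U. openin T U}"
    using that
  proof induction
    case (Basic A)
    then have A: "openin T A" by simp
    show ?case
    proof (intro allI impI)
      fix e :: real assume "0 < e"
      obtain V :: "nat \<Rightarrow> 'a set" where V: "\<And>n. openin T (V n)" "decseq V" "(\<Inter>n. V n) = topspace T - A"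
        using closedin_decseq_open[OF T, of "topspace T - A"] A by blast
      define F where "F n = topspace T - V n" for n
      have "decseq (\<lambda>n. A - F n)"
        using V(2) unfolding F_def decseq_def by blast
      moreover have "range (\<lambda>n. A - F n) \<subseteq> sets p"
        unfolding F_def using op[OF A] op[OF V(1)] op[OF openin_topspace] by auto
      ultimately have "(\<lambda>n. measure p (A - F n)) \<longlonglongrightarrow> measure p (\<Inter>n. A - F n)"
        by (intro finite_Lim_measure_decseq)
      moreover have "(\<Inter>n. A - F n) = {}"
        using V(3) openin_subset[OF A] by (auto simp: F_def)
      ultimately have "(\<lambda>n. measure p (A - F n)) \<longlonglongrightarrow> 0" by (simp only: measure_empty)
      from order_tendstoD(2)[OF this \<open>0 < e\<close>] obtain n where "measure p (A - F n) < e"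
        by (auto simp: eventually_sequentially)
      moreover have "closedin T (F n)" unfolding F_def using V(1) by blast
      moreover have "F n \<subseteq> A" using V(3) unfolding F_def by blast
      ultimately show "\<exists>F U. closedin T F \<and> openin T U \<and> F \<subseteq> A \<and> A \<subseteq> U \<and> measure p (U - F) < e"
        using A by blast
    qed
  next
    case Empty
    show ?case by (intro allI impI exI[of _ "{}"]) auto
  next
    case (Compl A)
    show ?case
    proof (intro allI impI)
      fix e :: real assume "0 < e"
      from Compl.IH[rule_format, OF this]
      obtain F U where FU: "closedin T F" "openin T U" "F \<subseteq> A" "A \<subseteq> U" "measure p (U - F) < e"
        by blast
      have "(topspace T - F) - (topspace T - U) = U - F"
        using openin_subset[OF FU(2)] by auto
      with FU show "\<exists>F' U'. closedin T F' \<and> openin T U' \<and> F' \<subseteq> topspace T - A \<and> topspace T - A \<subseteq> U'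
          \<and> measure p (U' - F') < e"
        by (intro exI[of _ "topspace T - U"] exI[of _ "topspace T - F"] conjI) (auto simp: closedin_def)
    qed
  next
    case (Union A)
    show ?case
    proof (intro allI impI)
      fix e :: real assume e: "0 < e"
      \<comment> \<open>These errors add up to \<open>e/2\<close>. The other half is spent on
        passing from infinitely many closed sets to finitely many.\<close>
      define \<delta> where "\<delta> n = e / 2 * (1/2) ^ Suc n" for n :: nat
      have \<delta>: "\<delta> n > 0" for n using e by (simp add: \<delta>_def)
      have "\<exists>F U. closedin T F \<and> openin T U \<and> F \<subseteq> A n \<and> A n \<subseteq> U \<and> measure p (U - F) < \<delta> n" for n
        using Union.IH[of n, rule_format, OF \<delta>] .
      then obtain F U where FU: "\<And>n. closedin T (F n)" "\<And>n. openin T (U n)" "\<And>n. F n \<subseteq> A n"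
        "\<And>n. A n \<subseteq> U n" "\<And>n. measure p (U n - F n) < \<delta> n"
        by metis
      have ds: "(\<lambda>n. \<delta> n) sums (e/2)"
        unfolding \<delta>_def using sums_mult[OF power_half_series, of "e/2"] by simp
      define W where "W = (\<Union>n. U n)"
      have W: "openin T W" unfolding W_def using FU(2) by auto
      have "measure p (\<Union>n. U n - F n) \<le> (\<Sum>n. measure p (U n - F n))"
      proof (rule finite_measure_subadditive_countably)
        show "range (\<lambda>n. U n - F n) \<subseteq> sets p" using op[OF FU(2)] cl[OF FU(1)] by auto
        show "summable (\<lambda>n. measure p (U n - F n))"
          using FU(5) by (intro summable_comparison_test'[OF sums_summable[OF ds]]) (auto simp: less_imp_le)
      qed
      also have "\<dots> \<le> (\<Sum>n. \<delta> n)"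
        using FU(5)
        by (intro suminf_le sums_summable[OF ds] summable_comparison_test'[OF sums_summable[OF ds]])
           (auto simp: less_imp_le)
      also have "\<dots> = e/2" using ds by (simp add: sums_iff)
      finally have le: "measure p (\<Union>n. U n - F n) \<le> e/2" .
      \<comment> \<open>The union of all \<open>F n\<close> need not be closed. Finite unions are,
        and they exhaust it, so continuity from above finds a \<open>k\<close> that is good
        enough.\<close>
      define G where "G k = (\<Union>n\<le>k. F n)" for k :: nat
      have G: "closedin T (G k)" for k unfolding G_def using FU(1) by (intro closedin_Union) auto
      have lim: "(\<lambda>k. measure p (W - G k)) \<longlonglongrightarrow> measure p (\<Inter>k. W - G k)"
      proof (rule finite_Lim_measure_decseq)
        show "range (\<lambda>k. W - G k) \<subseteq> sets p" using op[OF W] cl[OF G] by auto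
        show "decseq (\<lambda>k. W - G k)" unfolding decseq_def G_def by (meson Diff_mono UN_mono atMost_subset_iff order_refl)
      qed
      have "measure p (\<Inter>k. W - G k) \<le> measure p (\<Union>n. U n - F n)"
      proof (rule finite_measure_mono)
        show "(\<Inter>k. W - G k) \<subseteq> (\<Union>n. U n - F n)" unfolding W_def G_def by auto
        show "(\<Union>n. U n - F n) \<in> sets p" using op[OF FU(2)] cl[OF FU(1)] by auto
      qed
      also have "\<dots> < e" using le e by simp
      finally have "measure p (\<Inter>k. W - G k) < e" .
      from order_tendstoD(2)[OF lim this] obtain k where k: "measure p (W - G k) < e"
        by (auto simp: eventually_sequentially)
      have "G k \<subseteq> (\<Union>i. A i)" "(\<Union>i. A i) \<subseteq> W"
        unfolding G_def W_def using FU(3,4) by blast+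
      with k W G[of k] show "\<exists>F U. closedin T F \<and> openin T U \<and> F \<subseteq> (\<Union>i. A i) \<and> (\<Union>i. A i) \<subseteq> U
          \<and> measure p (U - F) < e"
        by (intro exI[of _ "G k"] exI[of _ W] conjI)
    qed
  qed
  moreover have "A \<in> sigma_sets (topspace T) {U. openin T U}"
    using A s by (simp add: sets_borel_of)
  ultimately obtain F U where "closedin T F" "openin T U" "F \<subseteq> A" "A \<subseteq> U" "measure p (U - F) < e"
    using e by meson
  then show ?thesis by (rule that)
qed

text \<open>On a metrizable space tightness is all that has to be checked: a closed set that
  approximates \<open>A\<close> from inside becomes compact after intersection with a compact set
  carrying almost all of the mass.\<close>

lemma tight_imp_radon_prob:
  assumes T: "metrizable_space T" and s: "sets p = sets (borel_of T)" and p: "prob_space p"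
    and tight: "\<And>e. 0 < e \<Longrightarrow> \<exists>K. compactin T K \<and> measure p (topspace T - K) \<le> e"
  shows "radon_prob T p"
proof (rule radon_probI_diff[OF T s p])
  interpret prob_space p by (rule p)
  fix A and e :: real assume A: "A \<in> sets p" and e: "0 < e"
  obtain K where K: "compactin T K" "measure p (topspace T - K) \<le> e/2"
    using tight[of "e/2"] e by auto
  obtain F U where FU: "closedin T F" "openin T U" "F \<subseteq> A" "A \<subseteq> U" "measure p (U - F) < e/2"
    using metrizable_closed_open_regular[OF T s finite_measure_axioms A, of "e/2"] e by auto
  have Fs: "F \<in> sets p" "U \<in> sets p" "K \<in> sets p" "topspace T \<in> sets p"
    using FU(1,2) K(1) borel_of_compact[OF T] s by auto
  have "A - (F \<inter> K) \<subseteq> (U - F) \<union> (topspace T - K)"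
    using FU(4) openin_subset[OF FU(2)] by auto
  then have "measure p (A - (F \<inter> K)) \<le> measure p ((U - F) \<union> (topspace T - K))"
    using Fs by (intro finite_measure_mono) auto
  also have "\<dots> \<le> measure p (U - F) + measure p (topspace T - K)"
    using Fs by (intro measure_subadditive) auto
  also have "\<dots> \<le> e" using FU(5) K(2) by simp
  finally have "measure p (A - (F \<inter> K)) \<le> e" .
  moreover have "compactin T (F \<inter> K)"
    using FU(1) K(1) by (simp add: closed_Int_compactin)
  ultimately show "\<exists>K. compactin T K \<and> K \<subseteq> A \<and> measure p (A - K) \<le> e"
    using FU(3) by (intro exI[of _ "F \<inter> K"]) auto
qed

text \<open>The substitute for separability of the space: countable unions of compact sets have
  countable bases, and every Radon probability lives on one of them.\<close>

lemma radon_prob_sigma_compact: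
  assumes T: "metrizable_space T" and p: "radon_prob T p"
  obtains K :: "nat \<Rightarrow> 'a set" where "\<And>n. compactin T (K n)" "measure p (topspace T - (\<Union>n. K n)) = 0"
proof -
  interpret prob_space p using p by (rule radon_probD)
  have ts: "topspace T \<in> sets p" using radon_probD[OF p] by auto
  have "\<exists>K. compactin T K \<and> measure p (topspace T - K) < inverse (Suc n)" for n
    by (rule radon_prob_inner_diff[OF T p ts, of "inverse (Suc n)"]) auto
  then obtain K where K: "\<And>n. compactin T (K n)" "\<And>n. measure p (topspace T - K n) < inverse (Suc n)"
    by metis
  have Ks: "K n \<in> sets p" for n
    using borel_of_compact[OF T K(1)] radon_probD[OF p] by auto
  have "measure p (topspace T - (\<Union>n. K n)) \<le> measure p (topspace T - K n)" for n
    using Ks ts by (intro finite_measure_mono) auto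
  then have lt: "measure p (topspace T - (\<Union>n. K n)) < inverse (Suc n)" for n
    using K(2) by (rule order_le_less_trans)
  have "measure p (topspace T - (\<Union>n. K n)) \<le> e" if e: "e > 0" for e
  proof -
    obtain n where "inverse (real (Suc n)) < e" using reals_Archimedean[OF e] by auto
    with lt[of n] show ?thesis by simp
  qed
  then have "measure p (topspace T - (\<Union>n. K n)) = 0"
    using field_le_epsilon[of "measure p (topspace T - (\<Union>n. K n))" 0] measure_nonneg[of p] by (simp add: antisym)
  with K(1) show ?thesis by (rule that)
qed

text \<open>The base consists of open sets of the whole space, namely the balls around finite nets
  of \<open>K\<close>. Thus it generates neighbourhoods in \<open>T\<close> of the points of
  \<open>K\<close>, which is more than a base of the subspace.\<close>

lemma compactin_countable_base:
  assumes T: "metrizable_space T" and K: "compactin T K"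
  obtains B where "countable B" "\<And>V. V \<in> B \<Longrightarrow> openin T V"
    "\<And>U x. openin T U \<Longrightarrow> x \<in> U \<Longrightarrow> x \<in> K \<Longrightarrow> \<exists>V\<in>B. x \<in> V \<and> V \<subseteq> U"
proof -
  obtain M d where "Metric_space M d" and Teq: "T = Metric_space.mtopology M d"
    using T metrizable_space_def by blast
  interpret Metric_space M d by fact
  have "mtotally_bounded K"
    using K compactin_imp_mtotally_bounded by (simp add: Teq)
  then have "\<forall>n. \<exists>F. finite F \<and> F \<subseteq> K \<and> K \<subseteq> (\<Union>x\<in>F. mball x (inverse (Suc n)))"
    unfolding mtotally_bounded_def by simp
  then obtain F where F: "\<And>n. finite (F n)" "\<And>n. F n \<subseteq> K"
    "\<And>n. K \<subseteq> (\<Union>x\<in>F n. mball x (inverse (Suc n)))"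
    by metis
  define B where "B = (\<Union>n. (\<lambda>x. mball x (inverse (Suc n))) ` F n)"
  show ?thesis
  proof
    show "countable B" unfolding B_def using F(1) by (intro countable_UN) (auto simp: countable_finite)
    show "openin T V" if "V \<in> B" for V using that by (auto simp: B_def Teq)
    fix U x assume U: "openin T U" and x: "x \<in> U" "x \<in> K"
    then obtain r where r: "r > 0" "mball x r \<subseteq> U"
      by (auto simp: Teq openin_mtopology)
    \<comment> \<open>Half the radius, because the ball that is found contains \<open>x\<close> but
      is centred at a point of the net.\<close>
    obtain n where n: "inverse (Suc n) < r/2"
      using r(1) reals_Archimedean[of "r/2"] by auto
    obtain y where y: "y \<in> F n" "x \<in> mball y (inverse (Suc n))" using F(3)[of n] x(2) by auto
    have "mball y (inverse (Suc n)) \<subseteq> mball x r"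
      using y n by (intro mball_subset) auto
    with y r show "\<exists>V\<in>B. x \<in> V \<and> V \<subseteq> U" by (auto simp: B_def)
  qed
qed

lemma sigma_compact_countable_base:
  assumes T: "metrizable_space T" and K: "\<And>n::nat. compactin T (K n)"
  obtains B where "countable B" "\<And>V. V \<in> B \<Longrightarrow> openin T V"
    "\<And>U x. openin T U \<Longrightarrow> x \<in> U \<Longrightarrow> x \<in> (\<Union>n. K n) \<Longrightarrow> \<exists>V\<in>B. x \<in> V \<and> V \<subseteq> U"
proof -
  have "\<exists>B. countable B \<and> (\<forall>V\<in>B. openin T V) \<and>
    (\<forall>U x. openin T U \<longrightarrow> x \<in> U \<longrightarrow> x \<in> K n \<longrightarrow> (\<exists>V\<in>B. x \<in> V \<and> V \<subseteq> U))" for n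
    by (rule compactin_countable_base[OF T K[of n]]) blast
  then obtain B where B: "\<And>n. countable (B n)" "\<And>n V. V \<in> B n \<Longrightarrow> openin T V"
    "\<And>n U x. openin T U \<Longrightarrow> x \<in> U \<Longrightarrow> x \<in> K n \<Longrightarrow> \<exists>V\<in>B n. x \<in> V \<and> V \<subseteq> U"
    by metis
  show ?thesis
  proof (rule that[of "\<Union>n. B n"])
    show "countable (\<Union>n. B n)" using B(1) by auto
    show "openin T V" if "V \<in> (\<Union>n. B n)" for V using that B(2) by auto
    show "\<exists>V\<in>\<Union>n. B n. x \<in> V \<and> V \<subseteq> U" if "openin T U" "x \<in> U" "x \<in> (\<Union>n. K n)" for U x
    proof -
      from that(3) obtain n where "x \<in> K n" by auto
      from B(3)[OF that(1,2) this] show ?thesis by auto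
    qed
  qed
qed

section \<open>Measures on products with Radon marginals\<close>

text \<open>With countable bases at the points of both factors, an open set of the product agrees on
  the rectangle with a countable union of open rectangles. Put as measurability of the identity,
  this serves both to pull sets back and to push measures forward to the larger
  sigma-algebra.\<close>

lemma id_measurable_sigma_compact_rectangle:
  assumes S: "metrizable_space S" and T: "metrizable_space T"
    and K: "\<And>n::nat. compactin S (K n)" and L: "\<And>n::nat. compactin T (L n)"
  shows "id \<in> measurable (restrict_space (borel_of S \<Otimes>\<^sub>M borel_of T) ((\<Union>n. K n) \<times> (\<Union>n. L n)))
           (borel_of (prod_topology S T))"
proof -
  let ?S = "\<Union>n. K n" and ?T = "\<Union>n. L n" and ?P = "borel_of S \<Otimes>\<^sub>M borel_of T"
  have "?S \<in> sets (borel_of S)" "?T \<in> sets (borel_of T)"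
    using borel_of_compact[OF S K] borel_of_compact[OF T L] by auto
  then have ST: "?S \<times> ?T \<in> sets ?P" by auto
  have sub: "?S \<subseteq> topspace S" "?T \<subseteq> topspace T"
    using compactin_subset_topspace[OF K] compactin_subset_topspace[OF L] by auto
  obtain B where B: "countable B" "\<And>V. V \<in> B \<Longrightarrow> openin S V"
    "\<And>U x. openin S U \<Longrightarrow> x \<in> U \<Longrightarrow> x \<in> ?S \<Longrightarrow> \<exists>V\<in>B. x \<in> V \<and> V \<subseteq> U"
    using sigma_compact_countable_base[where K=K, OF S K] by blast
  obtain C where C: "countable C" "\<And>V. V \<in> C \<Longrightarrow> openin T V"
    "\<And>U x. openin T U \<Longrightarrow> x \<in> U \<Longrightarrow> x \<in> ?T \<Longrightarrow> \<exists>V\<in>C. x \<in> V \<and> V \<subseteq> U"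
    using sigma_compact_countable_base[where K=L, OF T L] by blast
  show ?thesis
  proof (rule measurable_borel_ofI)
    show "id x \<in> topspace (prod_topology S T)" if "x \<in> space (restrict_space ?P (?S \<times> ?T))" for x
      using that sub by (auto simp: space_restrict_space)
    fix U assume U: "openin (prod_topology S T) U"
    define D where "D = {(V, W). V \<in> B \<and> W \<in> C \<and> V \<times> W \<subseteq> U}"
    have "countable D"
      by (rule countable_subset[of _ "B \<times> C"]) (auto simp: D_def B(1) C(1))
    moreover have "V \<times> W \<in> sets ?P" if "(V, W) \<in> D" for V W
      using that B(2) C(2) by (auto simp: D_def)
    ultimately have *: "(\<Union>(V, W)\<in>D. V \<times> W) \<in> sets ?P"
      by (intro sets.countable_UN') auto
    have "U \<inter> (?S \<times> ?T) = (\<Union>(V, W)\<in>D. V \<times> W) \<inter> (?S \<times> ?T)" (is "?l = ?r")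
    proof
      show "?l \<subseteq> ?r"
      proof
        fix z assume z: "z \<in> ?l"
        obtain x y where xy: "z = (x, y)" by (cases z)
        have zU: "(x, y) \<in> U" using z xy by simp
        from U[unfolded openin_prod_topology_alt, rule_format, OF zU]
        obtain V W where VW: "openin S V" "openin T W" "x \<in> V" "y \<in> W" "V \<times> W \<subseteq> U" by blast
        from z xy have x: "x \<in> ?S" and y: "y \<in> ?T" by auto
        obtain V' where V': "V' \<in> B" "x \<in> V'" "V' \<subseteq> V" using B(3)[OF VW(1,3) x] by blast
        obtain W' where W': "W' \<in> C" "y \<in> W'" "W' \<subseteq> W" using C(3)[OF VW(2,4) y] by blast
        have "(V', W') \<in> D" using V' W' VW(5) unfolding D_def by blast
        then show "z \<in> ?r" using V'(2) W'(2) x y xy by (auto intro!: bexI[of _ "(V', W')"])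
      qed
      show "?r \<subseteq> ?l" by (auto simp: D_def)
    qed
    then have "U \<inter> (?S \<times> ?T) \<in> sets ?P" using * ST by auto
    moreover have "space (restrict_space ?P (?S \<times> ?T)) = ?S \<times> ?T"
      using sub by (auto simp: space_restrict_space space_pair_measure)
    moreover have "(?S \<times> ?T) \<inter> space ?P \<in> sets ?P" using ST by auto
    ultimately show "id -` U \<inter> space (restrict_space ?P (?S \<times> ?T)) \<in> sets (restrict_space ?P (?S \<times> ?T))"
      by (simp add: sets_restrict_space_iff)
  qed
qed

lemma Int_sigma_compact_rectangle_in_pair_sets:
  assumes S: "metrizable_space S" and T: "metrizable_space T"
    and K: "\<And>n::nat. compactin S (K n)" and L: "\<And>n::nat. compactin T (L n)"
    and E: "E \<in> sets (borel_of (prod_topology S T))"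
  shows "E \<inter> ((\<Union>n. K n) \<times> (\<Union>n. L n)) \<in> sets (borel_of S \<Otimes>\<^sub>M borel_of T)"
proof -
  let ?S = "\<Union>n. K n" and ?T = "\<Union>n. L n" and ?P = "borel_of S \<Otimes>\<^sub>M borel_of T"
  have "?S \<in> sets (borel_of S)" "?T \<in> sets (borel_of T)"
    using borel_of_compact[OF S K] borel_of_compact[OF T L] by auto
  then have ST: "?S \<times> ?T \<in> sets ?P" by auto
  have sub: "?S \<subseteq> topspace S" "?T \<subseteq> topspace T"
    using compactin_subset_topspace[OF K] compactin_subset_topspace[OF L] by auto
  from measurable_sets[OF id_measurable_sigma_compact_rectangle[OF S T K L] E]
  have "E \<inter> space (restrict_space ?P (?S \<times> ?T)) \<in> sets (restrict_space ?P (?S \<times> ?T))" by simp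
  moreover have "space (restrict_space ?P (?S \<times> ?T)) = ?S \<times> ?T"
    using sub by (auto simp: space_restrict_space space_pair_measure)
  moreover have "(?S \<times> ?T) \<inter> space ?P \<in> sets ?P" using ST by auto
  ultimately show ?thesis by (simp add: sets_restrict_space_iff)
qed

section \<open>Couplings with Radon marginals\<close>

lemma measurable_fst_borel_of: "fst \<in> measurable (borel_of (prod_topology S T)) (borel_of S)"
  by (rule continuous_map_measurable[OF continuous_map_fst])

lemma measurable_snd_borel_of: "snd \<in> measurable (borel_of (prod_topology S T)) (borel_of T)"
  by (rule continuous_map_measurable[OF continuous_map_snd])

lemma id_measurable_prod_topology:
  "id \<in> measurable (borel_of (prod_topology S T)) (borel_of S \<Otimes>\<^sub>M borel_of T)"
  using measurable_Pair[OF measurable_fst_borel_of measurable_snd_borel_of, of S T] by (simp add: id_def)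

lemma Times_in_borel_of_prod:
  assumes "A \<in> sets (borel_of S)" "B \<in> sets (borel_of T)"
  shows "A \<times> B \<in> sets (borel_of (prod_topology S T))"
proof -
  have "A \<times> B \<in> sets (borel_of S \<Otimes>\<^sub>M borel_of T)" using assms by auto
  from measurable_sets[OF id_measurable_prod_topology this]
  have "A \<times> B \<inter> topspace S \<times> topspace T \<in> sets (borel_of (prod_topology S T))" by simp
  moreover have "A \<times> B \<inter> topspace S \<times> topspace T = A \<times> B"
    using assms[THEN sets.sets_into_space] by auto
  ultimately show ?thesis by simp
qed

text \<open>The two factors may have different types and topologies, because gluing couples a
  measure that already lives on a product with a third one. Metrizability and the Radon property are
  bundled, so that one hypothesis gives access to compact approximation on both sides.\<close>

definition radon_coupling :: "'a topology \<Rightarrow> 'b topology \<Rightarrow> 'a measure \<Rightarrow> 'b measure \<Rightarrow> ('a \<times> 'b) measure \<Rightarrow> bool"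
  where "radon_coupling S T p q r \<longleftrightarrow>
    metrizable_space S \<and> metrizable_space T \<and> radon_prob S p \<and> radon_prob T q \<and>
    sets r = sets (borel_of (prod_topology S T)) \<and> prob_space r \<and>
    distr r (borel_of S) fst = p \<and> distr r (borel_of T) snd = q"

lemma radon_couplingD:
  assumes "radon_coupling S T p q r"
  shows "metrizable_space S" "metrizable_space T" "radon_prob S p" "radon_prob T q"
    "sets r = sets (borel_of (prod_topology S T))" "prob_space r"
    "distr r (borel_of S) fst = p" "distr r (borel_of T) snd = q"
    "space r = topspace S \<times> topspace T"
    "fst \<in> measurable r (borel_of S)" "snd \<in> measurable r (borel_of T)"
    "metrizable_space (prod_topology S T)"
  using assms measurable_fst_borel_of measurable_snd_borel_of
    sets_eq_imp_space_eq[of r "borel_of (prod_topology S T)"]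
  by (auto simp: radon_coupling_def metrizable_space_prod_topology cong: measurable_cong_sets)

lemma radon_coupling_emeasure_fst:
  assumes "radon_coupling S T p q r" "A \<in> sets (borel_of S)"
  shows "emeasure r (A \<times> topspace T) = emeasure p A" "A \<times> topspace T \<in> sets r"
proof -
  note r = radon_couplingD[OF assms(1)]
  have *: "fst -` A \<inter> space r = A \<times> topspace T"
    using sets.sets_into_space[OF assms(2)] by (auto simp: r)
  show "emeasure r (A \<times> topspace T) = emeasure p A"
    unfolding r(7)[symmetric] using emeasure_distr[OF r(10) assms(2)] by (simp add: *)
  show "A \<times> topspace T \<in> sets r" using measurable_sets[OF r(10) assms(2)] by (simp add: *)
qed

lemma radon_coupling_emeasure_snd:
  assumes "radon_coupling S T p q r" "B \<in> sets (borel_of T)"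
  shows "emeasure r (topspace S \<times> B) = emeasure q B" "topspace S \<times> B \<in> sets r"
proof -
  note r = radon_couplingD[OF assms(1)]
  have *: "snd -` B \<inter> space r = topspace S \<times> B"
    using sets.sets_into_space[OF assms(2)] by (auto simp: r)
  show "emeasure r (topspace S \<times> B) = emeasure q B"
    unfolding r(8)[symmetric] using emeasure_distr[OF r(11) assms(2)] by (simp add: *)
  show "topspace S \<times> B \<in> sets r" using measurable_sets[OF r(11) assms(2)] by (simp add: *)
qed

text \<open>The compact sets come from the marginals alone. One sigma-compact rectangle therefore
  carries all couplings of \<open>p\<close> and \<open>q\<close> at once, which makes two of them
  comparable.\<close>

lemma radon_coupling_sigma_compact:
  assumes r: "radon_coupling S T p q r"
  obtains K :: "nat \<Rightarrow> 'a set" and L :: "nat \<Rightarrow> 'b set"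
  where "\<And>n. compactin S (K n)" "\<And>n. compactin T (L n)"
    "\<And>r' E. radon_coupling S T p q r' \<Longrightarrow> E \<in> sets r' \<Longrightarrow>
      emeasure r' E = emeasure r' (E \<inter> ((\<Union>n. K n) \<times> (\<Union>n. L n)))"
proof -
  note D = radon_couplingD[OF r]
  obtain K :: "nat \<Rightarrow> 'a set" where K: "\<And>n. compactin S (K n)" "measure p (topspace S - (\<Union>n. K n)) = 0"
    using radon_prob_sigma_compact[OF D(1,3)] by blast
  obtain L :: "nat \<Rightarrow> 'b set" where L: "\<And>n. compactin T (L n)" "measure q (topspace T - (\<Union>n. L n)) = 0"
    using radon_prob_sigma_compact[OF D(2,4)] by blast
  let ?S = "\<Union>n. K n" and ?T = "\<Union>n. L n"
  have s: "?S \<in> sets (borel_of S)" "?T \<in> sets (borel_of T)"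
    using borel_of_compact[OF D(1) K(1)] borel_of_compact[OF D(2) L(1)] by auto
  have pq: "emeasure p (topspace S - ?S) = 0" "emeasure q (topspace T - ?T) = 0"
    using K(2) L(2) radon_probD(2)[OF D(3)] radon_probD(2)[OF D(4)]
    by (simp_all add: finite_measure.emeasure_eq_measure prob_space.finite_measure)
  show ?thesis
  proof (rule that[OF K(1) L(1)])
    fix r' E assume r': "radon_coupling S T p q r'" and E: "E \<in> sets r'"
    note D' = radon_couplingD[OF r']
    have N1: "(topspace S - ?S) \<times> topspace T \<in> null_sets r'"
      using radon_coupling_emeasure_fst[OF r', of "topspace S - ?S"] s(1) pq(1)
        sets.compl_sets[OF s(1)] by (auto simp: null_sets_def)
    have N2: "topspace S \<times> (topspace T - ?T) \<in> null_sets r'"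
      using radon_coupling_emeasure_snd[OF r', of "topspace T - ?T"] s(2) pq(2)
        sets.compl_sets[OF s(2)] by (auto simp: null_sets_def)
    have "AE z in r'. z \<notin> (topspace S - ?S) \<times> topspace T" "AE z in r'. z \<notin> topspace S \<times> (topspace T - ?T)"
      using AE_not_in N1 N2 by blast+
    then have "AE z in r'. z \<in> E \<longleftrightarrow> z \<in> E \<inter> (?S \<times> ?T)"
      using AE_space by eventually_elim (auto simp: D')
    moreover have "?S \<times> ?T \<in> sets r'" using Times_in_borel_of_prod[OF s] D'(5) by simp
    ultimately show "emeasure r' E = emeasure r' (E \<inter> (?S \<times> ?T))"
      using E by (intro emeasure_eq_AE) auto
  qed
qed

text \<open>Rectangles are stable under intersection and generate the product of the Borel
  sigma-algebras. The remaining Borel sets of the product topology enter that sigma-algebra once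
  they are cut down to the common sigma-compact rectangle, which costs no mass.\<close>

lemma radon_coupling_eqI:
  assumes r: "radon_coupling S T p q r" and r': "radon_coupling S T p q r'"
    and eq: "\<And>A B. A \<in> sets (borel_of S) \<Longrightarrow> B \<in> sets (borel_of T) \<Longrightarrow>
      emeasure r (A \<times> B) = emeasure r' (A \<times> B)"
  shows "r = r'"
proof -
  note D = radon_couplingD[OF r] and D' = radon_couplingD[OF r']
  let ?P = "borel_of S \<Otimes>\<^sub>M borel_of T"
  have id: "id \<in> measurable r ?P" "id \<in> measurable r' ?P"
    using id_measurable_prod_topology by (auto simp: D(5) D'(5) cong: measurable_cong_sets)
  have eqP: "distr r ?P id = distr r' ?P id"
  proof (rule measure_eqI_generator_eq[OF Int_stable_pair_measure_generator[of "borel_of S" "borel_of T"]])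
    let ?E = "{a \<times> b |a b. a \<in> sets (borel_of S) \<and> b \<in> sets (borel_of T)}"
    show "?E \<subseteq> Pow (space ?P)"
      using sets.space_closed[of "borel_of S"] sets.space_closed[of "borel_of T"]
      by (auto simp: space_pair_measure)
    show "sets (distr r ?P id) = sigma_sets (space ?P) ?E" "sets (distr r' ?P id) = sigma_sets (space ?P) ?E"
      by (simp_all add: sets_pair_measure space_pair_measure)
    show "range (\<lambda>_::nat. space ?P) \<subseteq> ?E" "(\<Union>i::nat. space ?P) = space ?P"
      by (auto simp: space_pair_measure intro!: exI[of _ "topspace S"] exI[of _ "topspace T"])
    show "emeasure (distr r ?P id) (space ?P) \<noteq> \<infinity>"
      using D(6) id by (simp add: emeasure_distr prob_space.emeasure_space_1 measurable_space[OF id(1)]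
          prob_space.finite_measure finite_measure.emeasure_finite)
    fix X assume "X \<in> ?E"
    then obtain A B where X: "X = A \<times> B" and AB: "A \<in> sets (borel_of S)" "B \<in> sets (borel_of T)" by auto
    have sub: "A \<subseteq> topspace S" "B \<subseteq> topspace T" using AB[THEN sets.sets_into_space] by auto
    have "X \<inter> space r = X" "X \<inter> space r' = X" using sub by (auto simp: D D' X)
    then show "emeasure (distr r ?P id) X = emeasure (distr r' ?P id) X"
      using id AB eq[OF AB] by (simp add: emeasure_distr X)
  qed
  obtain K :: "nat \<Rightarrow> 'a set" and L :: "nat \<Rightarrow> 'b set"
    where K: "\<And>n. compactin S (K n)" and L: "\<And>n. compactin T (L n)" and
    conc: "\<And>r' E. radon_coupling S T p q r' \<Longrightarrow> E \<in> sets r' \<Longrightarrow>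
      emeasure r' E = emeasure r' (E \<inter> ((\<Union>n. K n) \<times> (\<Union>n. L n)))"
    using radon_coupling_sigma_compact[OF r] by blast
  show ?thesis
  proof (rule measure_eqI)
    show "sets r = sets r'" by (simp add: D(5) D'(5))
    fix E assume E: "E \<in> sets r"
    let ?E = "E \<inter> ((\<Union>n. K n) \<times> (\<Union>n. L n))"
    have m: "?E \<in> sets ?P"
      using Int_sigma_compact_rectangle_in_pair_sets[OF D(1,2) K L] E by (simp add: D(5))
    have "?E \<subseteq> space r" using sets.sets_into_space[OF E] by auto
    then have "?E \<inter> space r = ?E" "?E \<inter> space r' = ?E" by (auto simp: D D')
    then have "emeasure r ?E = emeasure r' ?E"
      using arg_cong[OF eqP, of "\<lambda>M. emeasure M ?E"] id m by (simp add: emeasure_distr)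
    then show "emeasure r E = emeasure r' E"
      using conc[OF r E] conc[OF r', of E] E by (simp add: D(5) D'(5))
  qed
qed

text \<open>Tightness is inherited from the marginals: the mass outside \<open>K \<times> L\<close>
  is at most the mass that \<open>p\<close> has outside \<open>K\<close> plus the mass that
  \<open>q\<close> has outside \<open>L\<close>.\<close>

lemma radon_coupling_radon:
  assumes r: "radon_coupling S T p q r"
  shows "radon_prob (prod_topology S T) r"
proof -
  note D = radon_couplingD[OF r]
  interpret prob_space r by (rule D)
  interpret p: prob_space p using radon_probD[OF D(3)] by simp
  interpret q: prob_space q using radon_probD[OF D(4)] by simp
  show ?thesis
  proof (rule tight_imp_radon_prob[OF D(12,5,6)])
    fix e :: real assume e: "0 < e"
    have "topspace S \<in> sets p" "topspace T \<in> sets q"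
      using radon_probD[OF D(3)] radon_probD[OF D(4)] by auto
    with e obtain K L where K: "compactin S K" "K \<in> sets p" "measure p (topspace S - K) < e/2"
      and L: "compactin T L" "L \<in> sets q" "measure q (topspace T - L) < e/2"
      using radon_prob_inner_diff[OF D(1,3), of "topspace S" "e/2"]
        radon_prob_inner_diff[OF D(2,4), of "topspace T" "e/2"] by (metis half_gt_zero)
    have Ks: "K \<in> sets (borel_of S)" "L \<in> sets (borel_of T)"
      using K(2) L(2) radon_probD[OF D(3)] radon_probD[OF D(4)] by auto
    have c: "topspace S - K \<in> sets (borel_of S)" "topspace T - L \<in> sets (borel_of T)"
      using sets.compl_sets[OF Ks(1)] sets.compl_sets[OF Ks(2)] by auto
    note m = radon_coupling_emeasure_fst[OF r c(1)] radon_coupling_emeasure_snd[OF r c(2)]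
    have "topspace (prod_topology S T) - K \<times> L = (topspace S - K) \<times> topspace T \<union> topspace S \<times> (topspace T - L)"
      by auto
    then have "prob (topspace (prod_topology S T) - K \<times> L)
        \<le> prob ((topspace S - K) \<times> topspace T) + prob (topspace S \<times> (topspace T - L))"
      using m by (simp add: measure_subadditive)
    also have "\<dots> = measure p (topspace S - K) + measure q (topspace T - L)"
      using m by (simp add: measure_def)
    also have "\<dots> \<le> e" using K(3) L(3) by simp
    finally have "prob (topspace (prod_topology S T) - K \<times> L) \<le> e" .
    then show "\<exists>K. compactin (prod_topology S T) K \<and> prob (topspace (prod_topology S T) - K) \<le> e"
      using K(1) L(1) by (intro exI[of _ "K \<times> L"]) (auto simp: compactin_Times)
  qed
qed

section \<open>Bimeasures with Radon marginals\<close>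

text \<open>Additivity is only finite and only in each argument separately; this is what integrals
  of densities, products and pointwise limits of couplings visibly satisfy. Countable additivity on
  rectangles is recovered from the marginals.\<close>

locale radon_bimeasure =
  fixes S :: "'a topology" and T :: "'b topology" and p :: "'a measure" and q :: "'b measure"
    and \<beta> :: "'a set \<Rightarrow> 'b set \<Rightarrow> real"
  assumes S: "metrizable_space S" and T: "metrizable_space T"
    and p: "radon_prob S p" and q: "radon_prob T q"
    and nonneg: "\<And>A B. A \<in> sets p \<Longrightarrow> B \<in> sets q \<Longrightarrow> 0 \<le> \<beta> A B"
    and add1: "\<And>A A' B. A \<in> sets p \<Longrightarrow> A' \<in> sets p \<Longrightarrow> A \<inter> A' = {} \<Longrightarrow> B \<in> sets q \<Longrightarrow>
      \<beta> (A \<union> A') B = \<beta> A B + \<beta> A' B"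
    and add2: "\<And>A B B'. A \<in> sets p \<Longrightarrow> B \<in> sets q \<Longrightarrow> B' \<in> sets q \<Longrightarrow> B \<inter> B' = {} \<Longrightarrow>
      \<beta> A (B \<union> B') = \<beta> A B + \<beta> A B'"
    and marg1: "\<And>A. A \<in> sets p \<Longrightarrow> \<beta> A (topspace T) = measure p A"
    and marg2: "\<And>B. B \<in> sets q \<Longrightarrow> \<beta> (topspace S) B = measure q B"
begin

lemma sets_p [simp]: "sets p = sets (borel_of S)" and sets_q [simp]: "sets q = sets (borel_of T)"
  using radon_probD p q by auto

lemma split1:
  assumes "A \<in> sets p" "C \<in> sets p" "B \<in> sets q"
  shows "\<beta> A B = \<beta> (A \<inter> C) B + \<beta> (A - C) B"
  using add1[of "A \<inter> C" "A - C" B] assms by (simp add: Int_Diff_Un Int_Diff_disjoint)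

lemma split2:
  assumes "A \<in> sets p" "B \<in> sets q" "C \<in> sets q"
  shows "\<beta> A B = \<beta> A (B \<inter> C) + \<beta> A (B - C)"
  using add2[of A "B \<inter> C" "B - C"] assms by (simp add: Int_Diff_Un Int_Diff_disjoint)

lemma empty1: "B \<in> sets q \<Longrightarrow> \<beta> {} B = 0"
  using add1[of "{}" "{}" B] by simp

lemma empty2: "A \<in> sets p \<Longrightarrow> \<beta> A {} = 0"
  using add2[of A "{}" "{}"] by simp

lemma mono1:
  assumes "A \<in> sets p" "A' \<in> sets p" "A \<subseteq> A'" "B \<in> sets q"
  shows "\<beta> A B \<le> \<beta> A' B"
  using split1[of A' A B] assms nonneg[of "A' - A" B] by (simp add: Int_absorb1)

lemma mono2:
  assumes "A \<in> sets p" "B \<in> sets q" "B' \<in> sets q" "B \<subseteq> B'"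
  shows "\<beta> A B \<le> \<beta> A B'"
  using split2[of A B' B] assms nonneg[of A "B' - B"] by (simp add: Int_absorb1)

lemma space_p [simp]: "space p = topspace S" and space_q [simp]: "space q = topspace T"
  using radon_probD(3)[OF p] radon_probD(3)[OF q] by auto

lemma top: "topspace S \<in> sets p" "topspace T \<in> sets q"
  by auto

lemma le_p: assumes "A \<in> sets p" "B \<in> sets q" shows "\<beta> A B \<le> measure p A"
  using mono2[OF assms top(2)] marg1[OF assms(1)] sets.sets_into_space[OF assms(2)] by simp

lemma le_q: assumes "A \<in> sets p" "B \<in> sets q" shows "\<beta> A B \<le> measure q B"
  using mono1[OF assms(1) top(1) _ assms(2)] marg2[OF assms(2)] sets.sets_into_space[OF assms(1)] by simp

text \<open>Shrinking the sides of a rectangle costs no more than the marginals charge for it. This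
  lets compact and open sides stand in for measurable ones.\<close>

lemma approx:
  assumes "A \<in> sets p" "A' \<in> sets p" "B \<in> sets q" "B' \<in> sets q" "A' \<subseteq> A" "B' \<subseteq> B"
  shows "\<beta> A B \<le> \<beta> A' B' + measure p (A - A') + measure q (B - B')"
proof -
  have "\<beta> A B = \<beta> A' B' + \<beta> A' (B - B') + \<beta> (A - A') B"
    using split1[of A A' B] split2[of A' B B'] assms by (simp add: Int_absorb1)
  moreover have "\<beta> A' (B - B') \<le> measure q (B - B')" "\<beta> (A - A') B \<le> measure p (A - A')"
    using assms by (auto intro!: le_q le_p)
  ultimately show ?thesis by simp
qed

text \<open>Cut the first factor along \<open>A k\<close>. Over \<open>A k\<close>, the other
  rectangles are disjoint from \<open>A k \<times> B k\<close> and hence fit into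
  \<open>A k \<times> (B0 - B k)\<close>; the rest lies over \<open>A0 - A k\<close>. Either part
  has one rectangle less.\<close>

lemma superadditive:
  fixes k :: nat
  assumes "\<And>n. n < k \<Longrightarrow> A n \<in> sets p" "\<And>n. n < k \<Longrightarrow> B n \<in> sets q" "A0 \<in> sets p" "B0 \<in> sets q"
    and "\<And>n. n < k \<Longrightarrow> A n \<times> B n \<subseteq> A0 \<times> B0"
    and "\<And>m n. m < k \<Longrightarrow> n < k \<Longrightarrow> m \<noteq> n \<Longrightarrow> (A m \<times> B m) \<inter> (A n \<times> B n) = {}"
  shows "(\<Sum>n<k. \<beta> (A n) (B n)) \<le> \<beta> A0 B0"
  using assms
proof (induction k arbitrary: A A0 B0)
  case 0
  then show ?case by (simp add: nonneg)
next
  case (Suc k)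
  have m: "A n \<in> sets p" "B n \<in> sets q" if "n \<le> k" for n using Suc.prems(1,2) that by auto
  show ?case
  \<comment> \<open>An empty rectangle is contained in every rectangle, so the inclusion of the
    sides is available only if both sides are inhabited.\<close>
  proof (cases "A k = {} \<or> B k = {}")
    case True
    have "(\<Sum>n<k. \<beta> (A n) (B n)) \<le> \<beta> A0 B0"
      by (rule Suc.IH) (use Suc.prems in auto)
    moreover have "\<beta> (A k) (B k) = 0" using True m[of k] empty1 empty2 by auto
    ultimately show ?thesis by simp
  next
    case False
    then have sub: "A k \<subseteq> A0" "B k \<subseteq> B0" using Suc.prems(5)[of k] by (auto simp: times_subset_iff)
    have 1: "(\<Sum>n<k. \<beta> (A n \<inter> A k) (B n)) \<le> \<beta> (A k) (B0 - B k)"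
    proof (rule Suc.IH)
      show "(A n \<inter> A k) \<times> B n \<subseteq> A k \<times> (B0 - B k)" if "n < k" for n
      proof -
        have "A n \<times> B n \<subseteq> A0 \<times> B0" "(A n \<times> B n) \<inter> (A k \<times> B k) = {}"
          using Suc.prems(5)[of n] Suc.prems(6)[of n k] that by auto
        then show ?thesis by blast
      qed
      show "((A i \<inter> A k) \<times> B i) \<inter> ((A n \<inter> A k) \<times> B n) = {}" if "i < k" "n < k" "i \<noteq> n" for i n
        using Suc.prems(6)[of i n] that by auto
    qed (use m Suc.prems in auto)
    have 2: "(\<Sum>n<k. \<beta> (A n - A k) (B n)) \<le> \<beta> (A0 - A k) B0"
    proof (rule Suc.IH)
      show "(A n - A k) \<times> B n \<subseteq> (A0 - A k) \<times> B0" if "n < k" for n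
        using Suc.prems(5)[of n] that by auto
      show "((A i - A k) \<times> B i) \<inter> ((A n - A k) \<times> B n) = {}" if "i < k" "n < k" "i \<noteq> n" for i n
        using Suc.prems(6)[of i n] that by auto
    qed (use m Suc.prems in auto)
    have "(\<Sum>n<k. \<beta> (A n) (B n)) = (\<Sum>n<k. \<beta> (A n \<inter> A k) (B n)) + (\<Sum>n<k. \<beta> (A n - A k) (B n))"
      unfolding sum.distrib[symmetric] using m by (intro sum.cong refl split1) auto
    then have "(\<Sum>n<Suc k. \<beta> (A n) (B n)) \<le> \<beta> (A k) (B0 - B k) + \<beta> (A0 - A k) B0 + \<beta> (A k) (B k)"
      using 1 2 by simp
    also have "\<dots> = \<beta> (A k) B0 + \<beta> (A0 - A k) B0"
      using split2[of "A k" B0 "B k"] m[of k] Suc.prems(4) sub(2) by (simp add: Int_absorb1)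
    also have "\<dots> = \<beta> A0 B0"
      using split1[of A0 "A k" B0] m[of k] Suc.prems(3,4) sub(1) by (simp add: Int_absorb1)
    finally show ?thesis .
  qed
qed

text \<open>The same cut along \<open>A k\<close>: over it, the points outside \<open>B k\<close>
  must be covered by the earlier rectangles, and so must everything over
  \<open>A0 - A k\<close>.\<close>

lemma subadditive:
  fixes k :: nat
  assumes "\<And>n. n < k \<Longrightarrow> A n \<in> sets p" "\<And>n. n < k \<Longrightarrow> B n \<in> sets q" "A0 \<in> sets p" "B0 \<in> sets q"
    and "A0 \<times> B0 \<subseteq> (\<Union>n<k. A n \<times> B n)"
  shows "\<beta> A0 B0 \<le> (\<Sum>n<k. \<beta> (A n) (B n))"
  using assms
proof (induction k arbitrary: A A0 B0)
  case 0
  then have "A0 = {} \<or> B0 = {}" by auto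
  then show ?case using 0 empty1 empty2 by auto
next
  case (Suc k)
  have m: "A n \<in> sets p" "B n \<in> sets q" if "n \<le> k" for n using Suc.prems(1,2) that by auto
  have cov: "A0 \<times> B0 \<subseteq> (\<Union>n<k. A n \<times> B n) \<union> A k \<times> B k"
    using Suc.prems(5) by (auto simp: lessThan_Suc)
  have 1: "\<beta> (A0 \<inter> A k) (B0 - B k) \<le> (\<Sum>n<k. \<beta> (A n \<inter> A k) (B n))"
  proof (rule Suc.IH)
    show "(A0 \<inter> A k) \<times> (B0 - B k) \<subseteq> (\<Union>n<k. (A n \<inter> A k) \<times> B n)"
      using cov by blast
  qed (use m Suc.prems in auto)
  have 2: "\<beta> (A0 - A k) B0 \<le> (\<Sum>n<k. \<beta> (A n - A k) (B n))"
  proof (rule Suc.IH)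
    show "(A0 - A k) \<times> B0 \<subseteq> (\<Union>n<k. (A n - A k) \<times> B n)"
      using cov by blast
  qed (use m Suc.prems in auto)
  have "\<beta> A0 B0 = \<beta> (A0 \<inter> A k) B0 + \<beta> (A0 - A k) B0"
    using split1[of A0 "A k" B0] m[of k] Suc.prems(3,4) by simp
  also have "\<beta> (A0 \<inter> A k) B0 = \<beta> (A0 \<inter> A k) (B0 \<inter> B k) + \<beta> (A0 \<inter> A k) (B0 - B k)"
    using split2[of "A0 \<inter> A k" B0 "B k"] m[of k] Suc.prems(3,4) by simp
  also have "\<beta> (A0 \<inter> A k) (B0 \<inter> B k) \<le> \<beta> (A k) (B k)"
    using mono1[of "A0 \<inter> A k" "A k" "B0 \<inter> B k"] mono2[of "A k" "B0 \<inter> B k" "B k"] m[of k] Suc.prems(3,4)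
    by simp
  finally have "\<beta> A0 B0 \<le> \<beta> (A k) (B k) + \<beta> (A0 \<inter> A k) (B0 - B k) + \<beta> (A0 - A k) B0" by simp
  moreover have "(\<Sum>n<k. \<beta> (A n) (B n)) = (\<Sum>n<k. \<beta> (A n \<inter> A k) (B n)) + (\<Sum>n<k. \<beta> (A n - A k) (B n))"
    unfolding sum.distrib[symmetric] using m by (intro sum.cong refl split1) auto
  ultimately show ?case using 1 2 by simp
qed

text \<open>Inner approximation by a compact rectangle and outer approximation by open rectangles reduce
  countable to finite subadditivity.\<close>

lemma countably_subadditive:
  assumes A: "\<And>n. A n \<in> sets p" and B: "\<And>n. B n \<in> sets q" and A0: "A0 \<in> sets p" and B0: "B0 \<in> sets q"
    and cov: "A0 \<times> B0 \<subseteq> (\<Union>n. A n \<times> B n)"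
  shows "ennreal (\<beta> A0 B0) \<le> (\<Sum>n. ennreal (\<beta> (A n) (B n)))"
proof (rule ennreal_le_epsilon)
  fix e :: real assume e: "0 < e"
  \<comment> \<open>Each of the rectangles pays \<open>\<delta> n\<close> for either side, which
    makes \<open>e/2\<close> in total; the compact rectangle inside \<open>A0 \<times> B0\<close>
    costs \<open>e/4\<close> for either side, which is the other half.\<close>
  define \<delta> where "\<delta> n = e / 4 * (1/2) ^ Suc n" for n :: nat
  have \<delta>: "\<delta> n > 0" for n using e by (simp add: \<delta>_def)
  have ds: "(\<lambda>n. \<delta> n) sums (e/4)"
    unfolding \<delta>_def using sums_mult[OF power_half_series, of "e/4"] by simp
  have e4: "e/4 > 0" using e by simp
  obtain K where K: "compactin S K" "K \<subseteq> A0" "K \<in> sets p" "measure p (A0 - K) < e/4"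
    by (rule radon_prob_inner_diff[OF S p A0 e4])
  obtain L where L: "compactin T L" "L \<subseteq> B0" "L \<in> sets q" "measure q (B0 - L) < e/4"
    by (rule radon_prob_inner_diff[OF T q B0 e4])
  have "\<exists>U. openin S U \<and> A n \<subseteq> U \<and> U \<in> sets p \<and> measure p (U - A n) < \<delta> n" for n
    by (rule radon_prob_outer_diff[OF S p A \<delta>, of n n]) blast
  then obtain U where U: "\<And>n. openin S (U n)" "\<And>n. A n \<subseteq> U n" "\<And>n. U n \<in> sets p"
    "\<And>n. measure p (U n - A n) < \<delta> n" by metis
  have "\<exists>U. openin T U \<and> B n \<subseteq> U \<and> U \<in> sets q \<and> measure q (U - B n) < \<delta> n" for n
    by (rule radon_prob_outer_diff[OF T q B \<delta>, of n n]) blast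
  then obtain V where V: "\<And>n. openin T (V n)" "\<And>n. B n \<subseteq> V n" "\<And>n. V n \<in> sets q"
    "\<And>n. measure q (V n - B n) < \<delta> n" by metis
  have KL: "compactin (prod_topology S T) (K \<times> L)" using K(1) L(1) by (simp add: compactin_Times)
  have open_cov: "K \<times> L \<subseteq> \<Union> (range (\<lambda>n. U n \<times> V n))"
  proof -
    have "K \<times> L \<subseteq> (\<Union>n. A n \<times> B n)" using cov K(2) L(2) by blast
    also have "\<dots> \<subseteq> \<Union> (range (\<lambda>n. U n \<times> V n))"
      using U(2) V(2) by (intro UN_mono Sigma_mono) auto
    finally show ?thesis .
  qed
  obtain F where F: "finite F" "F \<subseteq> range (\<lambda>n. U n \<times> V n)" "K \<times> L \<subseteq> \<Union> F"
  proof -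
    have "openin (prod_topology S T) W" if "W \<in> range (\<lambda>n. U n \<times> V n)" for W
      using that U(1) V(1) by (auto simp: openin_prod_Times_iff)
    then show ?thesis using compactinD[OF KL, of "range (\<lambda>n. U n \<times> V n)"] open_cov that by blast
  qed
  obtain I where I: "finite I" "F = (\<lambda>n. U n \<times> V n) ` I"
    using finite_subset_image[OF F(1,2)] by blast
  obtain k where k: "I \<subseteq> {..<k}" using finite_nat_iff_bounded I(1) by blast
  have "K \<times> L \<subseteq> (\<Union>n<k. U n \<times> V n)" using F(3) I(2) k by blast
  then have KLle: "\<beta> K L \<le> (\<Sum>n<k. \<beta> (U n) (V n))"
    using U(3) V(3) K(3) L(3) by (intro subadditive)
  have "\<beta> (U n) (V n) \<le> \<beta> (A n) (B n) + 2 * \<delta> n" for n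
    using approx[OF U(3)[of n] A[of n] V(3)[of n] B[of n] U(2) V(2)] U(4)[of n] V(4)[of n] by simp
  then have "(\<Sum>n<k. \<beta> (U n) (V n)) \<le> (\<Sum>n<k. \<beta> (A n) (B n) + 2 * \<delta> n)" by (rule sum_mono)
  also have "\<dots> = (\<Sum>n<k. \<beta> (A n) (B n)) + 2 * (\<Sum>n<k. \<delta> n)"
    by (simp add: sum.distrib sum_distrib_left)
  also have "(\<Sum>n<k. \<delta> n) \<le> e/4"
    using sum_le_suminf[OF sums_summable[OF ds], of "{..<k}"] \<delta> ds
    by (simp add: less_imp_le sums_iff)
  finally have "\<beta> K L \<le> (\<Sum>n<k. \<beta> (A n) (B n)) + e/2" using KLle by simp
  then have "\<beta> A0 B0 \<le> (\<Sum>n<k. \<beta> (A n) (B n)) + e"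
    using approx[OF A0 K(3) B0 L(3) K(2) L(2)] K(4) L(4) by simp
  then have "ennreal (\<beta> A0 B0) \<le> ennreal ((\<Sum>n<k. \<beta> (A n) (B n)) + e)" by (rule ennreal_leI)
  also have "\<dots> = (\<Sum>n<k. ennreal (\<beta> (A n) (B n))) + ennreal e"
    using e nonneg[OF A B] by (simp add: sum_nonneg)
  also have "\<dots> \<le> (\<Sum>n. ennreal (\<beta> (A n) (B n))) + ennreal e"
    by (intro add_right_mono sum_le_suminf) auto
  finally show "ennreal (\<beta> A0 B0) \<le> (\<Sum>n. ennreal (\<beta> (A n) (B n))) + ennreal e" .
qed

lemma countably_additive:
  assumes A: "\<And>n. A n \<in> sets p" and B: "\<And>n. B n \<in> sets q" and A0: "A0 \<in> sets p" and B0: "B0 \<in> sets q"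
    and disj: "disjoint_family (\<lambda>n. A n \<times> B n)" and Un: "(\<Union>n. A n \<times> B n) = A0 \<times> B0"
  shows "(\<Sum>n. ennreal (\<beta> (A n) (B n))) = ennreal (\<beta> A0 B0)"
proof (rule antisym)
  have "(\<Sum>n<k. ennreal (\<beta> (A n) (B n))) \<le> ennreal (\<beta> A0 B0)" for k
  proof -
    have "(\<Sum>n<k. \<beta> (A n) (B n)) \<le> \<beta> A0 B0"
    proof (rule superadditive)
      show "A n \<times> B n \<subseteq> A0 \<times> B0" for n using Un by blast
      show "(A i \<times> B i) \<inter> (A n \<times> B n) = {}" if "i \<noteq> n" for i n
        using disj that by (auto simp: disjoint_family_on_def)
    qed (use assms in auto)
    moreover have "(\<Sum>n<k. ennreal (\<beta> (A n) (B n))) = ennreal (\<Sum>n<k. \<beta> (A n) (B n))"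
      using nonneg[OF A B] by simp
    ultimately show ?thesis by (simp add: ennreal_leI)
  qed
  then show "(\<Sum>n. ennreal (\<beta> (A n) (B n))) \<le> ennreal (\<beta> A0 B0)"
    unfolding suminf_eq_SUP by (intro SUP_least)
  show "ennreal (\<beta> A0 B0) \<le> (\<Sum>n. ennreal (\<beta> (A n) (B n)))"
    using countably_subadditive[OF A B A0 B0] Un by simp
qed

lemma pair_measure_extension:
  obtains r where "sets r = sets (borel_of S \<Otimes>\<^sub>M borel_of T)"
    "\<And>A B. A \<in> sets p \<Longrightarrow> B \<in> sets q \<Longrightarrow> emeasure r (A \<times> B) = ennreal (\<beta> A B)"
proof -
  let ?P = "\<lambda>A B. A \<in> sets p \<and> B \<in> sets q"
  define r where "r = extend_measure (topspace S \<times> topspace T) {(A, B). ?P A B}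
    (\<lambda>(A, B). A \<times> B) (\<lambda>(A, B). ennreal (\<beta> A B))"
  have sub: "A \<times> B \<subseteq> topspace S \<times> topspace T" if "?P A B" for A B
    using sets.sets_into_space[of A "borel_of S"] sets.sets_into_space[of B "borel_of T"] that by auto
  have "sets r = sigma_sets (topspace S \<times> topspace T) ((\<lambda>(A, B). A \<times> B) ` {(A, B). ?P A B})"
    unfolding r_def using sub by (intro sets_extend_measure) auto
  also have "(\<lambda>(A, B). A \<times> B) ` {(A, B). ?P A B} = {a \<times> b |a b. a \<in> sets (borel_of S) \<and> b \<in> sets (borel_of T)}"
    by auto
  finally have sets_r: "sets r = sets (borel_of S \<Otimes>\<^sub>M borel_of T)" by (simp add: sets_pair_measure)
  have "emeasure r (A \<times> B) = ennreal (\<beta> A B)" if AB: "?P A B" for A B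
  proof (rule extend_measure_caratheodory_pair[OF r_def, of A B])
    show "?P A B" by fact
    show "semiring_of_sets (topspace S \<times> topspace T) {a \<times> b |a b. ?P a b}"
    proof
      show "{a \<times> b |a b. ?P a b} \<subseteq> Pow (topspace S \<times> topspace T)" using sub by blast
      show "{} \<in> {a \<times> b |a b. ?P a b}" by (auto intro!: exI[of _ "{}"])
      fix X Y assume "X \<in> {a \<times> b |a b. ?P a b}" "Y \<in> {a \<times> b |a b. ?P a b}"
      then obtain a b c d where X: "X = a \<times> b" "?P a b" and Y: "Y = c \<times> d" "?P c d" by blast
      have "X \<inter> Y = (a \<inter> c) \<times> (b \<inter> d)" "?P (a \<inter> c) (b \<inter> d)" using X Y by auto
      then show "X \<inter> Y \<in> {a \<times> b |a b. ?P a b}" by blast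
      have "X - Y = \<Union> {(a - c) \<times> b, (a \<inter> c) \<times> (b - d)}" "?P (a - c) b" "?P (a \<inter> c) (b - d)"
        "disjoint {(a - c) \<times> b, (a \<inter> c) \<times> (b - d)}"
        using X Y by (auto simp: disjoint_def)
      then show "\<exists>C\<subseteq>{a \<times> b |a b. ?P a b}. finite C \<and> disjoint C \<and> X - Y = \<Union> C"
        by (intro exI[of _ "{(a - c) \<times> b, (a \<inter> c) \<times> (b - d)}"] conjI) auto
    qed
    show "ennreal (\<beta> a b) = 0" if "?P a b" "a \<times> b = {}" for a b
      using that empty1[of b] empty2[of a] by auto
    \<comment> \<open>A rectangle determines its sides unless it is empty, and then both values are
      0.\<close>
    show "ennreal (\<beta> a b) = ennreal (\<beta> c d)" if "?P a b" "?P c d" "a \<times> b = c \<times> d" for a b c d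
      using that empty1 empty2 by (auto simp: times_eq_iff)
    show "(\<Sum>n. ennreal (\<beta> (X n) (Y n))) = ennreal (\<beta> c d)"
      if "\<And>n. ?P (X n) (Y n)" "?P c d" "disjoint_family (\<lambda>n. X n \<times> Y n)" "(\<Union>i. X i \<times> Y i) = c \<times> d"
      for X Y c d
      by (rule countably_additive) (use that in auto)
  qed simp
  then show ?thesis using sets_r that by auto
qed

text \<open>The Caratheodory extension only reaches the product of the Borel sigma-algebras. To get
  a measure on the Borel sets of the product topology, it is restricted to a sigma-compact rectangle
  of full measure, where the identity is measurable for the larger sigma-algebra, and pushed
  forward.\<close>

theorem radon_coupling_extension:
  obtains r where "radon_coupling S T p q r"
    "\<And>A B. A \<in> sets p \<Longrightarrow> B \<in> sets q \<Longrightarrow> emeasure r (A \<times> B) = ennreal (\<beta> A B)"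
proof -
  obtain r0 where r0: "sets r0 = sets (borel_of S \<Otimes>\<^sub>M borel_of T)"
    "\<And>A B. A \<in> sets p \<Longrightarrow> B \<in> sets q \<Longrightarrow> emeasure r0 (A \<times> B) = ennreal (\<beta> A B)"
    using pair_measure_extension by blast
  obtain K :: "nat \<Rightarrow> 'a set" where K: "\<And>n. compactin S (K n)" "measure p (topspace S - (\<Union>n. K n)) = 0"
    using radon_prob_sigma_compact[OF S p] by blast
  obtain L :: "nat \<Rightarrow> 'b set" where L: "\<And>n. compactin T (L n)" "measure q (topspace T - (\<Union>n. L n)) = 0"
    using radon_prob_sigma_compact[OF T q] by blast
  let ?S = "\<Union>n. K n" and ?T = "\<Union>n. L n"
  have s: "?S \<in> sets p" "?T \<in> sets q"
    using borel_of_compact[OF S K(1)] borel_of_compact[OF T L(1)] by auto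
  have sp0: "space r0 = topspace S \<times> topspace T"
    using sets_eq_imp_space_eq[OF r0(1)] by (simp add: space_pair_measure)
  have ST: "?S \<times> ?T \<in> sets r0" using s by (simp add: r0(1))
  have sub: "?S \<subseteq> topspace S" "?T \<subseteq> topspace T"
    using compactin_subset_topspace[OF K(1)] compactin_subset_topspace[OF L(1)] by auto
  have sr: "space (restrict_space r0 (?S \<times> ?T)) = ?S \<times> ?T"
    using sub by (auto simp: space_restrict_space sp0)
  have mid: "id \<in> measurable (restrict_space r0 (?S \<times> ?T)) (borel_of (prod_topology S T))"
    using id_measurable_sigma_compact_rectangle[where K=K and L=L, OF S T K(1) L(1)]
    by (simp add: measurable_cong_sets[OF sets_restrict_space_cong[OF r0(1)] refl])
  define r where "r = distr (restrict_space r0 (?S \<times> ?T)) (borel_of (prod_topology S T)) id"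
  have rect: "emeasure r (A \<times> B) = ennreal (\<beta> A B)" if A: "A \<in> sets p" and B: "B \<in> sets q" for A B
  proof -
    have AB: "A \<times> B \<in> sets (borel_of (prod_topology S T))"
      using A B by (intro Times_in_borel_of_prod) auto
    have "emeasure r (A \<times> B) = emeasure (restrict_space r0 (?S \<times> ?T)) (A \<times> B \<inter> ?S \<times> ?T)"
      unfolding r_def using mid AB by (simp add: emeasure_distr sr)
    also have "\<dots> = emeasure r0 ((A \<inter> ?S) \<times> (B \<inter> ?T))"
      using ST by (subst emeasure_restrict_space) (auto simp: Times_Int_Times)
    also have "\<dots> = ennreal (\<beta> (A \<inter> ?S) (B \<inter> ?T))"
      using A B s by (intro r0(2)) auto
    \<comment> \<open>The parts of the sides that are cut off are null for the marginals, and
      \<open>approx\<close> transfers this to \<open>\<beta>\<close>.\<close>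
    also have "\<beta> (A \<inter> ?S) (B \<inter> ?T) = \<beta> A B"
    proof -
      interpret P: prob_space p using radon_probD[OF p] by simp
      interpret Q: prob_space q using radon_probD[OF q] by simp
      have "measure p (A - ?S) \<le> measure p (topspace S - ?S)"
        using A s sets.sets_into_space[of A "borel_of S"] by (intro P.finite_measure_mono) auto
      moreover have "measure q (B - ?T) \<le> measure q (topspace T - ?T)"
        using B s sets.sets_into_space[of B "borel_of T"] by (intro Q.finite_measure_mono) auto
      ultimately have "measure p (A - (A \<inter> ?S)) = 0" "measure q (B - (B \<inter> ?T)) = 0"
        using K(2) L(2) by (simp_all add: Diff_Int measure_le_0_iff)
      then have "\<beta> A B \<le> \<beta> (A \<inter> ?S) (B \<inter> ?T)"
        using approx[of A "A \<inter> ?S" B "B \<inter> ?T"] A B s by simp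
      moreover have "\<beta> (A \<inter> ?S) (B \<inter> ?T) \<le> \<beta> A B"
        using mono1[of "A \<inter> ?S" A "B \<inter> ?T"] mono2[of A "B \<inter> ?T" B] A B s by simp
      ultimately show ?thesis by simp
    qed
    finally show ?thesis .
  qed
  have sets_r: "sets r = sets (borel_of (prod_topology S T))" by (simp add: r_def)
  have space_r: "space r = topspace S \<times> topspace T" by (simp add: r_def)
  have "emeasure r (topspace S \<times> topspace T) = 1"
    using rect[OF top] marg1[OF top(1)] radon_probD[OF p]
    by (metis ennreal_1 prob_space.prob_space)
  then have pr: "prob_space r" by (intro prob_spaceI) (simp add: space_r)
  have ms: "fst \<in> measurable r (borel_of S)" "snd \<in> measurable r (borel_of T)"
    using measurable_fst_borel_of measurable_snd_borel_of
    by (auto simp: sets_r cong: measurable_cong_sets)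
  have d1: "distr r (borel_of S) fst = p"
  proof (rule measure_eqI)
    fix A assume "A \<in> sets (distr r (borel_of S) fst)"
    then have A: "A \<in> sets p" by simp
    have "fst -` A \<inter> space r = A \<times> topspace T"
      using A sets.sets_into_space[of A "borel_of S"] by (auto simp: space_r)
    then have "emeasure (distr r (borel_of S) fst) A = ennreal (measure p A)"
      using A ms rect[OF A top(2)] marg1[OF A] by (simp add: emeasure_distr)
    then show "emeasure (distr r (borel_of S) fst) A = emeasure p A"
      using radon_probD(2)[OF p] by (simp add: prob_space.finite_measure finite_measure.emeasure_eq_measure)
  qed simp
  have d2: "distr r (borel_of T) snd = q"
  proof (rule measure_eqI)
    fix A assume "A \<in> sets (distr r (borel_of T) snd)"
    then have A: "A \<in> sets q" by simp
    have "snd -` A \<inter> space r = topspace S \<times> A"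
      using A sets.sets_into_space[of A "borel_of T"] by (auto simp: space_r)
    then have "emeasure (distr r (borel_of T) snd) A = ennreal (measure q A)"
      using A ms rect[OF top(1) A] marg2[OF A] by (simp add: emeasure_distr)
    then show "emeasure (distr r (borel_of T) snd) A = emeasure q A"
      using radon_probD(2)[OF q] by (simp add: prob_space.finite_measure finite_measure.emeasure_eq_measure)
  qed simp
  show ?thesis
    using that[of r] rect S T p q sets_r pr d1 d2 by (auto simp: radon_coupling_def)
qed

end

section \<open>Gluing of couplings\<close>

text \<open>The function \<open>k\<close> is the conditional probability of \<open>E\<close> given
  \<open>g\<close>, for a single set \<open>E\<close>. It is the Radon-Nikodym density, with respect
  to the law of \<open>g\<close>, of the image under \<open>g\<close> of the part of
  \<open>r\<close> on \<open>E\<close>.\<close>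

lemma disintegration_density:
  fixes E :: "'a set"
  assumes r: "prob_space r" and g: "g \<in> measurable r N" and E: "E \<in> sets r"
  obtains k where "k \<in> borel_measurable N"
    "\<And>f. f \<in> borel_measurable N \<Longrightarrow>
      (\<integral>\<^sup>+ t. f t * k t \<partial>distr r N g) = (\<integral>\<^sup>+ z. f (g z) * indicator E z \<partial>r)"
proof -
  interpret prob_space r by (rule r)
  let ?q = "distr r N g"
  interpret q: prob_space ?q using g by (rule prob_space_distr)
  define \<rho> where "\<rho> = distr (density r (indicator E)) N g"
  have g': "g \<in> measurable (density r (indicator E)) N" using g by simp
  have ac: "absolutely_continuous ?q \<rho>"
    unfolding absolutely_continuous_def
  proof
    fix A assume "A \<in> null_sets ?q"
    then have A: "A \<in> sets N" "emeasure r (g -` A \<inter> space r) = 0"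
      using g by (auto simp: null_sets_def emeasure_distr)
    have m: "g -` A \<inter> space r \<in> sets r" using g A(1) by simp
    then have "AE z in r. z \<notin> g -` A \<inter> space r"
      using A(2) by (intro AE_not_in) (simp add: null_sets_def)
    then have "(\<integral>\<^sup>+ z. indicator E z * indicator (g -` A \<inter> space r) z \<partial>r) = (\<integral>\<^sup>+ z. 0 \<partial>r)"
      by (intro nn_integral_cong_AE) (auto elim!: eventually_mono)
    then have "emeasure \<rho> A = 0"
      unfolding \<rho>_def using g' A(1) m E by (simp add: emeasure_distr emeasure_density)
    then show "A \<in> null_sets \<rho>" using A(1) by (simp add: null_sets_def \<rho>_def)
  qed
  have "density ?q (RN_deriv ?q \<rho>) = \<rho>"
    by (rule q.density_RN_deriv[OF ac]) (simp add: \<rho>_def)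
  moreover have k: "RN_deriv ?q \<rho> \<in> borel_measurable N"
    using borel_measurable_RN_deriv[of ?q \<rho>] by simp
  ultimately have "(\<integral>\<^sup>+ t. f t * RN_deriv ?q \<rho> t \<partial>?q) = (\<integral>\<^sup>+ z. f (g z) * indicator E z \<partial>r)"
    if f: "f \<in> borel_measurable N" for f
  proof -
    have "(\<integral>\<^sup>+ t. f t * RN_deriv ?q \<rho> t \<partial>?q) = (\<integral>\<^sup>+ t. f t \<partial>density ?q (RN_deriv ?q \<rho>))"
      using f k by (subst nn_integral_density) (auto simp: mult.commute)
    also have "\<dots> = (\<integral>\<^sup>+ t. f t \<partial>\<rho>)" using \<open>density ?q (RN_deriv ?q \<rho>) = \<rho>\<close> by simp
    also have "\<dots> = (\<integral>\<^sup>+ z. f (g z) \<partial>density r (indicator E))"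
      unfolding \<rho>_def using f g' by (intro nn_integral_distr) auto
    also have "\<dots> = (\<integral>\<^sup>+ z. f (g z) * indicator E z \<partial>r)"
      using f g E by (subst nn_integral_density) (auto simp: mult.commute)
    finally show ?thesis .
  qed
  with k show ?thesis by (rule that)
qed

lemma nn_integral_indicator_Un:
  assumes "E \<in> sets r" "E' \<in> sets r" "E \<inter> E' = {}" "f \<in> borel_measurable r"
  shows "(\<integral>\<^sup>+ z. f z * indicator (E \<union> E') z \<partial>r)
    = (\<integral>\<^sup>+ z. f z * indicator E z \<partial>r) + (\<integral>\<^sup>+ z. f z * indicator E' z \<partial>r)"
proof -
  have "(\<integral>\<^sup>+ z. f z * indicator (E \<union> E') z \<partial>r) = (\<integral>\<^sup>+ z. f z * indicator E z + f z * indicator E' z \<partial>r)"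
    using assms(3) by (intro nn_integral_cong) (auto split: split_indicator)
  also have "\<dots> = (\<integral>\<^sup>+ z. f z * indicator E z \<partial>r) + (\<integral>\<^sup>+ z. f z * indicator E' z \<partial>r)"
    using assms by (intro nn_integral_add) auto
  finally show ?thesis .
qed

lemma continuous_map_snd_fst:
  "continuous_map (prod_topology (prod_topology S T) U) (prod_topology T U) (\<lambda>x. (snd (fst x), snd x))"
proof -
  have "continuous_map (prod_topology (prod_topology S T) U) T (snd \<circ> fst)"
    by (rule continuous_map_compose[OF continuous_map_fst continuous_map_snd])
  then show ?thesis by (simp add: comp_def continuous_map_paired continuous_map_snd)
qed

text \<open>With \<open>k E\<close> and \<open>h C\<close> the densities on \<open>T\<close> of the traces of \<open>r\<close> on \<open>E\<close> and of \<open>s\<close> on \<open>C\<close>,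
  the bimeasure is \<open>\<integral> h C * k E\<close>; it is the integral of \<open>h C\<close> over \<open>E\<close> against \<open>r\<close>, hence additive
  in \<open>E\<close>, and the integral of \<open>k E\<close> against \<open>s\<close>, hence additive in \<open>C\<close>.\<close>

theorem radon_coupling_glue:
  assumes r: "radon_coupling S T p q r" and s: "radon_coupling T U q w s"
  obtains R where "radon_coupling (prod_topology S T) U r w R"
    "distr R (borel_of (prod_topology T U)) (\<lambda>x. (snd (fst x), snd x)) = s"
proof -
  note D = radon_couplingD[OF r] and D' = radon_couplingD[OF s]
  interpret r: prob_space r by (rule D)
  interpret s: prob_space s by (rule D')
  let ?N = "borel_of T"
  have ex_k: "\<exists>k. k \<in> borel_measurable ?N \<and> (\<forall>f\<in>borel_measurable ?N.
      (\<integral>\<^sup>+ t. f t * k t \<partial>q) = (\<integral>\<^sup>+ z. f (snd z) * indicator E z \<partial>r))" if "E \<in> sets r" for E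
    by (rule disintegration_density[OF D(6) D(11) that]) (unfold D(8), blast)
  \<comment> \<open>Densities are unique only almost everywhere. Any version will do, because
    \<open>k E\<close> is only ever used under integrals against \<open>q\<close>, or against
    \<open>s\<close> through its first coordinate.\<close>
  define k where "k E = (SOME k. k \<in> borel_measurable ?N \<and> (\<forall>f\<in>borel_measurable ?N.
      (\<integral>\<^sup>+ t. f t * k t \<partial>q) = (\<integral>\<^sup>+ z. f (snd z) * indicator E z \<partial>r)))" for E
  have k: "k E \<in> borel_measurable ?N"
    "\<And>f. f \<in> borel_measurable ?N \<Longrightarrow>
      (\<integral>\<^sup>+ t. f t * k E t \<partial>q) = (\<integral>\<^sup>+ z. f (snd z) * indicator E z \<partial>r)" if "E \<in> sets r" for E
    using someI_ex[OF ex_k[OF that]] unfolding k_def[symmetric] by blast+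
  have TC: "topspace T \<times> C \<in> sets s" if "C \<in> sets w" for C
    using radon_coupling_emeasure_snd[OF s] that by (simp add: radon_probD[OF D'(4)])
  have ex_h: "\<exists>h. h \<in> borel_measurable ?N \<and> (\<forall>f\<in>borel_measurable ?N.
      (\<integral>\<^sup>+ t. f t * h t \<partial>q) = (\<integral>\<^sup>+ z. f (fst z) * indicator (topspace T \<times> C) z \<partial>s))" if "C \<in> sets w" for C
    by (rule disintegration_density[OF D'(6) D'(10) TC[OF that]]) (unfold D'(7), blast)
  define h where "h C = (SOME h. h \<in> borel_measurable ?N \<and> (\<forall>f\<in>borel_measurable ?N.
      (\<integral>\<^sup>+ t. f t * h t \<partial>q) = (\<integral>\<^sup>+ z. f (fst z) * indicator (topspace T \<times> C) z \<partial>s)))" for C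
  have h: "h C \<in> borel_measurable ?N"
    "\<And>f. f \<in> borel_measurable ?N \<Longrightarrow>
      (\<integral>\<^sup>+ t. f t * h C t \<partial>q) = (\<integral>\<^sup>+ z. f (fst z) * indicator (topspace T \<times> C) z \<partial>s)" if "C \<in> sets w" for C
    using someI_ex[OF ex_h[OF that]] unfolding h_def[symmetric] by blast+
  have kr: "(\<lambda>z. h C (snd z)) \<in> borel_measurable r" if "C \<in> sets w" for C
    using measurable_compose[OF D(11) h(1)[OF that]] .
  have hs: "(\<lambda>z. k E (fst z)) \<in> borel_measurable s" if "E \<in> sets r" for E
    using measurable_compose[OF D'(10) k(1)[OF that]] .
  define b where "b E C = (\<integral>\<^sup>+ t. h C t * k E t \<partial>q)" for E C
  have b_r: "b E C = (\<integral>\<^sup>+ z. h C (snd z) * indicator E z \<partial>r)" if "E \<in> sets r" "C \<in> sets w" for E C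
    unfolding b_def using k(2)[OF that(1) h(1)[OF that(2)]] .
  have b_s: "b E C = (\<integral>\<^sup>+ z. k E (fst z) * indicator (topspace T \<times> C) z \<partial>s)" if "E \<in> sets r" "C \<in> sets w" for E C
    unfolding b_def using h(2)[OF that(2) k(1)[OF that(1)]] by (simp add: mult.commute)
  have sw: "sets w = sets (borel_of U)" "space w = topspace U" using radon_probD[OF D'(4)] by auto
  \<comment> \<open>For a cylinder over \<open>B\<close> the functional returns \<open>s\<close>
    itself. With \<open>B\<close> the whole space this gives the marginal \<open>w\<close>, and with
    general \<open>B\<close> it identifies the projection of the glued measure to \<open>T\<close>
    and \<open>U\<close>.\<close>
  have b_rect: "b (topspace S \<times> B) C = emeasure s (B \<times> C)" if B: "B \<in> sets ?N" and C: "C \<in> sets w" for B C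
  proof -
    have E: "topspace S \<times> B \<in> sets r" using radon_coupling_emeasure_snd[OF r B] by simp
    have BC: "B \<subseteq> topspace T" "C \<subseteq> topspace U"
      using sets.sets_into_space[OF B] sets.sets_into_space[OF C] by (auto simp: sw)
    have "b (topspace S \<times> B) C = (\<integral>\<^sup>+ z. h C (snd z) * indicator B (snd z) \<partial>r)"
      unfolding b_r[OF E C] by (intro nn_integral_cong) (auto simp: D(9) split: split_indicator)
    also have "\<dots> = (\<integral>\<^sup>+ t. h C t * indicator B t \<partial>q)"
      unfolding D(8)[symmetric] using D(11) h(1)[OF C] B by (intro nn_integral_distr[symmetric]) auto
    also have "\<dots> = (\<integral>\<^sup>+ z. indicator B (fst z) * indicator (topspace T \<times> C) z \<partial>s)"
      using h(2)[OF C, of "indicator B"] B by (simp add: mult.commute)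
    also have "\<dots> = (\<integral>\<^sup>+ z. indicator (B \<times> C) z \<partial>s)"
      using BC by (intro nn_integral_cong) (auto split: split_indicator)
    also have "\<dots> = emeasure s (B \<times> C)"
      using Times_in_borel_of_prod[OF B, of C U] C by (simp add: D'(5) sw)
    finally show ?thesis .
  qed
  have b_top: "b E (topspace U) = emeasure r E" if E: "E \<in> sets r" for E
  proof -
    have tw: "topspace U \<in> sets w" using sw by (metis sets.top)
    have "b E (topspace U) = (\<integral>\<^sup>+ z. k E (fst z) \<partial>s)"
      unfolding b_s[OF E tw] by (intro nn_integral_cong) (auto simp: D'(9) split: split_indicator)
    also have "\<dots> = (\<integral>\<^sup>+ t. k E t \<partial>q)"
      unfolding D'(7)[symmetric] using D'(10) k(1)[OF E] by (intro nn_integral_distr[symmetric]) auto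
    also have "\<dots> = (\<integral>\<^sup>+ z. indicator E z \<partial>r)" using k(2)[OF E, of "\<lambda>_. 1"] by simp
    finally show ?thesis using E by simp
  qed
  have tr: "topspace (prod_topology S T) = space r" "space r \<in> sets r" by (simp_all add: D(9)[symmetric])
  have b_space: "b (space r) C = emeasure w C" if C: "C \<in> sets w" for C
    using b_rect[of "topspace T" C] radon_coupling_emeasure_snd[OF s, of C] C sets.top[of ?N]
    by (simp add: D(9) sw)
  \<comment> \<open>Finiteness is what makes \<open>enn2real\<close> additive on the values of
    \<open>b\<close>.\<close>
  have fin: "b E C < top" if E: "E \<in> sets r" and C: "C \<in> sets w" for E C
  proof -
    have "b E C \<le> b (space r) C"
      unfolding b_r[OF E C] b_r[OF tr(2) C]
      using sets.sets_into_space[OF E] by (intro nn_integral_mono) (auto split: split_indicator)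
    also have "\<dots> < top" using b_space[OF C] radon_probD(2)[OF D'(4)]
      by (simp add: prob_space.finite_measure finite_measure.emeasure_finite less_top[symmetric])
    finally show ?thesis .
  qed
  interpret radon_bimeasure "prod_topology S T" U r w "\<lambda>E C. enn2real (b E C)"
  proof
    show "enn2real (b (E \<union> E') C) = enn2real (b E C) + enn2real (b E' C)"
      if "E \<in> sets r" "E' \<in> sets r" "E \<inter> E' = {}" "C \<in> sets w" for E E' C
      using that fin kr by (simp add: b_r nn_integral_indicator_Un enn2real_plus)
    show "enn2real (b E (C \<union> C')) = enn2real (b E C) + enn2real (b E C')"
      if "E \<in> sets r" "C \<in> sets w" "C' \<in> sets w" "C \<inter> C' = {}" for E C C'
    proof -
      have "b E (C \<union> C') = b E C + b E C'"
        unfolding b_s[OF that(1) sets.Un[OF that(2,3)]] b_s[OF that(1,2)] b_s[OF that(1,3)] Sigma_Un_distrib2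
        using that(4) by (intro nn_integral_indicator_Un TC that hs) auto
      then show ?thesis using that fin by (simp add: enn2real_plus)
    qed
    show "enn2real (b E (topspace U)) = measure r E" if "E \<in> sets r" for E
      using b_top[OF that] by (simp add: measure_def)
    show "enn2real (b (topspace (prod_topology S T)) C) = measure w C" if "C \<in> sets w" for C
      unfolding tr using b_space[OF that] by (simp add: measure_def)
  qed (use D D' radon_coupling_radon[OF r] in auto)
  obtain R where R: "radon_coupling (prod_topology S T) U r w R"
    "\<And>A B. A \<in> sets r \<Longrightarrow> B \<in> sets w \<Longrightarrow> emeasure R (A \<times> B) = ennreal (enn2real (b A B))"
    using radon_coupling_extension by blast
  note DR = radon_couplingD[OF R(1)]
  let ?g = "\<lambda>x. (snd (fst x), snd x)"
  let ?s = "distr R (borel_of (prod_topology T U)) ?g"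
  have g: "?g \<in> measurable R (borel_of (prod_topology T U))"
    using continuous_map_measurable[OF continuous_map_snd_fst] by (simp cong: measurable_cong_sets add: DR(5))
  have "radon_coupling T U q w ?s"
    unfolding radon_coupling_def
  proof (intro conjI)
    show "prob_space ?s" using DR(6) g by (rule prob_space.prob_space_distr)
    have "distr ?s (borel_of T) fst = distr R (borel_of T) (snd \<circ> fst)"
      using g measurable_fst_borel_of by (subst distr_distr) (auto simp: comp_def)
    also have "\<dots> = distr (distr R (borel_of (prod_topology S T)) fst) (borel_of T) snd"
      using DR(10) measurable_snd_borel_of by (subst distr_distr) auto
    finally show "distr ?s (borel_of T) fst = q" by (simp add: DR(7) D(8))
    have "distr ?s (borel_of U) snd = distr R (borel_of U) snd"
      using g measurable_snd_borel_of by (subst distr_distr) (auto simp: comp_def)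
    then show "distr ?s (borel_of U) snd = w" by (simp add: DR(8))
  qed (use D D' in auto)
  then have "?s = s"
  proof (rule radon_coupling_eqI[OF _ s])
    fix B C assume B: "B \<in> sets (borel_of T)" and C: "C \<in> sets (borel_of U)"
    then have Cw: "C \<in> sets w" by (simp add: sw)
    have E: "topspace S \<times> B \<in> sets r" using radon_coupling_emeasure_snd[OF r B] by simp
    have "?g -` (B \<times> C) \<inter> space R = (topspace S \<times> B) \<times> C"
      using sets.sets_into_space[OF B] sets.sets_into_space[OF C] by (auto simp: DR(9))
    then have "emeasure ?s (B \<times> C) = emeasure R ((topspace S \<times> B) \<times> C)"
      using g Times_in_borel_of_prod[OF B C] by (simp add: emeasure_distr)
    also have "\<dots> = emeasure s (B \<times> C)"
      using R(2)[OF E Cw] fin[OF E Cw] b_rect[OF B Cw] by simp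
    finally show "emeasure ?s (B \<times> C) = emeasure s (B \<times> C)" .
  qed
  with R(1) show ?thesis by (rule that)
qed

text \<open>The usual product measure lives on the product of the Borel sigma-algebras; as a
  bimeasure it extends to the Borel sets of the product topology. It provides the coupling that
  keeps the infimum in the distance finite.\<close>

lemma radon_product_coupling:
  assumes S: "metrizable_space S" and T: "metrizable_space T"
    and p: "radon_prob S p" and q: "radon_prob T q"
  obtains r where "radon_coupling S T p q r"
proof -
  interpret p: prob_space p using radon_probD[OF p] by simp
  interpret q: prob_space q using radon_probD[OF q] by simp
  interpret radon_bimeasure S T p q "\<lambda>A B. measure p A * measure q B"
  proof
    show "measure p A * measure q (topspace T) = measure p A" for A
      using q.prob_space by (simp add: radon_probD[OF q])
    show "measure p (topspace S) * measure q B = measure q B" for B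
      using p.prob_space by (simp add: radon_probD[OF p])
    show "measure p (A \<union> A') * measure q B = measure p A * measure q B + measure p A' * measure q B"
      if "A \<in> sets p" "A' \<in> sets p" "A \<inter> A' = {}" for A A' B
      using p.finite_measure_Union[OF that] by (simp add: distrib_right)
    show "measure p A * measure q (B \<union> B') = measure p A * measure q B + measure p A * measure q B'"
      if "B \<in> sets q" "B' \<in> sets q" "B \<inter> B' = {}" for A B B'
      using q.finite_measure_Union[OF that] by (simp add: distrib_left)
  qed (use S T p q in simp_all)
  obtain r where "radon_coupling S T p q r" by (rule radon_coupling_extension)
  then show ?thesis by (rule that)
qed

section \<open>Compactness of the set of couplings\<close>

text \<open>Tychonoff's theorem for a cube with arbitrarily many coordinates. For an uncountable
  index type a convergent subsequence need not exist, so a filter finer than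
  \<open>sequentially\<close> takes its place.\<close>

lemma bounded_functions_filter_limit:
  fixes F :: "nat \<Rightarrow> 'i \<Rightarrow> real"
  assumes "\<And>n i. F n i \<in> {0..1}"
  obtains H b where "H \<le> sequentially" "H \<noteq> bot" "\<And>i. ((\<lambda>n. F n i) \<longlongrightarrow> b i) H"
proof -
  have "compact (PiE UNIV (\<lambda>_::'i. {0..1::real}))"
    unfolding compactin_euclidean_iff[symmetric] euclidean_product_topology[symmetric] compactin_PiE
    by simp
  moreover have "eventually (\<lambda>x. x \<in> PiE UNIV (\<lambda>_::'i. {0..1::real})) (filtermap F sequentially)"
    using assms by (simp add: eventually_filtermap PiE_UNIV_domain)
  moreover have "filtermap F sequentially \<noteq> bot" by (simp add: filtermap_bot_iff)
  ultimately obtain b where b: "inf (nhds b) (filtermap F sequentially) \<noteq> bot"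
    unfolding compact_filter by blast
  \<comment> \<open>Pulling back the neighbourhoods of the cluster point \<open>b\<close> forces
    convergence along \<open>H\<close>; being a cluster point says precisely that \<open>H\<close>
    is not trivial.\<close>
  define H where "H = inf sequentially (filtercomap F (nhds b))"
  have "H \<noteq> bot"
  proof
    assume "H = bot"
    then have "eventually (\<lambda>_. False) H" by simp
    then obtain P Q where PQ: "eventually P sequentially" "eventually Q (filtercomap F (nhds b))"
      "\<And>n. P n \<and> Q n \<Longrightarrow> False"
      unfolding H_def eventually_inf by blast
    obtain Q' where Q': "eventually Q' (nhds b)" "\<And>n. Q' (F n) \<Longrightarrow> Q n"
      using PQ(2) unfolding eventually_filtercomap by blast
    have "eventually (\<lambda>y. \<exists>n. P n \<and> F n = y) (filtermap F sequentially)"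
      using PQ(1) by (auto simp: eventually_filtermap elim: eventually_mono)
    with Q'(1) have "eventually (\<lambda>_. False) (inf (nhds b) (filtermap F sequentially))"
      unfolding eventually_inf using Q'(2) PQ(3) by blast
    with b show False by (simp add: trivial_limit_def)
  qed
  moreover have "H \<le> sequentially" by (simp add: H_def)
  moreover have "((\<lambda>n. F n i) \<longlongrightarrow> b i) H" for i
  proof -
    have "filterlim F (nhds b) H"
      unfolding H_def by (rule filterlim_mono[OF filterlim_filtercomap order_refl]) simp
    then show ?thesis
      by (rule continuous_on_tendsto_compose[OF continuous_on_product_coordinates[of i]]) auto
  qed
  ultimately show ?thesis using that by blast
qed

text \<open>A limit on each rectangle separately preserves finite additivity and the fixed
  marginals, hence is a bimeasure. Countable additivity does not pass through the limit by itself;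
  it is restored by the Radon marginals.\<close>

lemma radon_coupling_cluster:
  assumes r: "\<And>n::nat. radon_coupling S T p q (r n)"
  obtains H r' where "H \<le> sequentially" "H \<noteq> bot" "radon_coupling S T p q r'"
    "\<And>A B. A \<in> sets (borel_of S) \<Longrightarrow> B \<in> sets (borel_of T) \<Longrightarrow>
      ((\<lambda>n. measure (r n) (A \<times> B)) \<longlongrightarrow> measure r' (A \<times> B)) H"
proof -
  note D = radon_couplingD[OF r]
  have P: "prob_space (r n)" for n by (rule D(6))
  obtain H b where H: "H \<le> sequentially" "H \<noteq> bot"
    "\<And>z. ((\<lambda>n. measure (r n) (fst z \<times> snd z)) \<longlongrightarrow> b z) H"
    using bounded_functions_filter_limit[of "\<lambda>n z. measure (r n) (fst z \<times> snd z)"] P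
    by (auto simp: prob_space.prob_le_1)
  have lim: "((\<lambda>n. measure (r n) (A \<times> B)) \<longlongrightarrow> b (A, B)) H" for A B using H(3)[of "(A, B)"] by simp
  have sp: "sets p = sets (borel_of S)" "sets q = sets (borel_of T)"
    using radon_probD[OF D(3)] radon_probD[OF D(4)] by auto
  have m: "A \<times> B \<in> sets (r n)" if "A \<in> sets p" "B \<in> sets q" for A B n
    using Times_in_borel_of_prod[of A S B T] that by (simp add: D(5) sp)
  interpret radon_bimeasure S T p q "\<lambda>A B. b (A, B)"
  proof
    show "0 \<le> b (A, B)" for A B by (rule tendsto_lowerbound[OF lim _ H(2)]) simp
    show "b (A \<union> A', B) = b (A, B) + b (A', B)"
      if *: "A \<in> sets p" "A' \<in> sets p" "A \<inter> A' = {}" "B \<in> sets q" for A A' B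
    proof (rule tendsto_unique[OF H(2) lim])
      have "measure (r n) ((A \<union> A') \<times> B) = measure (r n) (A \<times> B) + measure (r n) (A' \<times> B)" for n
        using m * P[of n] unfolding Times_Un_distrib1
        by (intro finite_measure.finite_measure_Union) (auto simp: prob_space.finite_measure)
      then show "((\<lambda>n. measure (r n) ((A \<union> A') \<times> B)) \<longlongrightarrow> b (A, B) + b (A', B)) H"
        using tendsto_add[OF lim lim] by simp
    qed
    show "b (A, B \<union> B') = b (A, B) + b (A, B')"
      if *: "A \<in> sets p" "B \<in> sets q" "B' \<in> sets q" "B \<inter> B' = {}" for A B B'
    proof (rule tendsto_unique[OF H(2) lim])
      have "measure (r n) (A \<times> (B \<union> B')) = measure (r n) (A \<times> B) + measure (r n) (A \<times> B')" for n
        using m * P[of n] unfolding Sigma_Un_distrib2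
        by (intro finite_measure.finite_measure_Union) (auto simp: prob_space.finite_measure)
      then show "((\<lambda>n. measure (r n) (A \<times> (B \<union> B'))) \<longlongrightarrow> b (A, B) + b (A, B')) H"
        using tendsto_add[OF lim lim] by simp
    qed
    show "b (A, topspace T) = measure p A" if "A \<in> sets p" for A
    proof (rule tendsto_unique[OF H(2) lim])
      show "((\<lambda>n. measure (r n) (A \<times> topspace T)) \<longlongrightarrow> measure p A) H"
        using radon_coupling_emeasure_fst[OF r] that by (simp add: measure_def sp)
    qed
    show "b (topspace S, B) = measure q B" if "B \<in> sets q" for B
    proof (rule tendsto_unique[OF H(2) lim])
      show "((\<lambda>n. measure (r n) (topspace S \<times> B)) \<longlongrightarrow> measure q B) H"
        using radon_coupling_emeasure_snd[OF r] that by (simp add: measure_def sp)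
    qed
  qed (use D in auto)
  obtain r' where r': "radon_coupling S T p q r'"
    "\<And>A B. A \<in> sets p \<Longrightarrow> B \<in> sets q \<Longrightarrow> emeasure r' (A \<times> B) = ennreal (b (A, B))"
    using radon_coupling_extension by blast
  have "measure r' (A \<times> B) = b (A, B)" if "A \<in> sets p" "B \<in> sets q" for A B
    using r'(2)[OF that] nonneg[OF that] by (simp add: measure_def)
  then show ?thesis using that[OF H(1,2) r'(1)] lim by (simp add: sp)
qed

section \<open>Composing and reversing couplings\<close>

lemma continuous_map_fst_fst:
  "continuous_map (prod_topology (prod_topology S T) U) (prod_topology S U) (\<lambda>x. (fst (fst x), snd x))"
proof -
  have "continuous_map (prod_topology (prod_topology S T) U) S (fst \<circ> fst)"
    by (rule continuous_map_compose[OF continuous_map_fst continuous_map_fst])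
  then show ?thesis by (simp add: comp_def continuous_map_paired continuous_map_snd)
qed

text \<open>The measure \<open>R\<close> on triples is kept, not only its projection to the outer
  coordinates: the triangle inequality and transitivity are statements about each single
  triple.\<close>

lemma radon_coupling_compose:
  assumes r: "radon_coupling S T p q r" and s: "radon_coupling T U q w s"
  obtains R where "prob_space R"
    "fst \<in> measurable R (borel_of (prod_topology S T))"
    "(\<lambda>x. (snd (fst x), snd x)) \<in> measurable R (borel_of (prod_topology T U))"
    "(\<lambda>x. (fst (fst x), snd x)) \<in> measurable R (borel_of (prod_topology S U))"
    "distr R (borel_of (prod_topology S T)) fst = r"
    "distr R (borel_of (prod_topology T U)) (\<lambda>x. (snd (fst x), snd x)) = s"
    "radon_coupling S U p w (distr R (borel_of (prod_topology S U)) (\<lambda>x. (fst (fst x), snd x)))"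
    "space R = (topspace S \<times> topspace T) \<times> topspace U"
proof -
  note D = radon_couplingD[OF r] and D' = radon_couplingD[OF s]
  obtain R where R: "radon_coupling (prod_topology S T) U r w R"
    "distr R (borel_of (prod_topology T U)) (\<lambda>x. (snd (fst x), snd x)) = s"
    by (rule radon_coupling_glue[OF r s])
  note DR = radon_couplingD[OF R(1)]
  let ?g = "\<lambda>x. (snd (fst x), snd x)" and ?h = "\<lambda>x. (fst (fst x), snd x)"
  let ?t = "distr R (borel_of (prod_topology S U)) ?h"
  have g: "?g \<in> measurable R (borel_of (prod_topology T U))"
    using continuous_map_measurable[OF continuous_map_snd_fst] by (simp cong: measurable_cong_sets add: DR(5))
  have h: "?h \<in> measurable R (borel_of (prod_topology S U))"
    using continuous_map_measurable[OF continuous_map_fst_fst] by (simp cong: measurable_cong_sets add: DR(5))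
  have "radon_coupling S U p w ?t"
    unfolding radon_coupling_def
  proof (intro conjI)
    show "prob_space ?t" using DR(6) h by (rule prob_space.prob_space_distr)
    have "distr ?t (borel_of S) fst = distr R (borel_of S) (fst \<circ> fst)"
      using h measurable_fst_borel_of by (subst distr_distr) (auto simp: comp_def)
    also have "\<dots> = distr (distr R (borel_of (prod_topology S T)) fst) (borel_of S) fst"
      using DR(10) measurable_fst_borel_of by (subst distr_distr) auto
    finally show "distr ?t (borel_of S) fst = p" by (simp add: DR(7) D(7))
    have "distr ?t (borel_of U) snd = distr R (borel_of U) snd"
      using h measurable_snd_borel_of by (subst distr_distr) (auto simp: comp_def)
    then show "distr ?t (borel_of U) snd = w" by (simp add: DR(8))
  qed (use D D' in auto)
  then show ?thesis using that[OF DR(6,10) g h DR(7) R(2)] DR(9) by simp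
qed

lemma continuous_map_swap: "continuous_map (prod_topology S T) (prod_topology T S) prod.swap"
  unfolding prod.swap_def by (simp add: continuous_map_paired continuous_map_fst continuous_map_snd)

lemma radon_coupling_swap:
  assumes r: "radon_coupling S T p q r"
  shows "radon_coupling T S q p (distr r (borel_of (prod_topology T S)) prod.swap)"
proof -
  note D = radon_couplingD[OF r]
  have sw: "prod.swap \<in> measurable r (borel_of (prod_topology T S))"
    using continuous_map_measurable[OF continuous_map_swap] by (simp cong: measurable_cong_sets add: D(5))
  show ?thesis
    unfolding radon_coupling_def
    using D measurable_fst_borel_of[of T S] measurable_snd_borel_of[of T S] sw
    by (auto simp: distr_distr comp_def prob_space.prob_space_distr)
qed

lemma radon_coupling_swap_Times:
  assumes r: "radon_coupling S T p q r" and A: "A \<in> sets (borel_of S)" and B: "B \<in> sets (borel_of T)"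
  shows "emeasure (distr r (borel_of (prod_topology T S)) prod.swap) (B \<times> A) = emeasure r (A \<times> B)"
proof -
  note D = radon_couplingD[OF r]
  have sw: "prod.swap \<in> measurable r (borel_of (prod_topology T S))"
    using continuous_map_measurable[OF continuous_map_swap] by (simp cong: measurable_cong_sets add: D(5))
  have "prod.swap -` (B \<times> A) \<inter> space r = A \<times> B"
    using sets.sets_into_space[OF A] sets.sets_into_space[OF B] by (auto simp: D(9))
  then show ?thesis using sw Times_in_borel_of_prod[OF B A] by (simp add: emeasure_distr)
qed

section \<open>The Wasserstein metric\<close>

text \<open>The metric theory is separated from the order so that it also applies to the space of
  pairs of points, in which couplings are themselves approximated by empirical measures.\<close>

locale metric_omet = Metric_space "pts X" "dst X" for X :: "'a omet"
begin

abbreviation "T \<equiv> omet_topology X"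
abbreviation "d \<equiv> dst X"
abbreviation "B \<equiv> borel_of T"
abbreviation "B2 \<equiv> borel_of (prod_topology T T)"
abbreviation "PX \<equiv> wasserstein_pts X"
abbreviation "W \<equiv> wasserstein_dist X"

lemma T_def: "T = mtopology"
  by (simp add: omet_topology_def)

lemma topspace_T [simp]: "topspace T = pts X"
  by (simp add: T_def)

lemma metrizable_T: "metrizable_space T"
  by (simp add: T_def metrizable_space_mtopology)

lemma Hausdorff_T: "Hausdorff_space T"
  by (simp add: T_def Hausdorff_space_mtopology)

lemma metrizable_T2: "metrizable_space (prod_topology T T)"
  by (simp add: metrizable_space_prod_topology metrizable_T)

lemma openin_mball_T [intro]: "openin T (mball x e)"
  by (simp add: T_def)

lemma mball_sets [intro]: "mball x e \<in> sets B"
  by (intro borel_of_open openin_mball_T)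

lemma d_measurable: "(\<lambda>z. d (fst z) (snd z)) \<in> borel_measurable B2"
proof (rule continuous_map_borel_measurable)
  have "mtopology_of Self = T" by (simp add: mtopology_of_def T_def)
  then show "continuous_map (prod_topology T T) euclideanreal (\<lambda>z. d (fst z) (snd z))"
    using continuous_map_mdist[of "prod_topology T T" Self fst snd] by (simp add: continuous_map_fst continuous_map_snd)
qed

lemma short_measurable:
  assumes "\<And>x y. x \<in> pts X \<Longrightarrow> y \<in> pts X \<Longrightarrow> \<bar>f x - f y\<bar> \<le> d x y"
  shows "f \<in> borel_measurable B"
proof (rule continuous_map_borel_measurable)
  have "\<exists>\<delta>>0. \<forall>x. x \<in> pts X \<and> d a x < \<delta> \<longrightarrow> dist (f a) (f x) < \<epsilon>" if "a \<in> pts X" "\<epsilon> > 0" for a \<epsilon>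
    using that assms[OF that(1)] by (intro exI[of _ \<epsilon>]) (fastforce simp: dist_real_def)
  then show "continuous_map T euclideanreal f"
    using metric_continuous_map[OF Met_TC.Metric_space_axioms, of f] by (simp add: T_def)
qed

lemma dist_measurable [measurable]: "a \<in> pts X \<Longrightarrow> d a \<in> borel_measurable B"
  by (rule short_measurable) (metis commute mdist_reverse_triangle)

text \<open>A short \<open>f\<close> satisfies
  \<open>\<bar>f x\<bar> \<le> \<bar>f a\<bar> + d a x\<close>, so the single short function
  \<open>d a\<close> decides integrability of all of them.\<close>

lemma finite_first_moment_iff:
  assumes p: "radon_prob T p" and a: "a \<in> pts X"
  shows "finite_first_moment X p \<longleftrightarrow> (\<integral>\<^sup>+ x. ennreal (d a x) \<partial>p) < top"
proof -
  note P = radon_probD[OF p]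
  have m: "f \<in> borel_measurable p" if "f \<in> borel_measurable B" for f :: "'a \<Rightarrow> real"
    using that by (simp cong: measurable_cong_sets add: P(1))
  have "(\<integral>\<^sup>+ x. ennreal (d a x) \<partial>p) < top" if "finite_first_moment X p"
  proof -
    have "integrable p (d a)"
      using that unfolding finite_first_moment_def using a by (metis commute mdist_reverse_triangle)
    then show ?thesis by (simp add: integrable_iff_bounded)
  qed
  moreover have "finite_first_moment X p" if fin: "(\<integral>\<^sup>+ x. ennreal (d a x) \<partial>p) < top"
    unfolding finite_first_moment_def
  proof (intro allI impI)
    fix f :: "'a \<Rightarrow> real" assume f: "\<forall>x\<in>pts X. \<forall>y\<in>pts X. \<bar>f x - f y\<bar> \<le> d x y"
    interpret prob_space p by (rule P)
    have "integrable p (d a)"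
      using m[OF dist_measurable[OF a]] fin by (intro integrableI_bounded) simp_all
    then have "integrable p (\<lambda>x. \<bar>f a\<bar> + d a x)" by simp
    then show "integrable p f"
    proof (rule Bochner_Integration.integrable_bound)
      show "f \<in> borel_measurable p" by (rule m[OF short_measurable]) (use f in blast)
      have "\<bar>f x\<bar> \<le> \<bar>f a\<bar> + d a x" if x: "x \<in> pts X" for x
      proof -
        have "\<bar>f a - f x\<bar> \<le> d a x" using f a x by blast
        then show ?thesis by linarith
      qed
      then show "AE x in p. norm (f x) \<le> norm (\<bar>f a\<bar> + d a x)"
        by (intro AE_I2) (simp add: P(3))
    qed
  qed
  ultimately show ?thesis by blast
qed

lemma PX_D:
  assumes "p \<in> PX"
  shows "radon_prob T p" "finite_first_moment X p" "prob_space p" "sets p = sets B" "space p = pts X"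
  using assms radon_probD[of T p] by (auto simp: wasserstein_pts_def)

lemma PX_I: "radon_prob T p \<Longrightarrow> a \<in> pts X \<Longrightarrow> (\<integral>\<^sup>+ x. ennreal (d a x) \<partial>p) < top \<Longrightarrow> p \<in> PX"
  by (simp add: wasserstein_pts_def finite_first_moment_iff)

lemma PX_nonempty: "p \<in> PX \<Longrightarrow> pts X \<noteq> {}"
  using PX_D(3,5) prob_space.not_empty by fastforce

lemma couplings_iff:
  assumes "radon_prob T p" "radon_prob T q"
  shows "r \<in> couplings X p q \<longleftrightarrow> radon_coupling T T p q r"
  using assms metrizable_T by (auto simp: couplings_def radon_coupling_def)

abbreviation cost :: "('a \<times> 'a) measure \<Rightarrow> ennreal"
  where "cost r \<equiv> \<integral>\<^sup>+ z. ennreal (d (fst z) (snd z)) \<partial>r"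

lemma cost_finite:
  assumes p: "p \<in> PX" and q: "q \<in> PX" and r: "radon_coupling T T p q r"
  shows "cost r < top"
proof -
  note D = radon_couplingD[OF r]
  obtain a where a: "a \<in> pts X" using PX_nonempty[OF p] by auto
  have m: "(\<lambda>x. ennreal (d a x)) \<in> borel_measurable B" using a by simp
  have "cost r \<le> (\<integral>\<^sup>+ z. ennreal (d a (fst z)) + ennreal (d a (snd z)) \<partial>r)"
  proof (rule nn_integral_mono)
    fix z assume "z \<in> space r"
    then have "d (fst z) (snd z) \<le> d a (fst z) + d a (snd z)"
      using triangle''[of "fst z" a "snd z"] a by (auto simp: D(9))
    then show "ennreal (d (fst z) (snd z)) \<le> ennreal (d a (fst z)) + ennreal (d a (snd z))"
      by (simp flip: ennreal_plus)
  qed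
  also have "\<dots> = (\<integral>\<^sup>+ z. ennreal (d a (fst z)) \<partial>r) + (\<integral>\<^sup>+ z. ennreal (d a (snd z)) \<partial>r)"
    using measurable_compose[OF D(10) m] measurable_compose[OF D(11) m] by (intro nn_integral_add) auto
  also have "(\<integral>\<^sup>+ z. ennreal (d a (fst z)) \<partial>r) = (\<integral>\<^sup>+ x. ennreal (d a x) \<partial>p)"
    unfolding D(7)[symmetric] using D(10) m by (subst nn_integral_distr) auto
  also have "(\<integral>\<^sup>+ z. ennreal (d a (snd z)) \<partial>r) = (\<integral>\<^sup>+ x. ennreal (d a x) \<partial>q)"
    unfolding D(8)[symmetric] using D(11) m by (subst nn_integral_distr) auto
  also have "(\<integral>\<^sup>+ x. ennreal (d a x) \<partial>p) + (\<integral>\<^sup>+ x. ennreal (d a x) \<partial>q) < top"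
    using PX_D(1,2)[OF p] PX_D(1,2)[OF q] a by (simp add: finite_first_moment_iff)
  finally show ?thesis .
qed

text \<open>An infinite infimum would be turned into 0 by \<open>enn2real\<close>. On
  \<open>PX\<close> this cannot happen, since the product coupling has finite cost.\<close>

lemma W_eq_INF:
  assumes p: "p \<in> PX" and q: "q \<in> PX"
  shows "ennreal (W p q) = (INF r \<in> couplings X p q. cost r)"
proof -
  obtain r where r: "radon_coupling T T p q r"
    by (rule radon_product_coupling[OF metrizable_T metrizable_T PX_D(1)[OF p] PX_D(1)[OF q]])
  then have "(INF r \<in> couplings X p q. cost r) \<le> cost r"
    using PX_D(1)[OF p] PX_D(1)[OF q] by (intro INF_lower) (simp add: couplings_iff)
  also have "\<dots> < top" by (rule cost_finite[OF p q r])
  finally show ?thesis by (simp add: wasserstein_dist_def)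
qed

lemma W_le:
  assumes p: "p \<in> PX" and q: "q \<in> PX" and r: "radon_coupling T T p q r"
  shows "ennreal (W p q) \<le> cost r"
  unfolding W_eq_INF[OF p q]
  using r PX_D(1)[OF p] PX_D(1)[OF q] by (intro INF_lower) (simp add: couplings_iff)

lemma W_approx:
  assumes p: "p \<in> PX" and q: "q \<in> PX" and c: "W p q < c"
  obtains r where "radon_coupling T T p q r" "cost r < ennreal c"
proof -
  have "0 \<le> W p q" by (simp add: wasserstein_dist_def)
  then have "ennreal (W p q) < ennreal c" using c by (simp add: ennreal_less_iff)
  then have "(INF r \<in> couplings X p q. cost r) < ennreal c" by (simp add: W_eq_INF[OF p q])
  then obtain r where "r \<in> couplings X p q" "cost r < ennreal c"
    unfolding INF_less_iff by blast
  then show ?thesis using PX_D(1)[OF p] PX_D(1)[OF q] by (intro that[of r]) (simp_all add: couplings_iff)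
qed

lemma W_nonneg [simp]: "0 \<le> W p q"
  by (simp add: wasserstein_dist_def)

text \<open>The locale \<open>Metric_space\<close> demands symmetry for arbitrary arguments, also
  outside \<open>PX\<close>. The proof therefore swaps the bare \<open>couplings\<close>, without
  reference to Radon marginals.\<close>

lemma W_commute: "W p q = W q p"
proof -
  have m: "prod.swap \<in> measurable B2 B2"
    by (rule continuous_map_measurable[OF continuous_map_swap])
  have *: "\<exists>r'\<in>couplings X q p. cost r' = cost r" if "r \<in> couplings X p q" for p q r
  proof -
    have r: "sets r = sets B2" "prob_space r" "distr r B fst = p" "distr r B snd = q"
      using that by (auto simp: couplings_def)
    have sw: "prod.swap \<in> measurable r B2" using m by (simp add: r(1) cong: measurable_cong_sets)
    let ?r = "distr r B2 prod.swap"
    have "distr ?r B fst = q" "distr ?r B snd = p"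
      using sw measurable_fst_borel_of[of T T] measurable_snd_borel_of[of T T] r(3,4)
      by (auto simp: distr_distr comp_def)
    then have "?r \<in> couplings X q p"
      using r(2) sw by (simp add: couplings_def prob_space.prob_space_distr)
    moreover have "cost ?r = cost r"
      using sw measurable_compose[OF d_measurable measurable_ennreal]
      by (subst nn_integral_distr) (simp_all add: commute)
    ultimately show ?thesis by blast
  qed
  have le: "(INF r \<in> couplings X q p. cost r) \<le> (INF r \<in> couplings X p q. cost r)" for p q
  proof (rule INF_greatest)
    fix r assume "r \<in> couplings X p q"
    from *[OF this] obtain r' where "r' \<in> couplings X q p" "cost r' = cost r" by blast
    then show "(INF r \<in> couplings X q p. cost r) \<le> cost r" by (intro INF_lower2[of r']) simp_all
  qed
  have "(INF r \<in> couplings X p q. cost r) = (INF r \<in> couplings X q p. cost r)"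
    by (rule antisym[OF le le])
  then show ?thesis by (simp add: wasserstein_dist_def)
qed

lemma W_triangle:
  assumes p: "p \<in> PX" and q: "q \<in> PX" and w: "w \<in> PX"
  shows "W p w \<le> W p q + W q w"
proof (rule field_le_epsilon)
  fix e :: real assume e: "0 < e"
  obtain r where r: "radon_coupling T T p q r" "cost r < ennreal (W p q + e/2)"
    by (rule W_approx[OF p q, of "W p q + e/2"]) (use e in auto)
  obtain s where s: "radon_coupling T T q w s" "cost s < ennreal (W q w + e/2)"
    by (rule W_approx[OF q w, of "W q w + e/2"]) (use e in auto)
  let ?f = "\<lambda>z. ennreal (d (fst z) (snd z))"
  have f: "?f \<in> borel_measurable B2" using measurable_compose[OF d_measurable measurable_ennreal] .
  obtain R where R: "prob_space R"
    "fst \<in> measurable R B2" "(\<lambda>x. (snd (fst x), snd x)) \<in> measurable R B2"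
    "(\<lambda>x. (fst (fst x), snd x)) \<in> measurable R B2"
    "distr R B2 fst = r" "distr R B2 (\<lambda>x. (snd (fst x), snd x)) = s"
    "radon_coupling T T p w (distr R B2 (\<lambda>x. (fst (fst x), snd x)))"
    "space R = (topspace T \<times> topspace T) \<times> topspace T"
    by (rule radon_coupling_compose[OF r(1) s(1)])
  have "ennreal (W p w) \<le> cost (distr R B2 (\<lambda>x. (fst (fst x), snd x)))"
    by (rule W_le[OF p w R(7)])
  also have "\<dots> = (\<integral>\<^sup>+ x. d (fst (fst x)) (snd x) \<partial>R)"
    using R(4) f by (subst nn_integral_distr) simp_all
  also have "\<dots> \<le> (\<integral>\<^sup>+ x. ?f (fst x) + ?f (snd (fst x), snd x) \<partial>R)"
  proof (rule nn_integral_mono)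
    fix x assume "x \<in> space R"
    then have "d (fst (fst x)) (snd x) \<le> d (fst (fst x)) (snd (fst x)) + d (snd (fst x)) (snd x)"
      using triangle[of "fst (fst x)" "snd (fst x)" "snd x"] by (auto simp: R(8))
    then show "ennreal (d (fst (fst x)) (snd x)) \<le> ?f (fst x) + ?f (snd (fst x), snd x)"
      by (simp flip: ennreal_plus)
  qed
  also have "\<dots> = (\<integral>\<^sup>+ x. ?f (fst x) \<partial>R) + (\<integral>\<^sup>+ x. ?f (snd (fst x), snd x) \<partial>R)"
    using measurable_compose[OF R(2) f] measurable_compose[OF R(3) f] by (intro nn_integral_add) auto
  also have "(\<integral>\<^sup>+ x. ?f (fst x) \<partial>R) = cost r"
    unfolding R(5)[symmetric] using R(2) f by (subst nn_integral_distr) simp_all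
  also have "(\<integral>\<^sup>+ x. ?f (snd (fst x), snd x) \<partial>R) = cost s"
    unfolding R(6)[symmetric] using R(3) f by (subst nn_integral_distr) simp_all
  also have "cost r + cost s \<le> ennreal (W p q + e/2) + ennreal (W q w + e/2)"
    using r(2) s(2) by (intro add_mono) auto
  also have "\<dots> = ennreal (W p q + W q w + e)"
    using e by (simp add: flip: ennreal_plus)
  finally show "W p w \<le> W p q + W q w + e"
    using e by (subst (asm) ennreal_le_iff) auto
qed

lemma diagonal_coupling:
  assumes p: "radon_prob T p"
  shows "radon_coupling T T p p (distr p B2 (\<lambda>x. (x, x)))" "(\<lambda>x. (x, x)) \<in> measurable p B2"
proof -
  note P = radon_probD[OF p]
  have "continuous_map T (prod_topology T T) (\<lambda>x. (x, x))" by (simp add: continuous_map_paired)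
  from continuous_map_measurable[OF this]
  show m: "(\<lambda>x. (x, x)) \<in> measurable p B2" by (simp add: P(1) cong: measurable_cong_sets)
  have "distr p B (\<lambda>x. x) = p" using P(1) by (intro distr_id2) simp
  then show "radon_coupling T T p p (distr p B2 (\<lambda>x. (x, x)))"
    unfolding radon_coupling_def
    using P metrizable_T p m measurable_fst_borel_of[of T T] measurable_snd_borel_of[of T T]
    by (auto simp: distr_distr comp_def prob_space.prob_space_distr)
qed

section \<open>Closedness under Wasserstein limits of being supported on a closed set\<close>

text \<open>Exchanging the second marginal \<open>q\<close> for \<open>w\<close> displaces the
  second coordinate according to \<open>s\<close>. By Markov's inequality the displacement reaches
  \<open>\<eta>\<close> only with probability \<open>cost s / \<eta>\<close>; otherwise a point that
  arrives in a ball started in the ball enlarged by \<open>\<eta>\<close>.\<close>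

lemma glue_right:
  assumes r: "radon_coupling T T p q r" and s: "radon_coupling T T q w s"
  obtains t where "radon_coupling T T p w t"
    "\<And>U y \<delta> \<eta>. U \<in> sets B \<Longrightarrow> 0 < \<eta> \<Longrightarrow>
      emeasure t (U \<times> mball y \<delta>) \<le> emeasure r (U \<times> mball y (\<delta> + \<eta>)) + cost s / ennreal \<eta>"
proof -
  let ?f = "\<lambda>z. ennreal (d (fst z) (snd z))"
  have f: "?f \<in> borel_measurable B2" using measurable_compose[OF d_measurable measurable_ennreal] .
  let ?g = "\<lambda>x. (snd (fst x), snd x)" and ?h = "\<lambda>x. (fst (fst x), snd x)"
  obtain R where R: "prob_space R"
    "fst \<in> measurable R B2" "?g \<in> measurable R B2" "?h \<in> measurable R B2"
    "distr R B2 fst = r" "distr R B2 ?g = s" "radon_coupling T T p w (distr R B2 ?h)"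
    "space R = (topspace T \<times> topspace T) \<times> topspace T"
    by (rule radon_coupling_compose[OF r s])
  have fg: "(\<lambda>x. ?f (?g x)) \<in> borel_measurable R" using measurable_compose[OF R(3) f] .
  show ?thesis
  proof (rule that[OF R(7)])
    fix U y and \<delta> \<eta> :: real assume U: "U \<in> sets B" and \<eta>: "0 < \<eta>"
    \<comment> \<open>The event that the second coordinate is displaced by at least
      \<open>\<eta>\<close>, written in the form in which Markov's inequality expects it.\<close>
    define E where "E = {x \<in> space R. 1 \<le> ennreal (1 / \<eta>) * ?f (?g x)}"
    have E: "E \<in> sets R" unfolding E_def using fg by measurable
    have A: "U \<times> mball y e \<in> sets B2" for e using U mball_sets by (rule Times_in_borel_of_prod)
    have UM: "U \<subseteq> pts X" using sets.sets_into_space[OF U] by simp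
    have "emeasure (distr R B2 ?h) (U \<times> mball y \<delta>) = emeasure R (?h -` (U \<times> mball y \<delta>) \<inter> space R)"
      using R(4) A by (simp add: emeasure_distr)
    also have "\<dots> \<le> emeasure R ((fst -` (U \<times> mball y (\<delta> + \<eta>)) \<inter> space R) \<union> E)"
    proof (rule emeasure_mono)
      show "?h -` (U \<times> mball y \<delta>) \<inter> space R \<subseteq> (fst -` (U \<times> mball y (\<delta> + \<eta>)) \<inter> space R) \<union> E"
      proof
        fix x assume x: "x \<in> ?h -` (U \<times> mball y \<delta>) \<inter> space R"
        obtain a b c where abc: "x = ((a, b), c)" by (metis surj_pair)
        have m: "a \<in> U" "b \<in> pts X" "c \<in> mball y \<delta>" using x by (auto simp: abc R(8))
        show "x \<in> (fst -` (U \<times> mball y (\<delta> + \<eta>)) \<inter> space R) \<union> E"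
        proof (cases "d b c < \<eta>")
          case True
          then have "b \<in> mball y (\<delta> + \<eta>)" using m triangle'[of y c b] by auto
          then show ?thesis using x m by (auto simp: abc)
        next
          case False
          then have "1 \<le> 1 / \<eta> * d b c" using \<eta> by simp
          then have "1 \<le> ennreal (1 / \<eta> * d b c)" by (metis ennreal_1 ennreal_leI)
          then have "x \<in> E" using x \<eta> by (auto simp: abc E_def simp flip: ennreal_mult)
          then show ?thesis by simp
        qed
      qed
      show "(fst -` (U \<times> mball y (\<delta> + \<eta>)) \<inter> space R) \<union> E \<in> sets R"
        using measurable_sets[OF R(2) A] E by auto
    qed
    also have "\<dots> \<le> emeasure R (fst -` (U \<times> mball y (\<delta> + \<eta>)) \<inter> space R) + emeasure R E"
      using measurable_sets[OF R(2) A] E by (intro emeasure_subadditive) auto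
    also have "emeasure R (fst -` (U \<times> mball y (\<delta> + \<eta>)) \<inter> space R) = emeasure r (U \<times> mball y (\<delta> + \<eta>))"
      unfolding R(5)[symmetric] using R(2) A by (simp add: emeasure_distr)
    also have "emeasure R E \<le> ennreal (1 / \<eta>) * (\<integral>\<^sup>+ x. ?f (?g x) \<partial>R)"
    proof -
      have "emeasure R E \<le> ennreal (1 / \<eta>) * (\<integral>\<^sup>+ x. ?f (?g x) * indicator (space R) x \<partial>R)"
        unfolding E_def using fg by (intro nn_integral_Markov_inequality) auto
      also have "(\<integral>\<^sup>+ x. ?f (?g x) * indicator (space R) x \<partial>R) = (\<integral>\<^sup>+ x. ?f (?g x) \<partial>R)"
        by (intro nn_integral_cong) simp
      finally show ?thesis .
    qed
    also have "(\<integral>\<^sup>+ x. ?f (?g x) \<partial>R) = cost s"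
      unfolding R(6)[symmetric] using R(3) f by (subst nn_integral_distr) simp_all
    also have "ennreal (1 / \<eta>) * cost s = cost s / ennreal \<eta>"
      using \<eta> by (simp add: divide_ennreal_def inverse_ennreal mult.commute inverse_eq_divide)
    finally show "emeasure (distr R B2 ?h) (U \<times> mball y \<delta>)
        \<le> emeasure r (U \<times> mball y (\<delta> + \<eta>)) + cost s / ennreal \<eta>"
      by simp
  qed
qed

lemma cost_swap:
  assumes "radon_coupling T T p q r"
  shows "cost (distr r B2 prod.swap) = cost r"
proof -
  have "prod.swap \<in> measurable r B2"
    using continuous_map_measurable[OF continuous_map_swap] radon_couplingD(5)[OF assms]
    by (simp cong: measurable_cong_sets)
  then show ?thesis
    using measurable_compose[OF d_measurable measurable_ennreal]
    by (subst nn_integral_distr) (simp_all add: commute)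
qed

text \<open>The mirror image of \<open>glue_right\<close>, obtained by swapping coordinates.\<close>

lemma glue_left:
  assumes s: "radon_coupling T T p q s" and r: "radon_coupling T T q w r"
  obtains t where "radon_coupling T T p w t"
    "\<And>U y \<delta> \<eta>. U \<in> sets B \<Longrightarrow> 0 < \<eta> \<Longrightarrow>
      emeasure t (mball y \<delta> \<times> U) \<le> emeasure r (mball y (\<delta> + \<eta>) \<times> U) + cost s / ennreal \<eta>"
proof -
  obtain t where t: "radon_coupling T T w p t"
    "\<And>U y \<delta> \<eta>. U \<in> sets B \<Longrightarrow> 0 < \<eta> \<Longrightarrow>
      emeasure t (U \<times> mball y \<delta>) \<le> emeasure (distr r B2 prod.swap) (U \<times> mball y (\<delta> + \<eta>))
        + cost (distr s B2 prod.swap) / ennreal \<eta>"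
    using glue_right[OF radon_coupling_swap[OF r] radon_coupling_swap[OF s]] by blast
  show ?thesis
  proof (rule that[OF radon_coupling_swap[OF t(1)]])
    fix U y and \<delta> \<eta> :: real assume U: "U \<in> sets B" and \<eta>: "0 < \<eta>"
    show "emeasure (distr t B2 prod.swap) (mball y \<delta> \<times> U)
        \<le> emeasure r (mball y (\<delta> + \<eta>) \<times> U) + cost s / ennreal \<eta>"
      using t(2)[OF U \<eta>, of y \<delta>]
      by (simp add: radon_coupling_swap_Times[OF t(1) U mball_sets]
          radon_coupling_swap_Times[OF r mball_sets U] cost_swap[OF s])
  qed
qed

end

text \<open>If \<open>E\<close> had positive mass, so would a compact subset of it; but finitely
  many of the given neighbourhoods cover that subset, and each contributes mass 0. This reduces
  almost sure statements to small boxes.\<close>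

lemma radon_prob_locally_null:
  assumes S: "metrizable_space S" and p: "radon_prob S p" and E: "E \<in> sets p"
    and loc: "\<And>x. x \<in> E \<Longrightarrow> \<exists>U. openin S U \<and> x \<in> U \<and> emeasure p (U \<inter> E) = 0"
  shows "emeasure p E = 0"
proof (rule ccontr)
  interpret prob_space p using p by (rule radon_probD)
  assume "emeasure p E \<noteq> 0"
  then have pos: "0 < measure p E"
    by (metis emeasure_eq_measure ennreal_0 measure_nonneg order_le_less)
  obtain C where C: "compactin S C" "C \<subseteq> E" "C \<in> sets p" "measure p (E - C) < measure p E"
    by (rule radon_prob_inner_diff[OF S p E pos])
  let ?F = "{U. openin S U \<and> emeasure p (U \<inter> E) = 0}"
  have "C \<subseteq> \<Union> ?F" using C(2) loc by blast
  then obtain G where G: "finite G" "G \<subseteq> ?F" "C \<subseteq> \<Union> G"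
    using compactinD[OF C(1), of ?F] by auto
  have "(\<Union>U\<in>G. U \<inter> E) \<in> null_sets p"
  proof (rule null_sets_UN')
    show "countable G" using G(1) by (rule countable_finite)
    show "U \<inter> E \<in> null_sets p" if "U \<in> G" for U
      using that G(2) E radon_probD(1)[OF p] by (auto simp: null_sets_def)
  qed
  moreover have "C \<subseteq> (\<Union>U\<in>G. U \<inter> E)" using G(3) C(2) by auto
  ultimately have "C \<in> null_sets p" using C(3) null_sets_subset by blast
  then have "measure p C = 0" by (simp add: null_sets_def measure_def)
  moreover have "measure p (E - C) = measure p E - measure p C"
    using C(2,3) E by (simp add: finite_measure_Diff)
  ultimately show False using C(4) by simp
qed

context metric_omet
begin

lemma W_approx_ex:
  assumes "p \<in> PX" "q \<in> PX" "W p q < c"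
  shows "\<exists>r. radon_coupling T T p q r \<and> cost r \<le> ennreal c"
  by (rule W_approx[OF assms]) (use less_imp_le in blast)

text \<open>Gluing \<open>a n\<close> on the left and \<open>b n\<close> on the right of
  \<open>r n\<close> yields couplings \<open>t n\<close> of the fixed pair \<open>p\<close>,
  \<open>q\<close>. A product of balls that stays away from \<open>Z\<close> is charged by
  \<open>t n\<close> with at most a multiple of \<open>e n\<close>, hence not at all by a cluster
  point. So the complement of \<open>Z\<close> is locally null.\<close>

lemma closed_support_limit:
  assumes p: "radon_prob T p" and q: "radon_prob T q" and Z: "closedin (prod_topology T T) Z"
    and a: "\<And>n. radon_coupling T T p (p' n) (a n)" "\<And>n. cost (a n) \<le> ennreal (e n)"
    and r: "\<And>n. radon_coupling T T (p' n) (q' n) (r n)" "\<And>n. AE z in r n. z \<in> Z"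
    and b: "\<And>n. radon_coupling T T (q' n) q (b n)" "\<And>n. cost (b n) \<le> ennreal (e n)"
    and e: "e \<longlonglongrightarrow> 0" "\<And>n. 0 \<le> e n"
  obtains t where "radon_coupling T T p q t" "AE z in t. z \<in> Z"
proof -
  \<comment> \<open>The radius is doubled because either gluing step enlarges one of the two balls
    by \<open>\<eta>\<close>, which is taken to be \<open>\<delta>\<close>.\<close>
  define bad where "bad x y \<delta> \<longleftrightarrow> (mball x (\<delta> + \<delta>) \<times> mball y (\<delta> + \<delta>)) \<inter> Z = {}" for x y \<delta>
  have ex: "\<forall>n. \<exists>t. radon_coupling T T p q t \<and> (\<forall>x y \<delta>. 0 < \<delta> \<longrightarrow> bad x y \<delta> \<longrightarrow>
      emeasure t (mball x \<delta> \<times> mball y \<delta>) \<le> ennreal (2 * e n / \<delta>))"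
    (is "\<forall>n. ?P n")
  proof
    fix n
    obtain s where s: "radon_coupling T T (p' n) q s"
      "\<And>U y \<delta> \<eta>. U \<in> sets B \<Longrightarrow> 0 < \<eta> \<Longrightarrow>
        emeasure s (U \<times> mball y \<delta>) \<le> emeasure (r n) (U \<times> mball y (\<delta> + \<eta>)) + cost (b n) / ennreal \<eta>"
      using glue_right[OF r(1) b(1), of n] by blast
    obtain t where t: "radon_coupling T T p q t"
      "\<And>U y \<delta> \<eta>. U \<in> sets B \<Longrightarrow> 0 < \<eta> \<Longrightarrow>
        emeasure t (mball y \<delta> \<times> U) \<le> emeasure s (mball y (\<delta> + \<eta>) \<times> U) + cost (a n) / ennreal \<eta>"
      using glue_left[OF a(1) s(1)] by blast
    have "emeasure t (mball x \<delta> \<times> mball y \<delta>) \<le> ennreal (2 * e n / \<delta>)" if \<delta>: "0 < \<delta>" and bad: "bad x y \<delta>" for x y \<delta>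
    proof -
      have c: "c / ennreal \<delta> \<le> ennreal (e n / \<delta>)" if "c \<le> ennreal (e n)" for c
        using divide_right_mono_ennreal[OF that, of "ennreal \<delta>"] \<delta> e(2)[of n] by (simp add: divide_ennreal)
      have "AE z in r n. z \<notin> mball x (\<delta> + \<delta>) \<times> mball y (\<delta> + \<delta>)"
        using r(2)[of n] by eventually_elim (use bad in \<open>auto simp: bad_def\<close>)
      then have "emeasure (r n) {z \<in> space (r n). z \<in> mball x (\<delta> + \<delta>) \<times> mball y (\<delta> + \<delta>)} = 0"
        by (rule emeasure_eq_0_AE)
      moreover have "{z \<in> space (r n). z \<in> mball x (\<delta> + \<delta>) \<times> mball y (\<delta> + \<delta>)} = mball x (\<delta> + \<delta>) \<times> mball y (\<delta> + \<delta>)"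
        by (auto simp: radon_couplingD(9)[OF r(1)])
      ultimately have z: "emeasure (r n) (mball x (\<delta> + \<delta>) \<times> mball y (\<delta> + \<delta>)) = 0"
        by simp
      have "emeasure t (mball x \<delta> \<times> mball y \<delta>) \<le> emeasure s (mball x (\<delta> + \<delta>) \<times> mball y \<delta>) + cost (a n) / ennreal \<delta>"
        by (rule t(2)[OF mball_sets \<delta>])
      also have "\<dots> \<le> (0 + cost (b n) / ennreal \<delta>) + cost (a n) / ennreal \<delta>"
        using s(2)[OF mball_sets \<delta>, of x "\<delta> + \<delta>" y \<delta>] z by (intro add_right_mono) simp
      also have "\<dots> \<le> ennreal (e n / \<delta>) + ennreal (e n / \<delta>)"
        using c[OF a(2)] c[OF b(2)] by (simp add: add_mono)
      also have "\<dots> = ennreal (2 * e n / \<delta>)" using \<delta> e(2)[of n] by (simp flip: ennreal_plus)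
      finally show ?thesis .
    qed
    with t(1) show "?P n" by blast
  qed
  from choice[OF ex] obtain t where t: "\<And>n. radon_coupling T T p q (t n)"
    "\<And>n x y \<delta>. 0 < \<delta> \<Longrightarrow> bad x y \<delta> \<Longrightarrow> emeasure (t n) (mball x \<delta> \<times> mball y \<delta>) \<le> ennreal (2 * e n / \<delta>)"
    by blast
  obtain H t' where H: "H \<le> sequentially" "H \<noteq> bot" and t': "radon_coupling T T p q t'"
    and lim: "\<And>U V. U \<in> sets B \<Longrightarrow> V \<in> sets B \<Longrightarrow>
      ((\<lambda>n. measure (t n) (U \<times> V)) \<longlongrightarrow> measure t' (U \<times> V)) H"
    using radon_coupling_cluster[of T T p q t, OF t(1)] by blast
  note D = radon_couplingD[OF t']
  interpret t': prob_space t' by (rule D)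
  have null: "emeasure t' (mball x \<delta> \<times> mball y \<delta>) = 0" if \<delta>: "0 < \<delta>" and bad: "bad x y \<delta>" for x y \<delta>
  proof -
    have le: "measure (t n) (mball x \<delta> \<times> mball y \<delta>) \<le> 2 * e n / \<delta>" for n
      using t(2)[OF that, of n] e(2)[of n] \<delta>
      by (simp add: finite_measure.emeasure_eq_measure prob_space.finite_measure radon_couplingD(6)[OF t(1)])
    have lim0: "((\<lambda>n. 2 * e n / \<delta>) \<longlongrightarrow> 0) H"
      using tendsto_divide[OF tendsto_mult[OF tendsto_const[of 2] e(1)] tendsto_const[of \<delta>]] \<delta>
      by (intro tendsto_mono[OF H(1)]) simp
    have "((\<lambda>n. measure (t n) (mball x \<delta> \<times> mball y \<delta>)) \<longlongrightarrow> 0) H"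
      by (rule tendsto_sandwich[OF _ _ tendsto_const lim0]) (simp_all add: le)
    from tendsto_unique[OF H(2) lim[OF mball_sets mball_sets] this]
    have "measure t' (mball x \<delta> \<times> mball y \<delta>) = 0" .
    then show ?thesis by (simp add: t'.emeasure_eq_measure)
  qed
  have oZ: "openin (prod_topology T T) (pts X \<times> pts X - Z)" using Z by (simp add: closedin_def)
  have sZ: "pts X \<times> pts X - Z \<in> sets t'" using borel_of_open[OF oZ] by (simp add: D(5))
  have "emeasure t' (pts X \<times> pts X - Z) = 0"
  proof (rule radon_prob_locally_null[OF metrizable_T2 radon_coupling_radon[OF t'] sZ])
    fix z assume z: "z \<in> pts X \<times> pts X - Z"
    obtain x y where xy: "z = (x, y)" by (cases z)
    obtain U V where UV: "openin T U" "openin T V" "x \<in> U" "y \<in> V" "U \<times> V \<subseteq> pts X \<times> pts X - Z"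
      using oZ z unfolding xy openin_prod_topology_alt by meson
    obtain r1 where r1: "r1 > 0" "mball x r1 \<subseteq> U" using UV(1,3) by (auto simp: T_def openin_mtopology)
    obtain r2 where r2: "r2 > 0" "mball y r2 \<subseteq> V" using UV(2,4) by (auto simp: T_def openin_mtopology)
    define \<delta> where "\<delta> = min r1 r2 / 2"
    have \<delta>: "\<delta> > 0" using r1 r2 by (simp add: \<delta>_def)
    have "mball x (\<delta> + \<delta>) \<subseteq> U" "mball y (\<delta> + \<delta>) \<subseteq> V"
      using r1(2) r2(2) mball_subset_concentric[of "\<delta> + \<delta>" r1 x] mball_subset_concentric[of "\<delta> + \<delta>" r2 y]
      by (auto simp: \<delta>_def)
    then have "bad x y \<delta>" using UV(5) unfolding bad_def by blast
    then have "emeasure t' (mball x \<delta> \<times> mball y \<delta>) = 0" using null[OF \<delta>] by simp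
    moreover have "emeasure t' (mball x \<delta> \<times> mball y \<delta> \<inter> (pts X \<times> pts X - Z)) \<le> emeasure t' (mball x \<delta> \<times> mball y \<delta>)"
      using Times_in_borel_of_prod[OF mball_sets mball_sets] by (intro emeasure_mono) (auto simp: D(5))
    moreover have "z \<in> mball x \<delta> \<times> mball y \<delta>" using z \<delta> by (auto simp: xy)
    moreover have "openin (prod_topology T T) (mball x \<delta> \<times> mball y \<delta>)"
      by (simp add: openin_prod_Times_iff openin_mball_T)
    ultimately show "\<exists>U. openin (prod_topology T T) U \<and> z \<in> U \<and> emeasure t' (U \<inter> (pts X \<times> pts X - Z)) = 0"
      by (metis le_zero_eq)
  qed
  then have "AE z in t'. z \<in> Z"
    using sZ by (subst AE_iff_measurable[of "pts X \<times> pts X - Z"]) (auto simp: D(9))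
  with t' show ?thesis by (rule that)
qed

lemma AE_diagonal_imp_eq:
  assumes r: "radon_coupling T T p q r" and AE: "AE z in r. fst z = snd z"
  shows "p = q"
proof -
  note D = radon_couplingD[OF r]
  have "distr r B fst = distr r B snd"
    using AE D by (intro distr_cong_AE) auto
  then show ?thesis using D(7,8) by simp
qed

lemma cost_diagonal:
  assumes p: "radon_prob T p"
  shows "cost (distr p B2 (\<lambda>x. (x, x))) = 0"
proof -
  have "cost (distr p B2 (\<lambda>x. (x, x))) = (\<integral>\<^sup>+ x. ennreal (d x x) \<partial>p)"
    using diagonal_coupling(2)[OF p] measurable_compose[OF d_measurable measurable_ennreal]
    by (subst nn_integral_distr) simp_all
  also have "\<dots> = (\<integral>\<^sup>+ x. 0 \<partial>p)"
    by (intro nn_integral_cong) (simp add: radon_probD[OF p])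
  finally show ?thesis by simp
qed

lemma W_self: assumes p: "p \<in> PX" shows "W p p = 0"
  using W_le[OF p p diagonal_coupling(1)[OF PX_D(1)[OF p]]] cost_diagonal[OF PX_D(1)[OF p]]
  by (simp add: order_antisym)

lemma diagonal_AE:
  assumes p: "radon_prob T p" and "closedin (prod_topology T T) Z" "\<And>x. x \<in> pts X \<Longrightarrow> (x, x) \<in> Z"
  shows "AE z in distr p B2 (\<lambda>x. (x, x)). z \<in> Z"
proof -
  have "Z \<in> sets B2" using assms(2) by (rule borel_of_closed)
  then have "{z \<in> space B2. z \<in> Z} \<in> sets B2"
    using sets.sets_into_space[of Z B2] by (simp add: Int_absorb1 Int_def[symmetric] Collect_conj_eq)
  then show ?thesis
    using assms(3) radon_probD[OF p] by (subst AE_distr_iff[OF diagonal_coupling(2)[OF p]]) auto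
qed

text \<open>Vanishing distance is a limit of couplings supported on the diagonal.\<close>

lemma W_zero_imp_eq:
  assumes p: "p \<in> PX" and q: "q \<in> PX" and W: "W p q = 0"
  shows "p = q"
proof -
  let ?Z = "(\<lambda>x. (x, x)) ` topspace T" and ?r = "distr p B2 (\<lambda>x. (x, x))"
  have Z: "closedin (prod_topology T T) ?Z"
    using Hausdorff_T by (simp add: Hausdorff_space_closedin_diagonal)
  have ex: "\<forall>n. \<exists>b. radon_coupling T T p q b \<and> cost b \<le> ennreal (inverse (Suc n))"
    by (intro allI W_approx_ex[OF p q]) (simp add: W)
  from choice[OF ex] obtain b where b: "\<And>n. radon_coupling T T p q (b n)"
    "\<And>n. cost (b n) \<le> ennreal (inverse (Suc n))" by blast
  note c = diagonal_coupling[OF PX_D(1)[OF p]]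
  have c0: "cost ?r \<le> ennreal (inverse (Suc n))" for n
    by (simp add: cost_diagonal[OF PX_D(1)[OF p]])
  have AE: "AE z in ?r. z \<in> ?Z" by (rule diagonal_AE[OF PX_D(1)[OF p] Z]) auto
  obtain t where "radon_coupling T T p q t" "AE z in t. z \<in> ?Z"
    using closed_support_limit[OF PX_D(1)[OF p] PX_D(1)[OF q] Z c(1) c0 c(1) AE b LIMSEQ_inverse_real_of_nat]
    by auto
  then show ?thesis by (intro AE_diagonal_imp_eq) (auto elim: eventually_mono)
qed

lemma Metric_space_W: "Metric_space PX W"
proof
  show "W p q = 0 \<longleftrightarrow> p = q" if "p \<in> PX" "q \<in> PX" for p q
    using W_self W_zero_imp_eq that by blast
qed (auto simp: W_triangle intro: W_commute)

end

section \<open>The stochastic order\<close>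

locale ordered_omet = metric_omet X for X :: "'a omet" +
  assumes partial_order: "partial_order_on (pts X) (leq X)"
    and closed_leq: "closedin (prod_topology (omet_topology X) (omet_topology X)) (leq X)"
begin

lemma leq_sets: "leq X \<in> sets B2"
  using closed_leq by (rule borel_of_closed)

lemma leq_sub: "leq X \<subseteq> pts X \<times> pts X"
  using closedin_subset[OF closed_leq] by simp

lemma leq_refl: "x \<in> pts X \<Longrightarrow> (x, x) \<in> leq X"
  using partial_order by (auto simp: partial_order_on_def preorder_on_def refl_on_def)

lemma leq_trans: "(x, y) \<in> leq X \<Longrightarrow> (y, z) \<in> leq X \<Longrightarrow> (x, z) \<in> leq X"
  using partial_order by (auto simp: partial_order_on_def preorder_on_def elim: transE)

lemma leq_antisym: "(x, y) \<in> leq X \<Longrightarrow> (y, x) \<in> leq X \<Longrightarrow> x = y"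
  using partial_order by (auto simp: partial_order_on_def elim: antisymD)

lemma AE_leq_iff:
  assumes "radon_coupling T T p q r"
  shows "(AE z in r. z \<in> leq X) \<longleftrightarrow> emeasure r (pts X \<times> pts X - leq X) = 0"
proof (rule AE_iff_measurable)
  note D = radon_couplingD[OF assms]
  show "pts X \<times> pts X - leq X \<in> sets r"
    using sets.compl_sets[OF leq_sets] by (simp add: D(5))
qed (auto simp: radon_couplingD(9)[OF assms])

lemma stochastic_order_iff:
  "(p, q) \<in> stochastic_order X \<longleftrightarrow>
    p \<in> PX \<and> q \<in> PX \<and> (\<exists>r. radon_coupling T T p q r \<and> (AE z in r. z \<in> leq X))"
  unfolding stochastic_order_def
  by (auto simp: AE_leq_iff couplings_iff PX_D(1))

lemma stochastic_refl: "p \<in> PX \<Longrightarrow> (p, p) \<in> stochastic_order X"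
  unfolding stochastic_order_iff
  using diagonal_coupling(1) diagonal_AE[OF _ closed_leq leq_refl] PX_D(1) by blast

lemma stochastic_trans:
  assumes "(p, q) \<in> stochastic_order X" "(q, w) \<in> stochastic_order X"
  shows "(p, w) \<in> stochastic_order X"
proof -
  from assms(1) obtain r where pq: "p \<in> PX" "q \<in> PX" and r: "radon_coupling T T p q r" "AE z in r. z \<in> leq X"
    by (auto simp: stochastic_order_iff)
  from assms(2) obtain s where w: "w \<in> PX" and s: "radon_coupling T T q w s" "AE z in s. z \<in> leq X"
    by (auto simp: stochastic_order_iff)
  let ?g = "\<lambda>x. (snd (fst x), snd x)" and ?h = "\<lambda>x. (fst (fst x), snd x)"
  obtain R where R: "prob_space R" "fst \<in> measurable R B2" "?g \<in> measurable R B2" "?h \<in> measurable R B2"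
    "distr R B2 fst = r" "distr R B2 ?g = s" "radon_coupling T T p w (distr R B2 ?h)"
    "space R = (topspace T \<times> topspace T) \<times> topspace T"
    by (rule radon_coupling_compose[OF r(1) s(1)])
  have m: "{z \<in> space B2. z \<in> leq X} \<in> sets B2"
    using leq_sets sets.sets_into_space[OF leq_sets] by (simp add: Collect_conj_eq Int_absorb1)
  have "AE x in R. fst x \<in> leq X" using r(2) unfolding R(5)[symmetric] AE_distr_iff[OF R(2) m] .
  moreover have "AE x in R. ?g x \<in> leq X" using s(2) unfolding R(6)[symmetric] AE_distr_iff[OF R(3) m] .
  ultimately have "AE x in R. ?h x \<in> leq X"
    by eventually_elim (metis leq_trans prod.collapse)
  then have "AE z in distr R B2 ?h. z \<in> leq X" unfolding AE_distr_iff[OF R(4) m] .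
  with pq w R(7) show ?thesis unfolding stochastic_order_iff by blast
qed

text \<open>Lower witnesses of a convergent sequence have a subsequence converging in
  \<open>V\<close>, and the closed graph passes to the limit. Compactness of \<open>V\<close> thus
  makes the up-closure closed, and in particular a Borel set to which measures can be
  applied.\<close>

lemma up_closure_compact_closed:
  assumes V: "compactin T V"
  shows "closedin T {z \<in> pts X. \<exists>v\<in>V. (v, z) \<in> leq X}" (is "closedin T ?A")
  unfolding T_def metric_closedin_iff_sequentially_closed
proof (intro conjI allI impI)
  fix \<sigma> l assume *: "range \<sigma> \<subseteq> ?A \<and> limitin mtopology \<sigma> l sequentially"
  then have "\<forall>n. \<exists>v\<in>V. (v, \<sigma> n) \<in> leq X" by blast
  then obtain v where v: "\<And>n. v n \<in> V" "\<And>n. (v n, \<sigma> n) \<in> leq X" by metis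
  obtain u \<rho> where u: "u \<in> V" "strict_mono \<rho>" "limitin mtopology (v \<circ> \<rho>) u sequentially"
    using V v(1) unfolding T_def compactin_sequentially by blast
  have "limitin mtopology (\<sigma> \<circ> \<rho>) l sequentially" using * u(2) by (metis limitin_subsequence)
  with u(3) have "limitin (prod_topology T T) (\<lambda>n. (v (\<rho> n), \<sigma> (\<rho> n))) (u, l) sequentially"
    by (simp add: limitin_pairwise T_def comp_def)
  then have "(u, l) \<in> leq X"
    by (rule limitin_closedin[OF _ closed_leq]) (use v in auto)
  with u(1) leq_sub show "l \<in> ?A" by auto
qed auto

lemma stochastic_le_up_set:
  assumes pq: "(p, q) \<in> stochastic_order X" and A: "A \<in> sets B"
    and up: "\<And>x y. x \<in> A \<Longrightarrow> (x, y) \<in> leq X \<Longrightarrow> y \<in> A"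
  shows "emeasure p A \<le> emeasure q A"
proof -
  obtain r where r: "radon_coupling T T p q r" "AE z in r. z \<in> leq X"
    using pq by (auto simp: stochastic_order_iff)
  have "emeasure p A = emeasure r (A \<times> topspace T)" using radon_coupling_emeasure_fst[OF r(1) A] by simp
  also have "\<dots> \<le> emeasure r (topspace T \<times> A)"
  proof (rule emeasure_mono_AE)
    show "AE z in r. z \<in> A \<times> topspace T \<longrightarrow> z \<in> topspace T \<times> A"
      using r(2) by eventually_elim (use up leq_sub in auto)
    show "topspace T \<times> A \<in> sets r" by (rule radon_coupling_emeasure_snd[OF r(1) A])
  qed
  also have "\<dots> = emeasure q A" using radon_coupling_emeasure_snd[OF r(1) A] by simp
  finally show ?thesis .
qed

text \<open>If a coupling of \<open>p \<le> q\<close> charges the strict order, it charges some compact set \<open>C\<close> of strict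
  pairs such that the up-closure \<open>A\<close> of the second projection of \<open>C\<close> avoids the first one. Then
  \<open>p A < q A\<close>, which excludes \<open>q \<le> p\<close>.\<close>

lemma stochastic_antisym:
  assumes pq: "(p, q) \<in> stochastic_order X" and qp: "(q, p) \<in> stochastic_order X"
  shows "p = q"
proof -
  obtain r where r: "radon_coupling T T p q r" "AE z in r. z \<in> leq X"
    using pq by (auto simp: stochastic_order_iff)
  note D = radon_couplingD[OF r(1)]
  interpret r: prob_space r by (rule D)
  let ?diag = "(\<lambda>x. (x, x)) ` topspace T"
  have dc: "closedin (prod_topology T T) ?diag"
    using Hausdorff_T by (simp add: Hausdorff_space_closedin_diagonal)
  define E where "E = leq X - ?diag"
  have E: "E \<in> sets r" using leq_sets borel_of_closed[OF dc] by (simp add: D(5) E_def)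
  have oN: "openin (prod_topology T T) (pts X \<times> pts X - leq X)" using closed_leq by (simp add: closedin_def)
  have "emeasure r E = 0"
  proof (rule radon_prob_locally_null[OF metrizable_T2 radon_coupling_radon[OF r(1)] E])
    fix z assume z: "z \<in> E"
    obtain x y where xy: "z = (x, y)" by (cases z)
    have x: "x \<in> pts X" "y \<in> pts X" "(x, y) \<in> leq X" "x \<noteq> y" using z leq_sub by (auto simp: E_def xy)
    then have "(y, x) \<in> pts X \<times> pts X - leq X" using leq_antisym by auto
    \<comment> \<open>No point of \<open>V\<close> lies below a point of \<open>U\<close>. As
      \<open>C\<close> sits in \<open>U \<times> V\<close>, the up-closure of its second projection
      misses all its first coordinates.\<close>
    then obtain V U where UV: "openin T U" "openin T V" "x \<in> U" "y \<in> V" "V \<times> U \<subseteq> pts X \<times> pts X - leq X"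
      using oN unfolding openin_prod_topology_alt by meson
    have UVs: "U \<times> V \<in> sets r" using Times_in_borel_of_prod[OF borel_of_open[OF UV(1)] borel_of_open[OF UV(2)]] by (simp add: D(5))
    have "emeasure r ((U \<times> V) \<inter> E) = 0"
    proof (rule ccontr)
      assume "emeasure r ((U \<times> V) \<inter> E) \<noteq> 0"
      then have pos: "0 < measure r ((U \<times> V) \<inter> E)"
        by (metis r.emeasure_eq_measure ennreal_0 measure_nonneg order_le_less)
      have UVE: "(U \<times> V) \<inter> E \<in> sets r" using UVs E by auto
      obtain C where C: "compactin (prod_topology T T) C" "C \<subseteq> (U \<times> V) \<inter> E" "C \<in> sets r"
        "measure r (((U \<times> V) \<inter> E) - C) < measure r ((U \<times> V) \<inter> E)"
        by (rule radon_prob_inner_diff[OF metrizable_T2 radon_coupling_radon[OF r(1)] UVE pos])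
      have Cpos: "0 < measure r C"
        using C(2,3,4) UVE by (simp add: r.finite_measure_Diff)
      define A where "A = {z \<in> pts X. \<exists>v\<in>snd ` C. (v, z) \<in> leq X}"
      have A: "A \<in> sets B"
        unfolding A_def by (intro borel_of_closed up_closure_compact_closed image_compactin[OF C(1) continuous_map_snd])
      have le: "emeasure q A \<le> emeasure p A"
        by (rule stochastic_le_up_set[OF qp A]) (use leq_sub in \<open>auto simp: A_def intro: leq_trans\<close>)
      have CA: "C \<subseteq> (topspace T - A) \<times> A"
      proof
        fix c assume c: "c \<in> C"
        obtain u v where uv: "c = (u, v)" by (cases c)
        have "u \<in> U" "v \<in> V" "(u, v) \<in> leq X" using c C(2) by (auto simp: uv E_def)
        have "v \<in> A" using c \<open>(u, v) \<in> leq X\<close> leq_sub leq_refl by (force simp: A_def uv)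
        moreover have "u \<notin> A"
        proof
          assume "u \<in> A"
          then obtain u' v' where "(u', v') \<in> C" "(v', u) \<in> leq X" by (auto simp: A_def)
          then show False using C(2) UV(5) \<open>u \<in> U\<close> by blast
        qed
        ultimately show "c \<in> (topspace T - A) \<times> A" using \<open>(u, v) \<in> leq X\<close> leq_sub by (auto simp: uv)
      qed
      have AT: "A \<times> topspace T \<in> sets r" "topspace T \<times> A \<in> sets r"
        using radon_coupling_emeasure_fst(2)[OF r(1) A] radon_coupling_emeasure_snd(2)[OF r(1) A] .
      \<comment> \<open>The sets \<open>A \<times> topspace T\<close> and \<open>C\<close> are
        disjoint, and almost surely both land in \<open>topspace T \<times> A\<close>: the first
        because \<open>A\<close> is an up-set, the second by the choice of \<open>A\<close>. So
        \<open>q A\<close> exceeds \<open>p A\<close> by at least the mass of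
        \<open>C\<close>.\<close>
      have "measure p A + measure r C = measure r (A \<times> topspace T) + measure r C"
        using radon_coupling_emeasure_fst(1)[OF r(1) A] by (simp add: measure_def)
      also have "\<dots> = measure r (A \<times> topspace T \<union> C)"
        using AT(1) C(3) CA by (intro r.finite_measure_Union[symmetric]) auto
      also have "\<dots> \<le> measure r (topspace T \<times> A)"
      proof (rule r.finite_measure_mono_AE)
        show "AE z in r. z \<in> A \<times> topspace T \<union> C \<longrightarrow> z \<in> topspace T \<times> A"
          using r(2)
        proof eventually_elim
          fix z assume z: "z \<in> leq X"
          obtain a b where ab: "z = (a, b)" by (cases z)
          have "b \<in> A" if "a \<in> A"
          proof -
            from that obtain v where "v \<in> snd ` C" "(v, a) \<in> leq X" unfolding A_def by blast
            then show ?thesis using leq_trans[of v a b] z leq_sub unfolding A_def ab by blast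
          qed
          then show "z \<in> A \<times> topspace T \<union> C \<longrightarrow> z \<in> topspace T \<times> A"
            using CA z leq_sub unfolding ab topspace_T by blast
        qed
      qed (use AT in auto)
      also have "\<dots> = measure q A"
        using radon_coupling_emeasure_snd(1)[OF r(1) A] by (simp add: measure_def)
      finally have "measure p A < measure q A" using Cpos by simp
      moreover have "measure q A \<le> measure p A"
        using le radon_probD(2)[OF D(3)] radon_probD(2)[OF D(4)]
        by (simp add: finite_measure.emeasure_eq_measure prob_space.finite_measure)
      ultimately show False by simp
    qed
    then show "\<exists>U. openin (prod_topology T T) U \<and> z \<in> U \<and> emeasure r (U \<inter> E) = 0"
      using UV by (intro exI[of _ "U \<times> V"]) (auto simp: xy openin_prod_Times_iff)
  qed
  then have "AE z in r. z \<notin> E" using E by (intro AE_not_in) (simp add: null_sets_def)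
  then have "AE z in r. fst z = snd z"
    using r(2) AE_space by eventually_elim (auto simp: E_def D(9))
  then show ?thesis by (rule AE_diagonal_imp_eq[OF r(1)])
qed

lemma partial_order_stochastic: "partial_order_on PX (stochastic_order X)"
  unfolding partial_order_on_def preorder_on_def
proof (intro conjI)
  show "stochastic_order X \<subseteq> PX \<times> PX" by (auto simp: stochastic_order_def)
  show "refl_on PX (stochastic_order X)" by (auto simp: refl_on_def stochastic_refl)
  show "trans (stochastic_order X)" using stochastic_trans by (rule transI)
  show "antisym (stochastic_order X)" using stochastic_antisym by (rule antisymI)
qed

lemma closed_stochastic:
  "closedin (prod_topology (Metric_space.mtopology PX W) (Metric_space.mtopology PX W)) (stochastic_order X)"
proof -
  interpret P: Metric_space PX W by (rule Metric_space_W)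
  interpret PP: Metric_space12 PX W PX W ..
  show ?thesis
    unfolding PP.mtopology_prod_metric[symmetric] PP.Prod_metric.metric_closedin_iff_sequentially_closed
  proof (intro conjI allI impI)
    show "stochastic_order X \<subseteq> PX \<times> PX" by (auto simp: stochastic_order_def)
    fix \<sigma> l
    assume *: "range \<sigma> \<subseteq> stochastic_order X \<and> limitin PP.Prod_metric.mtopology \<sigma> l sequentially"
    obtain p q where l: "l = (p, q)" by (cases l)
    define p' where "p' n = fst (\<sigma> n)" for n
    define q' where "q' n = snd (\<sigma> n)" for n
    have so: "(p' n, q' n) \<in> stochastic_order X" for n using * by (auto simp: p'_def q'_def)
    have PQ: "p' n \<in> PX" "q' n \<in> PX" for n using so by (auto simp: stochastic_order_def)
    have lim: "limitin P.mtopology p' p sequentially" "limitin P.mtopology q' q sequentially"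
      using * unfolding PP.mtopology_prod_metric by (auto simp: limitin_pairwise l comp_def p'_def[abs_def] q'_def[abs_def])
    have p: "p \<in> PX" and q: "q \<in> PX" using lim P.limitin_mspace by blast+
    have W0: "(\<lambda>n. W (p' n) p) \<longlonglongrightarrow> 0" "(\<lambda>n. W (q' n) q) \<longlonglongrightarrow> 0"
      using lim by (auto simp: P.limitin_metric_dist_null)
    \<comment> \<open>The last summand makes the bounds strict, as near-optimal couplings are
      available only above the distance; the sum of both distances lets one sequence serve for
      \<open>a\<close> and for \<open>b\<close>.\<close>
    define e where "e n = W (p' n) p + W (q' n) q + inverse (Suc n)" for n
    have e: "e \<longlonglongrightarrow> 0"
      using tendsto_add[OF tendsto_add[OF W0] LIMSEQ_inverse_real_of_nat] by (simp add: e_def[abs_def])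
    have e1: "W p (p' n) < e n" "W (q' n) q < e n" "0 \<le> e n" for n
      using W_nonneg[of "q' n" q] W_nonneg[of "p' n" p]
      by (auto simp: e_def W_commute[of p] intro: add_nonneg_pos add_pos_pos)
    have ex: "\<forall>n. \<exists>a. radon_coupling T T p (p' n) a \<and> cost a \<le> ennreal (e n)"
      by (intro allI W_approx_ex[OF p PQ(1) e1(1)])
    from choice[OF ex] obtain a where a: "\<And>n. radon_coupling T T p (p' n) (a n)"
      "\<And>n. cost (a n) \<le> ennreal (e n)" by blast
    have ex: "\<forall>n. \<exists>b. radon_coupling T T (q' n) q b \<and> cost b \<le> ennreal (e n)"
      by (intro allI W_approx_ex[OF PQ(2) q e1(2)])
    from choice[OF ex] obtain b where b: "\<And>n. radon_coupling T T (q' n) q (b n)"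
      "\<And>n. cost (b n) \<le> ennreal (e n)" by blast
    have ex: "\<forall>n. \<exists>r. radon_coupling T T (p' n) (q' n) r \<and> (AE z in r. z \<in> leq X)"
      using so by (simp add: stochastic_order_iff)
    from choice[OF ex] obtain r where r: "\<And>n. radon_coupling T T (p' n) (q' n) (r n)"
      "\<And>n. AE z in r n. z \<in> leq X" by blast
    obtain t where "radon_coupling T T p q t" "AE z in t. z \<in> leq X"
      by (rule closed_support_limit[OF PX_D(1)[OF p] PX_D(1)[OF q] closed_leq a r b e e1(3)])
    then show "l \<in> stochastic_order X" unfolding l stochastic_order_iff using p q by blast
  qed
qed

end

section \<open>Finitely supported measures\<close>

context metric_omet
begin

text \<open>Masses sit on labels rather than on points. Repetitions of points are then harmless, and
  two maps on the same labels give a coupling of their laws at once.\<close>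

definition fin_law :: "'i set \<Rightarrow> ('i \<Rightarrow> real) \<Rightarrow> ('i \<Rightarrow> 'a) \<Rightarrow> 'a measure"
  where "fin_law I w u = distr (point_measure I (\<lambda>i. ennreal (w i))) B u"

definition weights :: "'i set \<Rightarrow> ('i \<Rightarrow> real) \<Rightarrow> bool"
  where "weights I w \<longleftrightarrow> finite I \<and> (\<forall>i\<in>I. 0 \<le> w i) \<and> sum w I = 1"

lemma point_measure_measurable:
  "u \<in> I \<rightarrow> space N \<Longrightarrow> u \<in> measurable (point_measure I f) N"
  by (auto simp: point_measure_def measurable_count_space_eq1 cong: measurable_cong_sets)

lemma emeasure_law:
  assumes w: "weights I w" and u: "u \<in> I \<rightarrow> space N" and A: "A \<in> sets N"
  shows "emeasure (distr (point_measure I (\<lambda>i. ennreal (w i))) N u) A = ennreal (\<Sum>i\<in>I. w i * indicator A (u i))"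
proof -
  have fin: "finite I" and pos: "\<And>i. i \<in> I \<Longrightarrow> 0 \<le> w i" using w by (auto simp: weights_def)
  have "emeasure (distr (point_measure I (\<lambda>i. ennreal (w i))) N u) A
      = emeasure (point_measure I (\<lambda>i. ennreal (w i))) {i \<in> I. u i \<in> A}"
    using point_measure_measurable[OF u] A
    by (subst emeasure_distr) (auto simp: space_point_measure intro!: arg_cong[of _ _ "emeasure _"])
  also have "\<dots> = (\<Sum>i\<in>{i \<in> I. u i \<in> A}. ennreal (w i))"
    using fin by (intro emeasure_point_measure_finite) auto
  also have "\<dots> = ennreal (\<Sum>i\<in>{i \<in> I. u i \<in> A}. w i)"
    using pos by (intro sum_ennreal) auto
  also have "(\<Sum>i\<in>{i \<in> I. u i \<in> A}. w i) = (\<Sum>i\<in>I. w i * indicator A (u i))"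
    using fin by (intro sum.mono_neutral_cong_left) (auto simp: indicator_def)
  finally show ?thesis .
qed

lemma emeasure_fin_law:
  assumes "weights I w" "u \<in> I \<rightarrow> pts X" "A \<in> sets B"
  shows "emeasure (fin_law I w u) A = ennreal (\<Sum>i\<in>I. w i * indicator A (u i))"
  unfolding fin_law_def using assms by (intro emeasure_law) auto

lemma prob_space_point_measure: "weights I w \<Longrightarrow> prob_space (point_measure I (\<lambda>i. ennreal (w i)))"
  unfolding weights_def
  by (intro prob_spaceI) (simp add: space_point_measure emeasure_point_measure_finite)

lemma fin_law_eqI:
  assumes "weights I w" "u \<in> I \<rightarrow> pts X" "weights J v" "y \<in> J \<rightarrow> pts X"
    and "\<And>A. A \<in> sets B \<Longrightarrow> (\<Sum>i\<in>I. w i * indicator A (u i)) = (\<Sum>j\<in>J. v j * indicator A (y j))"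
  shows "fin_law I w u = fin_law J v y"
proof (rule measure_eqI)
  show "sets (fin_law I w u) = sets (fin_law J v y)" by (simp add: fin_law_def)
  fix A assume "A \<in> sets (fin_law I w u)"
  then have "A \<in> sets B" by (simp add: fin_law_def)
  then show "emeasure (fin_law I w u) A = emeasure (fin_law J v y) A"
    using assms by (simp add: emeasure_fin_law)
qed

lemma fin_law_radon:
  assumes w: "weights I w" and u: "u \<in> I \<rightarrow> pts X"
  shows "radon_prob T (fin_law I w u)"
proof (rule tight_imp_radon_prob[OF metrizable_T])
  show s: "sets (fin_law I w u) = sets B" by (simp add: fin_law_def)
  show p: "prob_space (fin_law I w u)"
    unfolding fin_law_def using point_measure_measurable[of u I B] u
    by (intro prob_space.prob_space_distr prob_space_point_measure[OF w]) auto
  fix e :: real assume "0 < e"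
  have c: "compactin T (u ` I)" using w u by (intro finite_imp_compactin) (auto simp: weights_def)
  have "topspace T - u ` I \<in> sets B" using sets.compl_sets[OF borel_of_compact[OF metrizable_T c]] by simp
  then have "emeasure (fin_law I w u) (topspace T - u ` I) = 0"
    using w u by (subst emeasure_fin_law) (auto intro!: sum.neutral)
  then have "measure (fin_law I w u) (topspace T - u ` I) \<le> e" using \<open>0 < e\<close> by (simp add: measure_def)
  with c show "\<exists>K. compactin T K \<and> measure (fin_law I w u) (topspace T - K) \<le> e" by blast
qed

lemma nn_integral_fin_law:
  assumes w: "weights I w" and u: "u \<in> I \<rightarrow> pts X" and f: "f \<in> borel_measurable B" and pos: "\<And>x. 0 \<le> f x"
  shows "(\<integral>\<^sup>+ x. ennreal (f x) \<partial>fin_law I w u) = ennreal (\<Sum>i\<in>I. w i * f (u i))"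
proof -
  have fin: "finite I" and wpos: "\<And>i. i \<in> I \<Longrightarrow> 0 \<le> w i" using w by (auto simp: weights_def)
  have "(\<integral>\<^sup>+ x. ennreal (f x) \<partial>fin_law I w u) = (\<integral>\<^sup>+ i. ennreal (f (u i)) \<partial>point_measure I (\<lambda>i. ennreal (w i)))"
    unfolding fin_law_def using point_measure_measurable[of u I B] u f by (intro nn_integral_distr) auto
  also have "\<dots> = (\<Sum>i\<in>I. ennreal (w i) * ennreal (f (u i)))"
    using fin by (simp add: nn_integral_point_measure_finite)
  also have "\<dots> = (\<Sum>i\<in>I. ennreal (w i * f (u i)))"
    using pos wpos by (intro sum.cong) (auto simp: ennreal_mult)
  also have "\<dots> = ennreal (\<Sum>i\<in>I. w i * f (u i))"
    using pos wpos by (intro sum_ennreal) auto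
  finally show ?thesis .
qed

lemma fin_law_in_PX:
  assumes w: "weights I w" and u: "u \<in> I \<rightarrow> pts X"
  shows "fin_law I w u \<in> PX"
proof -
  have "I \<noteq> {}" using w by (auto simp: weights_def)
  then obtain a where a: "a \<in> pts X" using u by blast
  show ?thesis
    by (rule PX_I[OF fin_law_radon[OF w u] a]) (simp add: nn_integral_fin_law[OF w u dist_measurable[OF a]])
qed

lemma fin_law_coupling:
  assumes w: "weights I w" and u: "u \<in> I \<rightarrow> pts X" and v: "v \<in> I \<rightarrow> pts X"
  defines "R \<equiv> distr (point_measure I (\<lambda>i. ennreal (w i))) B2 (\<lambda>i. (u i, v i))"
  shows "radon_coupling T T (fin_law I w u) (fin_law I w v) R"
    and "cost R = ennreal (\<Sum>i\<in>I. w i * d (u i) (v i))"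
    and "Z \<in> sets B2 \<Longrightarrow> (\<And>i. i \<in> I \<Longrightarrow> (u i, v i) \<in> Z) \<Longrightarrow> AE z in R. z \<in> Z"
proof -
  let ?P = "point_measure I (\<lambda>i. ennreal (w i))"
  have uv: "(\<lambda>i. (u i, v i)) \<in> measurable ?P B2"
    using u v by (intro point_measure_measurable) auto
  show "radon_coupling T T (fin_law I w u) (fin_law I w v) R"
    unfolding radon_coupling_def R_def
    using metrizable_T fin_law_radon[OF w u] fin_law_radon[OF w v] uv
      measurable_fst_borel_of[of T T] measurable_snd_borel_of[of T T]
    by (auto simp: distr_distr comp_def fin_law_def intro: prob_space.prob_space_distr prob_space_point_measure[OF w])
  have fin: "finite I" and wpos: "\<And>i. i \<in> I \<Longrightarrow> 0 \<le> w i" using w by (auto simp: weights_def)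
  have "cost R = (\<integral>\<^sup>+ i. ennreal (d (u i) (v i)) \<partial>?P)"
    unfolding R_def using uv measurable_compose[OF d_measurable measurable_ennreal]
    by (subst nn_integral_distr) simp_all
  also have "\<dots> = (\<Sum>i\<in>I. ennreal (w i) * ennreal (d (u i) (v i)))"
    using fin by (simp add: nn_integral_point_measure_finite)
  also have "\<dots> = (\<Sum>i\<in>I. ennreal (w i * d (u i) (v i)))"
    using wpos by (intro sum.cong) (auto simp: ennreal_mult)
  also have "\<dots> = ennreal (\<Sum>i\<in>I. w i * d (u i) (v i))"
    using wpos by (intro sum_ennreal) auto
  finally show "cost R = ennreal (\<Sum>i\<in>I. w i * d (u i) (v i))" .
  show "AE z in R. z \<in> Z" if Z: "Z \<in> sets B2" and *: "\<And>i. i \<in> I \<Longrightarrow> (u i, v i) \<in> Z"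
  proof -
    have "{z \<in> space B2. z \<in> Z} \<in> sets B2"
      using Z sets.sets_into_space[OF Z] by (simp add: Collect_conj_eq Int_absorb1)
    then show ?thesis
      unfolding R_def by (subst AE_distr_iff[OF uv]) (use * in \<open>auto simp: space_point_measure\<close>)
  qed
qed

text \<open>A version of \<open>empirical\<close> for index sets of any type and for functions that
  need not be extensional, so that tuples can be reindexed freely.\<close>

definition emp :: "'i set \<Rightarrow> ('i \<Rightarrow> 'a) \<Rightarrow> 'a measure"
  where "emp N x = fin_law N (\<lambda>_. 1 / real (card N)) x"

lemma uniform_weights: "finite N \<Longrightarrow> N \<noteq> {} \<Longrightarrow> weights N (\<lambda>_. 1 / real (card N))"
  by (simp add: weights_def)

lemma emp_reindex:
  assumes N: "finite N" "N \<noteq> {}" and x: "x \<in> N \<rightarrow> pts X" and M: "finite M" "M \<noteq> {}" and h: "h \<in> M \<rightarrow> N"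
    and c: "\<And>n. n \<in> N \<Longrightarrow> card {m \<in> M. h m = n} * card N = card M"
  shows "emp M (\<lambda>m. x (h m)) = emp N x"
  unfolding emp_def
proof (rule fin_law_eqI)
  show "weights M (\<lambda>_. 1 / real (card M))" "weights N (\<lambda>_. 1 / real (card N))"
    using N M by (auto intro: uniform_weights)
  show "(\<lambda>m. x (h m)) \<in> M \<rightarrow> pts X" "x \<in> N \<rightarrow> pts X" using x h by auto
  fix A
  have "(\<Sum>m\<in>M. 1 / real (card M) * indicator A (x (h m)))
      = (\<Sum>n\<in>N. \<Sum>m\<in>{m \<in> M. h m = n}. 1 / real (card M) * indicator A (x (h m)))"
    using M(1) N(1) h by (intro sum.group[symmetric]) auto
  also have "\<dots> = (\<Sum>n\<in>N. real (card {m \<in> M. h m = n}) / real (card M) * indicator A (x n))"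
    by (intro sum.cong refl) simp
  also have "\<dots> = (\<Sum>n\<in>N. 1 / real (card N) * indicator A (x n))"
  proof (intro sum.cong refl)
    fix n assume n: "n \<in> N"
    have "real (card {m \<in> M. h m = n}) * real (card N) = real (card M)"
      using c[OF n] by (metis of_nat_mult)
    moreover have "card N \<noteq> 0" "card M \<noteq> 0" using N M by auto
    ultimately have "real (card {m \<in> M. h m = n}) / real (card M) = 1 / real (card N)"
      by (simp add: field_simps)
    then show "real (card {m \<in> M. h m = n}) / real (card M) * indicator A (x n) = 1 / real (card N) * indicator A (x n)"
      by simp
  qed
  finally show "(\<Sum>m\<in>M. 1 / real (card M) * indicator A (x (h m))) = (\<Sum>n\<in>N. 1 / real (card N) * (indicator A (x n) :: real))" .
qed

lemma emp_bij:
  assumes N: "finite N" "N \<noteq> {}" and x: "x \<in> N \<rightarrow> pts X" and h: "bij_betw h M N"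
  shows "emp M (\<lambda>m. x (h m)) = emp N x"
proof (rule emp_reindex[OF N x])
  show "finite M" "M \<noteq> {}" using h N by (auto simp: bij_betw_finite dest: bij_betw_empty1)
  show "h \<in> M \<rightarrow> N" using h by (rule bij_betw_imp_funcset)
  fix n assume "n \<in> N"
  then obtain m where m: "m \<in> M" "h m = n" using h by (auto simp: bij_betw_def)
  then have "{m' \<in> M. h m' = n} = {m}" using h by (auto simp: bij_betw_def inj_on_def)
  then show "card {m' \<in> M. h m' = n} * card N = card M" using bij_betw_same_card[OF h] by simp
qed

text \<open>The definition of \<open>empirical\<close> feeds a formula to \<open>measure_of\<close>,
  which returns the intended values only if the formula is a measure; \<open>emp N x\<close> is a
  measure with these values.\<close>

lemma empirical_eq_emp:
  assumes N: "finite N" "N \<noteq> {}" and x: "x \<in> N \<rightarrow>\<^sub>E pts X"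
  shows "empirical X N x = emp N x"
proof -
  have x': "x \<in> N \<rightarrow> pts X" using x by auto
  have e: "(\<Sum>n\<in>N. emeasure (return B (x n)) A) / of_nat (card N) = emeasure (emp N x) A" if A: "A \<in> sets B" for A
  proof -
    have "(\<Sum>n\<in>N. emeasure (return B (x n)) A) / of_nat (card N)
        = ennreal (\<Sum>n\<in>N. indicator A (x n)) / ennreal (real (card N))"
      using A by (simp add: ennreal_indicator[symmetric] ennreal_of_nat_eq_real_of_nat)
    also have "ennreal (\<Sum>n\<in>N. indicator A (x n)) / ennreal (real (card N))
        = ennreal ((\<Sum>n\<in>N. indicator A (x n)) / real (card N))"
      using N by (intro divide_ennreal) (auto simp: sum_nonneg card_gt_0_iff)
    also have "(\<Sum>n\<in>N. indicator A (x n)) / real (card N) = (\<Sum>n\<in>N. 1 / real (card N) * indicator A (x n))"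
      by (simp add: sum_divide_distrib)
    finally show ?thesis
      unfolding emp_def by (subst emeasure_fin_law[OF uniform_weights[OF N] x' A]) simp
  qed
  have "empirical X N x = measure_of (space B) (sets B) (\<lambda>A. (\<Sum>n\<in>N. emeasure (return B (x n)) A) / of_nat (card N))"
    using x by (simp add: empirical_def omet_power_def Let_def)
  also have "\<dots> = measure_of (space B) (sets B) (emeasure (emp N x))"
    by (rule measure_of_eq[OF sets.space_closed]) (rule e, simp only: sets.sigma_sets_eq)
  also have "\<dots> = emp N x"
    using measure_of_of_measure[of "emp N x"] by (simp add: emp_def fin_law_def)
  finally show ?thesis .
qed

lemma emp_in_PX: "finite N \<Longrightarrow> N \<noteq> {} \<Longrightarrow> x \<in> N \<rightarrow> pts X \<Longrightarrow> emp N x \<in> PX"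
  unfolding emp_def by (intro fin_law_in_PX uniform_weights)

lemma W_emp_le:
  assumes N: "finite N" "N \<noteq> {}" and x: "x \<in> N \<rightarrow> pts X" and y: "y \<in> N \<rightarrow> pts X"
  shows "W (emp N x) (emp N y) \<le> (\<Sum>n\<in>N. d (x n) (y n)) / real (card N)"
proof -
  have "ennreal (W (emp N x) (emp N y)) \<le> ennreal (\<Sum>n\<in>N. 1 / real (card N) * d (x n) (y n))"
    using W_le[OF emp_in_PX[OF N x] emp_in_PX[OF N y] fin_law_coupling(1)[OF uniform_weights[OF N] x y, folded emp_def]]
    unfolding fin_law_coupling(2)[OF uniform_weights[OF N] x y] .
  then show ?thesis
    by (subst (asm) ennreal_le_iff) (auto simp: sum_nonneg sum_divide_distrib)
qed

end

section \<open>Density of empirical measures\<close>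

context metric_omet
begin

text \<open>Every weight except the last is rounded down to a multiple of \<open>1 / N\<close>, and
  what is cut off is moved to the atom \<open>b m\<close>. From each atom at most
  \<open>1 / N\<close> is moved, at a total cost of at most \<open>S / N\<close>. Multiples of
  \<open>1 / N\<close> are then read as numbers of repetitions.\<close>

lemma fin_law_rational_approx:
  fixes m :: nat
  assumes w: "weights {..m} w" and b: "b \<in> {..m} \<rightarrow> pts X" and e: "0 < e"
  obtains I :: "(nat \<times> nat) set" where "finite I" "I \<noteq> {}" "fst ` I \<subseteq> {..m}"
    "W (fin_law {..m} w b) (emp I (\<lambda>z. b (fst z))) < e"
proof -
  define S where "S = (\<Sum>j<m. d (b j) (b m))"
  have S: "0 \<le> S" by (simp add: S_def sum_nonneg)
  obtain N0 :: nat where N0: "S / e < real N0" using reals_Archimedean2 by blast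
  define N where "N = Suc N0"
  have N: "0 < N" "S / real N < e"
    using N0 e S by (auto simp: N_def field_simps)
  have wpos: "0 \<le> w j" if "j \<le> m" for j using w that by (auto simp: weights_def)
  have wsum: "(\<Sum>j<m. w j) + w m = 1" using w by (simp add: weights_def lessThan_Suc_atMost[symmetric])
  \<comment> \<open>The last atom takes the remainder, so that the counts add up to exactly
    \<open>N\<close>.\<close>
  define n where "n j = (if j < m then nat \<lfloor>real N * w j\<rfloor> else N - (\<Sum>j<m. nat \<lfloor>real N * w j\<rfloor>))" for j
  have nle: "real (n j) \<le> real N * w j" if "j < m" for j
    using that wpos[of j] by (simp add: n_def)
  have nge: "real N * w j - 1 \<le> real (n j)" if "j < m" for j
    using that wpos[of j] by (simp add: n_def)
  have "(\<Sum>j<m. real (n j)) \<le> (\<Sum>j<m. real N * w j)" using nle by (intro sum_mono) auto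
  also have "\<dots> \<le> real N" using wsum wpos[of m] N(1) by (simp add: sum_distrib_left[symmetric])
  finally have le: "(\<Sum>j<m. n j) \<le> N" by (simp flip: of_nat_sum)
  have eqs: "(\<Sum>j<m. n j) = (\<Sum>j<m. nat \<lfloor>real N * w j\<rfloor>)"
    by (intro sum.cong) (auto simp: n_def)
  have "n m = N - (\<Sum>j<m. n j)" unfolding eqs by (simp add: n_def)
  then have nm: "real (n m) = real N - (\<Sum>j<m. real (n j))" using le by (simp add: of_nat_diff)
  have nsum: "(\<Sum>j\<le>m. n j) = N"
    using \<open>n m = N - (\<Sum>j<m. n j)\<close> le by (simp add: lessThan_Suc_atMost[symmetric])
  define I where "I = Sigma {..m} (\<lambda>j. {..<n j})"
  have I: "finite I" "card I = N" using nsum by (auto simp: I_def)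
  then have I0: "I \<noteq> {}" using N by auto
  define \<theta> where "\<theta> j = (if j < m then real (n j) / real N else w m)" for j
  \<comment> \<open>The label \<open>(j, True)\<close> carries the mass that stays at
    \<open>b j\<close>, and \<open>(j, False)\<close> the mass that moves from \<open>b j\<close> to
    \<open>b m\<close>. As \<open>\<theta> m = w m\<close>, the label \<open>(m, False)\<close>
    carries nothing.\<close>
  define K where "K = {..m} \<times> (UNIV :: bool set)"
  define \<pi> where "\<pi> z = (if snd z then \<theta> (fst z) else w (fst z) - \<theta> (fst z))" for z :: "nat \<times> bool"
  define v where "v z = (if snd z then b (fst z) else b m)" for z :: "nat \<times> bool"
  have sumK: "(\<Sum>z\<in>K. f z) = (\<Sum>j\<le>m. f (j, True) + f (j, False))" for f :: "nat \<times> bool \<Rightarrow> real"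
  proof -
    have "(\<Sum>z\<in>K. f z) = (\<Sum>j\<le>m. \<Sum>c\<in>UNIV. f (j, c))"
      unfolding K_def sum.cartesian_product by (intro sum.cong) auto
    then show ?thesis by (simp add: UNIV_bool add.commute)
  qed
  have \<theta>: "0 \<le> \<theta> j" "\<theta> j \<le> w j" if "j \<le> m" for j
    using that nle[of j] wpos[of j] N by (auto simp: \<theta>_def field_simps)
  have wK: "weights K \<pi>"
    unfolding weights_def
  proof (intro conjI ballI)
    show "finite K" by (simp add: K_def)
    show "0 \<le> \<pi> z" if "z \<in> K" for z using that \<theta> by (auto simp: K_def \<pi>_def)
    show "sum \<pi> K = 1" using w by (simp add: sumK \<pi>_def weights_def)
  qed
  have uv: "(\<lambda>z. b (fst z)) \<in> K \<rightarrow> pts X" "v \<in> K \<rightarrow> pts X"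
    using b by (auto simp: K_def v_def)
  have 1: "fin_law K \<pi> (\<lambda>z. b (fst z)) = fin_law {..m} w b"
    by (rule fin_law_eqI[OF wK uv(1) w b]) (simp add: sumK \<pi>_def ring_distribs)
  have bI: "(\<lambda>z. b (fst z)) \<in> I \<rightarrow> pts X" using b by (auto simp: I_def)
  have 2: "fin_law K \<pi> v = emp I (\<lambda>z. b (fst z))"
    unfolding emp_def
  proof (rule fin_law_eqI[OF wK uv(2) uniform_weights[OF I(1) I0] bI])
    fix A
    let ?i = "\<lambda>j. indicator A (b j) :: real"
    have "(\<Sum>z\<in>K. \<pi> z * indicator A (v z)) = (\<Sum>j\<le>m. \<theta> j * ?i j + (w j - \<theta> j) * ?i m)"
      by (simp add: sumK \<pi>_def v_def)
    also have "\<dots> = (\<Sum>j<m. \<theta> j * ?i j + (w j - \<theta> j) * ?i m) + w m * ?i m"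
      by (simp add: lessThan_Suc_atMost[symmetric] \<theta>_def)
    also have "\<dots> = (\<Sum>j<m. \<theta> j * ?i j) + ((\<Sum>j<m. w j) + w m - (\<Sum>j<m. \<theta> j)) * ?i m"
      by (simp add: sum.distrib sum_subtractf sum_distrib_right algebra_simps)
    also have "(\<Sum>j<m. w j) + w m - (\<Sum>j<m. \<theta> j) = real (n m) / real N"
      unfolding wsum nm using N by (simp add: \<theta>_def diff_divide_distrib sum_divide_distrib)
    also have "(\<Sum>j<m. \<theta> j * ?i j) + real (n m) / real N * ?i m = (\<Sum>j\<le>m. real (n j) / real N * ?i j)"
      by (simp add: lessThan_Suc_atMost[symmetric] \<theta>_def)
    also have "\<dots> = (\<Sum>j\<le>m. \<Sum>l<n j. 1 / real (card I) * ?i j)"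
      by (simp add: I)
    also have "\<dots> = (\<Sum>z\<in>I. 1 / real (card I) * indicator A (b (fst z)))"
      unfolding I_def by (subst sum.Sigma) (auto intro!: sum.cong)
    finally show "(\<Sum>z\<in>K. \<pi> z * indicator A (v z)) = (\<Sum>z\<in>I. 1 / real (card I) * indicator A (b (fst z)))" .
  qed
  note c = fin_law_coupling(1,2)[OF wK uv]
  have "ennreal (W (fin_law {..m} w b) (emp I (\<lambda>z. b (fst z)))) \<le> ennreal (\<Sum>z\<in>K. \<pi> z * d (b (fst z)) (v z))"
    using W_le[OF fin_law_in_PX[OF wK uv(1)] fin_law_in_PX[OF wK uv(2)] c(1)] unfolding c(2) 1 2 .
  then have "W (fin_law {..m} w b) (emp I (\<lambda>z. b (fst z))) \<le> (\<Sum>z\<in>K. \<pi> z * d (b (fst z)) (v z))"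
    using wK by (subst (asm) ennreal_le_iff) (auto simp: weights_def intro!: sum_nonneg)
  also have "\<dots> = (\<Sum>j<m. (w j - \<theta> j) * d (b j) (b m))"
    using b by (simp add: sumK \<pi>_def v_def lessThan_Suc_atMost[symmetric] Pi_iff)
  also have "\<dots> \<le> (\<Sum>j<m. 1 / real N * d (b j) (b m))"
  proof (intro sum_mono mult_right_mono)
    fix j assume "j \<in> {..<m}"
    then have "real N * w j - 1 \<le> real (n j)" "j < m" using nge by auto
    then have "w j \<le> (1 + real (n j)) / real N" using N(1) by (simp add: pos_le_divide_eq mult.commute)
    then show "w j - \<theta> j \<le> 1 / real N" using \<open>j < m\<close> by (simp add: \<theta>_def add_divide_distrib)
  qed simp
  also have "\<dots> = S / real N" by (simp add: S_def sum_divide_distrib)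
  also have "\<dots> < e" by (rule N)
  finally have "W (fin_law {..m} w b) (emp I (\<lambda>z. b (fst z))) < e" .
  then show ?thesis using I I0 by (intro that[of I]) (auto simp: I_def)
qed

text \<open>Tightness for the finite measure with density \<open>d a\<close>: continuity from above
  along compact sets that exhaust \<open>Z\<close> up to a null set. Keeping \<open>L\<close> inside
  \<open>Z\<close> is what later allows atoms to be placed on the graph of the order.\<close>

lemma compact_exhaustion_moment:
  assumes p: "p \<in> PX" and a: "a \<in> pts X" and Z: "Z \<in> sets B" "emeasure p (pts X - Z) = 0" and e: "0 < e"
  obtains L where "compactin T L" "L \<subseteq> Z" "(\<integral>\<^sup>+ x. ennreal (d a x) * indicator (pts X - L) x \<partial>p) < ennreal e"
proof -
  note P = PX_D[OF p]
  interpret prob_space p by (rule P)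
  have Zp: "Z \<in> sets p" by (simp add: P Z)
  have ex: "\<forall>n. \<exists>K. compactin T K \<and> K \<subseteq> Z \<and> K \<in> sets p \<and> measure p (Z - K) < inverse (Suc n)"
  proof
    fix n
    show "\<exists>K. compactin T K \<and> K \<subseteq> Z \<and> K \<in> sets p \<and> measure p (Z - K) < inverse (Suc n)"
      by (rule radon_prob_inner_diff[OF metrizable_T P(1) Zp, of "inverse (Suc n)"]) auto
  qed
  from choice[OF ex] obtain K where K: "\<And>n. compactin T (K n)" "\<And>n. K n \<subseteq> Z" "\<And>n. K n \<in> sets p"
    "\<And>n. measure p (Z - K n) < inverse (Suc n)" by blast
  define L where "L n = (\<Union>i\<le>n. K i)" for n :: nat
  have L: "compactin T (L n)" "L n \<in> sets p" for n
    unfolding L_def using K(1,3) by (auto intro!: compactin_Union)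
  have "measure p (Z - (\<Union>n. K n)) \<le> measure p (Z - K n)" for n
    using K(3) Zp by (intro finite_measure_mono) auto
  then have lt: "measure p (Z - (\<Union>n. K n)) < inverse (Suc n)" for n
    using K(4) by (rule order_le_less_trans)
  have "measure p (Z - (\<Union>n. K n)) \<le> \<epsilon>" if \<epsilon>: "\<epsilon> > 0" for \<epsilon>
  proof -
    obtain n where "inverse (real (Suc n)) < \<epsilon>" using reals_Archimedean[OF \<epsilon>] by auto
    with lt[of n] show ?thesis by simp
  qed
  then have "measure p (Z - (\<Union>n. K n)) = 0"
    using field_le_epsilon[of "measure p (Z - (\<Union>n. K n))" 0] measure_nonneg[of p] by (simp add: antisym)
  then have "Z - (\<Union>n. K n) \<in> null_sets p"
    using K(3) Zp by (auto simp: null_sets_def emeasure_eq_measure)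
  moreover have "pts X - Z \<in> null_sets p" using Z Zp sets.compl_sets[OF Zp] by (auto simp: null_sets_def P)
  ultimately have AE: "AE x in p. x \<in> (\<Union>n. K n)"
    using AE_space[of p] by (auto dest!: AE_not_in simp: P elim!: eventually_elim2)
  have da: "(\<lambda>x. ennreal (d a x)) \<in> borel_measurable p"
    using dist_measurable[OF a] by (simp cong: measurable_cong_sets add: P(4))
  let ?\<mu> = "density p (\<lambda>x. ennreal (d a x))"
  have pX: "pts X \<in> sets p" using sets.top[of p] by (simp add: P)
  have em: "emeasure ?\<mu> A = (\<integral>\<^sup>+ x. ennreal (d a x) * indicator A x \<partial>p)" if "A \<in> sets p" for A
    using da that by (rule emeasure_density)
  have fin: "(\<integral>\<^sup>+ x. ennreal (d a x) \<partial>p) < top"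
    using P(1,2) a by (simp add: finite_first_moment_iff)
  have "(\<lambda>n. emeasure ?\<mu> (pts X - L n)) \<longlonglongrightarrow> emeasure ?\<mu> (\<Inter>n. pts X - L n)"
  proof (rule Lim_emeasure_decseq)
    show "range (\<lambda>n. pts X - L n) \<subseteq> sets ?\<mu>" using L pX by auto
    show "decseq (\<lambda>n. pts X - L n)" unfolding L_def decseq_def by (meson Diff_mono UN_mono atMost_subset_iff order_refl)
    fix n
    have "emeasure ?\<mu> (pts X - L n) \<le> (\<integral>\<^sup>+ x. ennreal (d a x) \<partial>p)"
      using L pX by (subst em) (auto intro!: nn_integral_mono split: split_indicator)
    then show "emeasure ?\<mu> (pts X - L n) \<noteq> \<infinity>" using fin by (auto simp: top_unique)
  qed
  moreover have "emeasure ?\<mu> (\<Inter>n. pts X - L n) = 0"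
  proof -
    have s: "(\<Inter>n. pts X - L n) \<in> sets p" using L pX by auto
    have "AE x in p. ennreal (d a x) * indicator (\<Inter>n. pts X - L n) x = 0"
      using AE
    proof eventually_elim
      fix x assume "x \<in> (\<Union>n. K n)"
      then have "x \<notin> (\<Inter>n. pts X - L n)" unfolding L_def by blast
      then show "ennreal (d a x) * indicator (\<Inter>n. pts X - L n) x = 0" by simp
    qed
    then show ?thesis using da s by (subst em[OF s]) (simp add: nn_integral_0_iff_AE)
  qed
  ultimately have lim: "(\<lambda>n. emeasure ?\<mu> (pts X - L n)) \<longlonglongrightarrow> 0" by simp
  have "0 < ennreal e" using e by simp
  from order_tendstoD(2)[OF lim this] obtain n where "emeasure ?\<mu> (pts X - L n) < ennreal e"
    by (auto simp: eventually_sequentially)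
  then have "(\<integral>\<^sup>+ x. ennreal (d a x) * indicator (pts X - L n) x \<partial>p) < ennreal e"
    using L pX by (subst (asm) em) auto
  moreover have "L n \<subseteq> Z" using K(2) by (auto simp: L_def)
  ultimately show ?thesis using L(1)[of n] by (intro that)
qed

text \<open>A point of \<open>L\<close> is sent to the centre of the first ball of a finite net that
  contains it, at distance below \<open>e/4\<close>; all other points are sent to \<open>a\<close>,
  which costs the moment outside \<open>L\<close>. Both the net and \<open>a\<close> lie in
  \<open>Z\<close>, and with them the whole support of the approximation.\<close>

lemma fin_law_dense:
  assumes p: "p \<in> PX" and Z: "Z \<in> sets B" "emeasure p (pts X - Z) = 0" and e: "0 < e"
  obtains m :: nat and w b where "weights {..m} w" "b \<in> {..m} \<rightarrow> Z" "W p (fin_law {..m} w b) < e"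
proof -
  note P = PX_D[OF p]
  interpret prob_space p by (rule P)
  have "Z \<noteq> {}" using Z(2) emeasure_space_1 by (auto simp: P)
  then obtain a where aZ: "a \<in> Z" by auto
  have ZX: "Z \<subseteq> pts X" using sets.sets_into_space[OF Z(1)] by simp
  have a: "a \<in> pts X" using aZ ZX by auto
  have e4: "0 < e/4" using e by simp
  obtain L where L: "compactin T L" "L \<subseteq> Z"
    "(\<integral>\<^sup>+ x. ennreal (d a x) * indicator (pts X - L) x \<partial>p) < ennreal (e/4)"
    by (rule compact_exhaustion_moment[OF p a Z e4])
  have Ls: "L \<in> sets p" using borel_of_compact[OF metrizable_T L(1)] by (simp add: P)
  have "mtotally_bounded L" using L(1) by (simp add: T_def compactin_imp_mtotally_bounded)
  from this[unfolded mtotally_bounded_def, rule_format, OF e4]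
  obtain F where F: "finite F" "F \<subseteq> L" "L \<subseteq> (\<Union>x\<in>F. mball x (e/4))" by blast
  define m where "m = card F"
  obtain g where g: "bij_betw g {0..<m} F" using ex_bij_betw_nat_finite[OF F(1)] by (auto simp: m_def)
  have gF: "g k \<in> F" if "k < m" for k using g that by (auto simp: bij_betw_def)
  \<comment> \<open>The index \<open>m\<close> holds for every point, so a least index always
    exists; it is the least one exactly outside \<open>L\<close> and stands for the base
    point.\<close>
  define Q where "Q k x \<longleftrightarrow> (x \<in> L \<and> k < m \<and> x \<in> mball (g k) (e/4)) \<or> k = m" for k x
  define j where "j x = (LEAST k. Q k x)" for x
  have Qj: "Q (j x) x" for x unfolding j_def by (rule LeastI[of _ m]) (simp add: Q_def)
  have jm: "j x \<le> m" for x unfolding j_def by (rule Least_le) (simp add: Q_def)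
  have jL: "j x < m \<and> d (g (j x)) x < e/4" if "x \<in> L" for x
  proof -
    obtain f where "f \<in> F" "x \<in> mball f (e/4)" using F(3) \<open>x \<in> L\<close> by auto
    then obtain k where "k < m" "x \<in> mball (g k) (e/4)" using g by (auto simp: bij_betw_def)
    then have "Q k x" using \<open>x \<in> L\<close> by (simp add: Q_def)
    then have "j x \<le> k" unfolding j_def by (rule Least_le)
    with \<open>k < m\<close> have "j x < m" by simp
    with Qj[of x] show ?thesis by (auto simp: Q_def)
  qed
  have jnL: "j x = m" if "x \<notin> L" for x using Qj[of x] that by (auto simp: Q_def)
  have mb: "mball z c \<in> sets p" for z c using mball_sets by (simp add: P)
  have jmeas: "j \<in> measurable p (count_space UNIV)"
    unfolding j_def
  proof (rule measurable_Least)
    fix k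
    have "{x \<in> space p. Q k x} = (if k = m then space p else if k < m then L \<inter> mball (g k) (e/4) else {})"
      using sets.sets_into_space[OF Ls] by (auto simp: Q_def)
    then have "{x \<in> space p. Q k x} \<in> sets p" using Ls mb by auto
    then show "Measurable.pred p (Q k)" by (simp add: pred_def)
  qed
  define b where "b k = (if k < m then g k else a)" for k
  have bZ: "b k \<in> Z" for k using gF[of k] F(2) L(2) aZ by (auto simp: b_def)
  have bX: "b k \<in> pts X" for k using bZ ZX by auto
  define w where "w k = measure p {x \<in> space p. j x = k}" for k
  have js: "{x \<in> space p. j x = k} \<in> sets p" for k
    using measurable_sets[OF jmeas, of "{k}"] by (simp add: vimage_def Int_def conj_commute)
  have wA: "measure p {x \<in> space p. b (j x) \<in> A} = (\<Sum>k\<le>m. w k * indicator A (b k))" for A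
  proof -
    have "{x \<in> space p. b (j x) \<in> A} = (\<Union>k\<in>{k. k \<le> m \<and> b k \<in> A}. {x \<in> space p. j x = k})"
      using jm by auto
    then have "measure p {x \<in> space p. b (j x) \<in> A} = (\<Sum>k\<in>{k. k \<le> m \<and> b k \<in> A}. w k)"
      unfolding w_def using js
      by (simp add: finite_measure_finite_Union disjoint_family_on_def)
         (subst finite_measure_finite_Union, auto simp: disjoint_family_on_def)
    also have "\<dots> = (\<Sum>k\<le>m. w k * indicator A (b k))"
      by (intro sum.mono_neutral_cong_left) (auto simp: indicator_def)
    finally show ?thesis .
  qed
  have "(\<Sum>k\<le>m. w k) = 1" using wA[of UNIV] prob_space by simp
  then have ww: "weights {..m} w" by (simp add: weights_def w_def)
  have bm: "b \<in> {..m} \<rightarrow> pts X" using bX by auto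
  let ?\<phi> = "\<lambda>x. (x, b (j x))"
  have "(\<lambda>x. (x, c)) \<in> measurable p B2" if "c \<in> pts X" for c
  proof -
    have "continuous_map T (prod_topology T T) (\<lambda>x. (x, c))" using that by (simp add: continuous_map_paired)
    from continuous_map_measurable[OF this] show ?thesis by (simp add: P cong: measurable_cong_sets)
  qed
  then have \<phi>: "?\<phi> \<in> measurable p B2"
    using measurable_compose_countable[of "\<lambda>k x. (x, b k)" p B2 j] bX jmeas by simp
  let ?R = "distr p B2 ?\<phi>"
  have bj: "(\<lambda>x. b (j x)) \<in> measurable p B"
    using measurable_compose[OF \<phi> measurable_snd_borel_of] by simp
  have law: "distr p B (\<lambda>x. b (j x)) = fin_law {..m} w b"
  proof (rule measure_eqI)
    show "sets (distr p B (\<lambda>x. b (j x))) = sets (fin_law {..m} w b)" by (simp add: fin_law_def)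
    fix A assume "A \<in> sets (distr p B (\<lambda>x. b (j x)))"
    then have A: "A \<in> sets B" by simp
    have "emeasure (distr p B (\<lambda>x. b (j x))) A = emeasure p {x \<in> space p. b (j x) \<in> A}"
      using bj A by (simp add: emeasure_distr vimage_def Int_def conj_commute)
    also have "\<dots> = emeasure (fin_law {..m} w b) A"
      by (simp add: emeasure_fin_law[OF ww bm A] emeasure_eq_measure wA)
    finally show "emeasure (distr p B (\<lambda>x. b (j x))) A = emeasure (fin_law {..m} w b) A" .
  qed
  have id: "distr p B (\<lambda>x. x) = p" using P(4) by (intro distr_id2) simp
  have R: "radon_coupling T T p (fin_law {..m} w b) ?R"
    unfolding radon_coupling_def
    using metrizable_T P(1) fin_law_radon[OF ww bm] \<phi> measurable_fst_borel_of[of T T] measurable_snd_borel_of[of T T] law id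
    by (auto simp: distr_distr comp_def prob_space_distr)
  have da: "(\<lambda>x. ennreal (d a x) * indicator (pts X - L) x) \<in> borel_measurable p"
    using dist_measurable[OF a] Ls sets.top[of p]
    by (intro borel_measurable_times_ennreal borel_measurable_indicator)
       (auto cong: measurable_cong_sets simp: P(4,5))
  have "ennreal (W p (fin_law {..m} w b)) \<le> cost ?R"
    by (rule W_le[OF p fin_law_in_PX[OF ww bm] R])
  also have "\<dots> = (\<integral>\<^sup>+ x. ennreal (d x (b (j x))) \<partial>p)"
    using \<phi> measurable_compose[OF d_measurable measurable_ennreal]
    by (subst nn_integral_distr) simp_all
  also have "\<dots> \<le> (\<integral>\<^sup>+ x. ennreal (e/4) + ennreal (d a x) * indicator (pts X - L) x \<partial>p)"
  proof (rule nn_integral_mono)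
    fix x assume "x \<in> space p"
    then have x: "x \<in> pts X" by (simp add: P)
    show "ennreal (d x (b (j x))) \<le> ennreal (e/4) + ennreal (d a x) * indicator (pts X - L) x"
    proof (cases "x \<in> L")
      case True
      then have "d x (b (j x)) \<le> e/4" using jL[OF True] by (simp add: b_def commute)
      with True show ?thesis by (simp add: ennreal_leI)
    next
      case False
      then have "b (j x) = a" by (simp add: jnL b_def)
      then have "ennreal (d x (b (j x))) = ennreal (d a x) * indicator (pts X - L) x"
        using x False by (simp add: commute)
      then show ?thesis by simp
    qed
  qed
  also have "\<dots> = ennreal (e/4) + (\<integral>\<^sup>+ x. ennreal (d a x) * indicator (pts X - L) x \<partial>p)"
    using da by (subst nn_integral_add) (auto simp: emeasure_space_1)
  also have "\<dots> \<le> ennreal (e/4) + ennreal (e/4)" using L(3) by (intro add_left_mono) simp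
  also have "\<dots> = ennreal (e/2)" using e by (simp flip: ennreal_plus)
  finally have "W p (fin_law {..m} w b) \<le> e/2" using e by (subst (asm) ennreal_le_iff) auto
  then have "W p (fin_law {..m} w b) < e" using e by simp
  with ww bZ show ?thesis by (intro that[of m w b]) auto
qed

lemma emp_dense:
  fixes e :: real
  assumes p: "p \<in> PX" and Z: "Z \<in> sets B" "emeasure p (pts X - Z) = 0" and e: "0 < e"
  obtains N :: "'n::infinite set" and x where "finite N" "N \<noteq> {}" "x \<in> N \<rightarrow>\<^sub>E Z" "W p (emp N x) < e"
proof -
  interpret PW: Metric_space PX W by (rule Metric_space_W)
  have e2: "0 < e/2" using e by simp
  obtain m :: nat and w b where b: "weights {..m} w" "b \<in> {..m} \<rightarrow> Z" "W p (fin_law {..m} w b) < e/2"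
    by (rule fin_law_dense[OF p Z e2])
  have ZX: "Z \<subseteq> pts X" using sets.sets_into_space[OF Z(1)] by simp
  then have bX: "b \<in> {..m} \<rightarrow> pts X" using b(2) by auto
  obtain I :: "(nat \<times> nat) set" where I: "finite I" "I \<noteq> {}" "fst ` I \<subseteq> {..m}"
    "W (fin_law {..m} w b) (emp I (\<lambda>z. b (fst z))) < e/2"
    by (rule fin_law_rational_approx[OF b(1) bX e2])
  \<comment> \<open>The approximation was indexed by pairs of natural numbers. An infinite index
    type has a set of the same size to which it can be transported.\<close>
  obtain N :: "'n set" where N: "finite N" "card N = card I"
    using infinite_arbitrarily_large[OF infinite_UNIV, of "card I"] by blast
  then obtain h where h: "bij_betw h N I" using finite_same_card_bij[OF N(1) I(1)] by blast
  have hI: "fst (h n) \<in> {..m}" if "n \<in> N" for n using bij_betwE[OF h] that I(3) by blast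
  define x where "x = (\<lambda>n\<in>N. b (fst (h n)))"
  have bI: "(\<lambda>z. b (fst z)) \<in> I \<rightarrow> pts X" using bX I(3) by (auto simp: Pi_iff)
  have N0: "N \<noteq> {}" using N I by auto
  have x: "x \<in> N \<rightarrow>\<^sub>E Z" using hI b(2) by (auto simp: x_def)
  then have xX: "x \<in> N \<rightarrow> pts X" using ZX by auto
  have "emp N x = emp N (\<lambda>n. b (fst (h n)))"
    unfolding emp_def
    by (rule fin_law_eqI[OF uniform_weights[OF N(1) N0] xX uniform_weights[OF N(1) N0]])
       (use hI bX in \<open>auto simp: x_def Pi_iff intro!: sum.cong\<close>)
  also have "\<dots> = emp I (\<lambda>z. b (fst z))" by (rule emp_bij[OF I(1,2) bI h])
  finally have eq: "emp N x = emp I (\<lambda>z. b (fst z))" .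
  have "W p (emp N x) \<le> W p (fin_law {..m} w b) + W (fin_law {..m} w b) (emp N x)"
    using p fin_law_in_PX[OF b(1) bX] emp_in_PX[OF N(1) N0 xX] by (rule W_triangle)
  also have "\<dots> < e" using b(3) I(4) eq by simp
  finally show ?thesis using N N0 x by (intro that[of N x])
qed

end

section \<open>Matching empirical measures\<close>

text \<open>Induction on the total: as long as it is positive, some row and some column both have
  demand left, and a unit placed at their crossing lowers both demands.\<close>

lemma nat_matrix_with_margins:
  fixes R :: "'i \<Rightarrow> nat" and C :: "'j \<Rightarrow> nat"
  assumes N: "finite N" and M: "finite M" and eq: "sum R N = sum C M"
  obtains m where "\<And>i. i \<in> N \<Longrightarrow> (\<Sum>j\<in>M. m i j) = R i" "\<And>j. j \<in> M \<Longrightarrow> (\<Sum>i\<in>N. m i j) = C j"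
proof -
  have "\<exists>m. (\<forall>i\<in>N. (\<Sum>j\<in>M. m i j) = R i) \<and> (\<forall>j\<in>M. (\<Sum>i\<in>N. m i j) = C j)"
    using eq
  proof (induction "sum R N" arbitrary: R C)
    case 0
    then have "\<forall>i\<in>N. R i = 0" "\<forall>j\<in>M. C j = 0" using N M by auto
    then show ?case by (intro exI[of _ "\<lambda>_ _. 0"]) auto
  next
    case (Suc k)
    then have "sum R N \<noteq> 0" "sum C M \<noteq> 0" by auto
    then obtain a b where a: "a \<in> N" "R a \<noteq> 0" and b: "b \<in> M" "C b \<noteq> 0"
      by (metis sum.neutral)
    define R' where "R' = R(a := R a - 1)"
    define C' where "C' = C(b := C b - 1)"
    have R: "R i = R' i + (if i = a then 1 else 0)" for i using a by (simp add: R'_def)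
    have C: "C j = C' j + (if j = b then 1 else 0)" for j using b by (simp add: C'_def)
    have sR: "sum R N = sum R' N + 1" using N a by (simp add: R sum.distrib)
    have sC: "sum C M = sum C' M + 1" using M b by (simp add: C sum.distrib)
    have "k = sum R' N" "sum R' N = sum C' M" using sR sC Suc.hyps(2) Suc.prems by auto
    from Suc.hyps(1)[OF this] obtain m where m: "\<And>i. i \<in> N \<Longrightarrow> (\<Sum>j\<in>M. m i j) = R' i"
      "\<And>j. j \<in> M \<Longrightarrow> (\<Sum>i\<in>N. m i j) = C' j" by blast
    define m' where "m' i j = m i j + (if i = a \<and> j = b then 1 else 0)" for i j
    have "(\<Sum>j\<in>M. m' i j) = R i" if "i \<in> N" for i
      using m(1)[OF that] M b by (cases "i = a") (simp_all add: m'_def sum.distrib R)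
    moreover have "(\<Sum>i\<in>N. m' i j) = C j" if "j \<in> M" for j
      using m(2)[OF that] N a by (cases "j = b") (simp_all add: m'_def sum.distrib C)
    ultimately show ?case by blast
  qed
  then show ?thesis using that by blast
qed

text \<open>Rounding down the entries of a matrix and filling up the margins changes each entry by at
  most a margin deficit, that is by at most the number of entries in a row.\<close>

lemma integral_matrix_rounding:
  fixes v :: "'i \<Rightarrow> 'j \<Rightarrow> real" and r c :: nat
  assumes N: "finite N" and M: "finite M" and v: "\<And>i j. i \<in> N \<Longrightarrow> j \<in> M \<Longrightarrow> 0 \<le> v i j"
    and row: "\<And>i. i \<in> N \<Longrightarrow> (\<Sum>j\<in>M. v i j) = real r" and col: "\<And>j. j \<in> M \<Longrightarrow> (\<Sum>i\<in>N. v i j) = real c"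
  obtains m :: "'i \<Rightarrow> 'j \<Rightarrow> nat" where "\<And>i. i \<in> N \<Longrightarrow> (\<Sum>j\<in>M. m i j) = r" "\<And>j. j \<in> M \<Longrightarrow> (\<Sum>i\<in>N. m i j) = c"
    "\<And>i j. i \<in> N \<Longrightarrow> j \<in> M \<Longrightarrow> real (m i j) \<le> v i j + real (card M)"
proof -
  define f where "f i j = nat \<lfloor>v i j\<rfloor>" for i j
  have f: "real (f i j) \<le> v i j" "v i j \<le> real (f i j) + 1" if "i \<in> N" "j \<in> M" for i j
    using v[OF that] by (simp_all add: f_def)
  have "(\<Sum>j\<in>M. real (f i j)) \<le> real r" if "i \<in> N" for i
    unfolding row[OF that, symmetric] using f(1) that by (intro sum_mono)
  then have fr: "(\<Sum>j\<in>M. f i j) \<le> r" if "i \<in> N" for i using that by (simp flip: of_nat_sum)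
  have "(\<Sum>i\<in>N. real (f i j)) \<le> real c" if "j \<in> M" for j
    unfolding col[OF that, symmetric] using f(1) that by (intro sum_mono)
  then have fc: "(\<Sum>i\<in>N. f i j) \<le> c" if "j \<in> M" for j using that by (simp flip: of_nat_sum)
  define R where "R i = r - (\<Sum>j\<in>M. f i j)" for i
  define C where "C j = c - (\<Sum>i\<in>N. f i j)" for j
  have R: "R i + (\<Sum>j\<in>M. f i j) = r" if "i \<in> N" for i using fr[OF that] by (simp add: R_def)
  have C: "C j + (\<Sum>i\<in>N. f i j) = c" if "j \<in> M" for j using fc[OF that] by (simp add: C_def)
  have "real (card N * r) = (\<Sum>i\<in>N. \<Sum>j\<in>M. v i j)" by (simp add: row)
  also have "\<dots> = (\<Sum>j\<in>M. \<Sum>i\<in>N. v i j)" by (rule sum.swap)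
  also have "\<dots> = real (card M * c)" by (simp add: col)
  finally have tot: "card N * r = card M * c" by (simp only: of_nat_eq_iff)
  have "sum R N + (\<Sum>i\<in>N. \<Sum>j\<in>M. f i j) = card N * r"
    unfolding sum.distrib[symmetric] by (simp add: R)
  moreover have "sum C M + (\<Sum>j\<in>M. \<Sum>i\<in>N. f i j) = card M * c"
    unfolding sum.distrib[symmetric] by (simp add: C)
  ultimately have "sum R N = sum C M" using tot sum.swap[of f M N] by simp
  from nat_matrix_with_margins[OF N M this]
  obtain e where e: "\<And>i. i \<in> N \<Longrightarrow> (\<Sum>j\<in>M. e i j) = R i" "\<And>j. j \<in> M \<Longrightarrow> (\<Sum>i\<in>N. e i j) = C j"
    by blast
  show ?thesis
  proof (rule that[of "\<lambda>i j. f i j + e i j"])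
    show "(\<Sum>j\<in>M. f i j + e i j) = r" if "i \<in> N" for i
      using R[OF that] e(1)[OF that] by (simp add: sum.distrib)
    show "(\<Sum>i\<in>N. f i j + e i j) = c" if "j \<in> M" for j
      using C[OF that] e(2)[OF that] by (simp add: sum.distrib)
    fix i j assume ij: "i \<in> N" "j \<in> M"
    have "e i j \<le> R i" unfolding e(1)[OF ij(1), symmetric] using M ij(2) by (intro member_le_sum) auto
    moreover have "real (R i) \<le> real (card M)"
    proof -
      have "real (R i) = (\<Sum>j\<in>M. v i j) - (\<Sum>j\<in>M. real (f i j))"
        using arg_cong[OF R[OF ij(1)], of real] row[OF ij(1)] by simp
      also have "\<dots> = (\<Sum>j\<in>M. v i j - real (f i j))" by (simp add: sum_subtractf)
      also have "\<dots> \<le> (\<Sum>j\<in>M. 1)" using f(2) ij(1) by (intro sum_mono) (simp add: algebra_simps)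
      finally show ?thesis by simp
    qed
    ultimately have "real (e i j) \<le> real (card M)" by simp
    then show "real (f i j + e i j) \<le> v i j + real (card M)" using f(1)[OF ij] by simp
  qed
qed

text \<open>Tuples may repeat points. Dividing by the number of repetitions spreads the contribution
  of a point evenly over the indices that carry it.\<close>

lemma sum_over_fibers:
  fixes f :: "'b \<Rightarrow> real"
  assumes "finite M"
  shows "(\<Sum>j\<in>M. f (y j) / real (card {j' \<in> M. y j' = y j})) = (\<Sum>b\<in>y ` M. f b)"
proof -
  have "(\<Sum>j\<in>M. f (y j) / real (card {j' \<in> M. y j' = y j}))
      = (\<Sum>b\<in>y ` M. \<Sum>j\<in>{j \<in> M. y j = b}. f (y j) / real (card {j' \<in> M. y j' = y j}))"
    using assms by (rule sum.image_gen)
  also have "\<dots> = (\<Sum>b\<in>y ` M. f b)"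
  proof (rule sum.cong[OF refl])
    fix b assume "b \<in> y ` M"
    then have "card {j \<in> M. y j = b} \<noteq> 0" using assms by auto
    moreover have "(\<Sum>j\<in>{j \<in> M. y j = b}. f (y j) / real (card {j' \<in> M. y j' = y j}))
        = (\<Sum>j\<in>{j \<in> M. y j = b}. f b / real (card {j' \<in> M. y j' = b}))"
      by (rule sum.cong) auto
    ultimately show "(\<Sum>j\<in>{j \<in> M. y j = b}. f (y j) / real (card {j' \<in> M. y j' = y j})) = f b" by simp
  qed
  finally show ?thesis .
qed

section \<open>From couplings of empirical measures to matchings of tuples\<close>

context metric_omet
begin

lemma measure_emp_singleton:
  assumes N: "finite N" "N \<noteq> {}" and x: "x \<in> N \<rightarrow> pts X" and a: "a \<in> pts X"
  shows "measure (emp N x) {a} = real (card {i \<in> N. x i = a}) / real (card N)"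
proof -
  have "emeasure (emp N x) {a} = ennreal (\<Sum>i\<in>N. 1 / real (card N) * indicator {a} (x i))"
    unfolding emp_def using a by (intro emeasure_fin_law uniform_weights N x borel_of_singleton metrizable_T) simp
  also have "(\<Sum>i\<in>N. 1 / real (card N) * indicator {a} (x i)) = (\<Sum>i\<in>{i \<in> N. x i = a}. 1 / real (card N))"
    using N by (intro sum.mono_neutral_cong_right) (auto simp: indicator_def)
  finally show ?thesis by (simp add: measure_def)
qed

text \<open>The mass of a pair of atoms is shared evenly among all index pairs that carry it.
  Summing over \<open>j\<close> undoes the sharing in the second coordinate and leaves an equal part
  of the mass of the atom \<open>x i\<close> for each index carrying it. Column sums follow by
  swapping.\<close>

lemma emp_coupling_row:
  assumes N: "finite N" "N \<noteq> {}" and x: "x \<in> N \<rightarrow> pts X" and M: "finite M" "M \<noteq> {}" and y: "y \<in> M \<rightarrow> pts X"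
    and r: "radon_coupling T T (emp N x) (emp M y) r" and i: "i \<in> N"
  shows "(\<Sum>j\<in>M. measure r ({x i} \<times> {y j}) / real (card {i' \<in> N. x i' = x i}) / real (card {j' \<in> M. y j' = y j}))
    = 1 / real (card N)"
proof -
  note D = radon_couplingD[OF r]
  interpret prob_space r by (rule D)
  let ?c = "real (card {i' \<in> N. x i' = x i})"
  have xi: "x i \<in> pts X" using x i by auto
  have c0: "?c \<noteq> 0" using N i by auto
  have sing: "{x i} \<in> sets B" using xi by (intro borel_of_singleton metrizable_T) simp
  have yM: "compactin T (y ` M)" using y M by (intro finite_imp_compactin) auto
  have yMs: "y ` M \<in> sets B" using borel_of_compact[OF metrizable_T yM] .
  have "(\<Sum>j\<in>M. measure r ({x i} \<times> {y j}) / ?c / real (card {j' \<in> M. y j' = y j}))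
      = (\<Sum>b\<in>y ` M. measure r ({x i} \<times> {b}) / ?c)"
    using sum_over_fibers[OF M(1), of "\<lambda>b. measure r ({x i} \<times> {b}) / ?c" y] .
  also have "\<dots> = (\<Sum>b\<in>y ` M. measure r ({x i} \<times> {b})) / ?c" by (simp add: sum_divide_distrib)
  also have "(\<Sum>b\<in>y ` M. measure r ({x i} \<times> {b})) = measure r (\<Union>b\<in>y ` M. {x i} \<times> {b})"
  proof (rule finite_measure_finite_Union[symmetric])
    show "finite (y ` M)" using M by simp
    have "{x i} \<times> {b} \<in> sets r" if "b \<in> y ` M" for b
      using that y Times_in_borel_of_prod[OF sing borel_of_singleton[OF metrizable_T, of b]]
      by (auto simp: D(5) Pi_iff)
    then show "(\<lambda>b. {x i} \<times> {b}) ` y ` M \<subseteq> sets r" by auto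
  qed (auto simp: disjoint_family_on_def)
  also have "\<dots> = measure r ({x i} \<times> topspace T)"
  proof (rule finite_measure_eq_AE)
    have c: "topspace T - y ` M \<in> sets B" using sets.compl_sets[OF yMs] by simp
    have "emeasure r (topspace T \<times> (topspace T - y ` M)) = emeasure (emp M y) (topspace T - y ` M)"
      by (rule radon_coupling_emeasure_snd[OF r c])
    also have "\<dots> = 0"
      unfolding emp_def by (subst emeasure_fin_law[OF uniform_weights[OF M] y c]) (auto intro!: sum.neutral)
    finally have "topspace T \<times> (topspace T - y ` M) \<in> null_sets r"
      using radon_coupling_emeasure_snd(2)[OF r c] by (simp add: null_sets_def)
    then have "AE z in r. z \<notin> topspace T \<times> (topspace T - y ` M)" by (rule AE_not_in)
    then show "AE z in r. z \<in> (\<Union>b\<in>y ` M. {x i} \<times> {b}) \<longleftrightarrow> z \<in> {x i} \<times> topspace T"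
      using AE_space
    proof eventually_elim
      case (elim z)
      obtain a b where z: "z = (a, b)" by (cases z)
      have "y ` M \<subseteq> topspace T" using y by auto
      with elim show ?case by (auto simp: z D(9))
    qed
    have "(\<Union>b\<in>y ` M. {x i} \<times> {b}) = {x i} \<times> y ` M" by auto
    then show "(\<Union>b\<in>y ` M. {x i} \<times> {b}) \<in> sets r"
      using Times_in_borel_of_prod[OF sing yMs] by (simp add: D(5))
    show "{x i} \<times> topspace T \<in> sets r" by (rule radon_coupling_emeasure_fst[OF r sing])
  qed
  also have "\<dots> = measure (emp N x) {x i}"
    using radon_coupling_emeasure_fst(1)[OF r sing] by (simp add: measure_def)
  also have "\<dots> = ?c / real (card N)" by (rule measure_emp_singleton[OF N x xi])
  finally show ?thesis using c0 by simp
qed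

lemma sum_le_cost:
  assumes r: "radon_coupling T T p q r" and S: "finite S" "S \<subseteq> pts X \<times> pts X"
  shows "ennreal (\<Sum>z\<in>S. measure r {z} * d (fst z) (snd z)) \<le> cost r"
proof -
  note D = radon_couplingD[OF r]
  interpret prob_space r by (rule D)
  have s: "{z} \<in> sets r" if "z \<in> S" for z
    using that S(2) borel_of_singleton[OF metrizable_T2, of z] by (auto simp: D(5))
  have "ennreal (\<Sum>z\<in>S. measure r {z} * d (fst z) (snd z)) = (\<Sum>z\<in>S. ennreal (d (fst z) (snd z)) * emeasure r {z})"
    by (subst sum_ennreal[symmetric]) (auto simp: emeasure_eq_measure ennreal_mult mult.commute)
  also have "\<dots> = (\<integral>\<^sup>+ z. ennreal (d (fst z) (snd z)) * indicator S z \<partial>r)"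
    using S(1) s by (rule nn_integral_indicator_finite[symmetric])
  also have "\<dots> \<le> cost r" by (intro nn_integral_mono) (auto split: split_indicator)
  finally show ?thesis .
qed

text \<open>The coupling is turned into a matrix \<open>v\<close> on \<open>N \<times> M\<close>, a
  large multiple of \<open>v\<close> is rounded to integers, and these count how often a pair of
  indices is repeated. Constant row and column sums mean constant fibres, so that the two
  projections are morphisms of FinUnif.\<close>

lemma emp_coupling_matching:
  fixes N M :: "'n::infinite set"
  assumes N: "finite N" "N \<noteq> {}" and x: "x \<in> N \<rightarrow> pts X" and M: "finite M" "M \<noteq> {}" and y: "y \<in> M \<rightarrow> pts X"
    and r: "radon_coupling T T (emp N x) (emp M y) r" and e: "0 < e"
  obtains K :: "'n set" and \<phi> \<psi> where "K \<in> finunif_obj" "\<phi> \<in> finunif_hom K N" "\<psi> \<in> finunif_hom K M"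
    "ennreal ((\<Sum>k\<in>K. d (x (\<phi> k)) (y (\<psi> k))) / real (card K)) \<le> cost r + ennreal e"
proof -
  note D = radon_couplingD[OF r]
  define cx where "cx i = real (card {i' \<in> N. x i' = x i})" for i
  define cy where "cy j = real (card {j' \<in> M. y j' = y j})" for j
  define v where "v i j = measure r ({x i} \<times> {y j}) / cx i / cy j" for i j
  have v0: "0 \<le> v i j" for i j by (simp add: v_def cx_def cy_def)
  have row: "(\<Sum>j\<in>M. v i j) = 1 / real (card N)" if "i \<in> N" for i
    unfolding v_def cx_def cy_def by (rule emp_coupling_row[OF N x M y r that])
  have col: "(\<Sum>i\<in>N. v i j) = 1 / real (card M)" if j: "j \<in> M" for j
  proof -
    let ?s = "distr r B2 prod.swap"
    have "measure ?s ({y j} \<times> {x i}) = measure r ({x i} \<times> {y j})" if "i \<in> N" for i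
    proof -
      have "{x i} \<in> sets B" "{y j} \<in> sets B"
        using x y j that by (auto intro!: borel_of_singleton metrizable_T)
      from radon_coupling_swap_Times[OF r this] show ?thesis by (simp add: measure_def)
    qed
    then have "(\<Sum>i\<in>N. v i j) = (\<Sum>i\<in>N. measure ?s ({y j} \<times> {x i}) / cy j / cx i)"
      by (intro sum.cong) (simp_all add: v_def)
    also have "\<dots> = 1 / real (card M)"
      unfolding cx_def cy_def by (rule emp_coupling_row[OF M y N x radon_coupling_swap[OF r] j])
    finally show ?thesis .
  qed
  define S where "S = (\<Sum>i\<in>N. \<Sum>j\<in>M. d (x i) (y j))"
  have S0: "0 \<le> S" by (simp add: S_def sum_nonneg)
  obtain L0 :: nat where L0: "S / e < real L0" using reals_Archimedean2 by blast
  define L where "L = Suc L0"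
  have L: "0 < L" "S / real L < e" using L0 e S0 by (auto simp: L_def field_simps)
  \<comment> \<open>Scaled by \<open>k\<close>, the rows of \<open>v\<close> sum to
    \<open>card M * L\<close> and the columns to \<open>card N * L\<close>, both integers. Rounding
    changes an entry by at most \<open>card M\<close>, so after division by \<open>k\<close> the
    error is at most \<open>S / (card N * L)\<close>, which \<open>L\<close> makes smaller than
    \<open>e\<close>.\<close>
  define k where "k = card N * card M * L"
  have k0: "0 < k" using N M L by (simp add: k_def card_gt_0_iff)
  have N0: "real (card N) > 0" "real (card M) > 0" using N M by (auto simp: card_gt_0_iff)
  have r1: "(\<Sum>j\<in>M. real k * v i j) = real (card M * L)" if "i \<in> N" for i
    using row[OF that] N0 by (simp add: sum_distrib_left[symmetric] k_def)
  have c1: "(\<Sum>i\<in>N. real k * v i j) = real (card N * L)" if "j \<in> M" for j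
    using col[OF that] N0 by (simp add: sum_distrib_left[symmetric] k_def)
  obtain m where m: "\<And>i. i \<in> N \<Longrightarrow> (\<Sum>j\<in>M. m i j) = card M * L" "\<And>j. j \<in> M \<Longrightarrow> (\<Sum>i\<in>N. m i j) = card N * L"
    "\<And>i j. i \<in> N \<Longrightarrow> j \<in> M \<Longrightarrow> real (m i j) \<le> real k * v i j + real (card M)"
    using integral_matrix_rounding[OF N(1) M(1), of "\<lambda>i j. real k * v i j" "card M * L" "card N * L"] r1 c1 v0
    by (metis mult_nonneg_nonneg of_nat_0_le_iff)
  \<comment> \<open>The triple \<open>(i, j, l)\<close> is the copy number \<open>l\<close> of the
    matched pair \<open>(i, j)\<close>. Afterwards this set is transported to the index type
    \<open>'n\<close>.\<close>
  define Q where "Q = Sigma N (\<lambda>i. Sigma M (\<lambda>j. {..<m i j}))"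
  have Q: "finite Q" using N M by (auto simp: Q_def)
  have cQ: "card Q = k" using N M m(1) by (simp add: Q_def card_SigmaI k_def)
  have fib1: "card {q \<in> Q. fst q = i} = card M * L" if "i \<in> N" for i
  proof -
    have "{q \<in> Q. fst q = i} = Pair i ` Sigma M (\<lambda>j. {..<m i j})" using that by (auto simp: Q_def)
    then have "card {q \<in> Q. fst q = i} = card (Sigma M (\<lambda>j. {..<m i j}))"
      by (simp add: card_image inj_on_def)
    then show ?thesis using M m(1)[OF that] by (simp add: card_SigmaI)
  qed
  have fib2: "card {q \<in> Q. fst (snd q) = j} = card N * L" if "j \<in> M" for j
  proof -
    have "{q \<in> Q. fst (snd q) = j} = (\<lambda>(i, l). (i, j, l)) ` Sigma N (\<lambda>i. {..<m i j})"
      using that by (auto simp: Q_def image_iff)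
    then have "card {q \<in> Q. fst (snd q) = j} = card (Sigma N (\<lambda>i. {..<m i j}))"
      by (simp add: card_image inj_on_def split_beta prod_eq_iff)
    then show ?thesis using N m(2)[OF that] by (simp add: card_SigmaI)
  qed
  obtain K :: "'n set" where K: "finite K" "card K = card Q"
    using infinite_arbitrarily_large[OF infinite_UNIV, of "card Q"] by blast
  then obtain h where h: "bij_betw h K Q" using finite_same_card_bij[OF K(1) Q] by blast
  have hQ: "h l \<in> Q" if "l \<in> K" for l using bij_betwE[OF h] that by blast
  define \<phi> where "\<phi> = (\<lambda>l\<in>K. fst (h l))"
  define \<psi> where "\<psi> = (\<lambda>l\<in>K. fst (snd (h l)))"
  have fibh: "card {l \<in> K. P (h l)} = card {q \<in> Q. P q}" for P
  proof -
    have "{q \<in> Q. P q} = h ` {l \<in> K. P (h l)}" using h by (auto simp: bij_betw_def)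
    moreover have "inj_on h {l \<in> K. P (h l)}" using h by (auto simp: bij_betw_def inj_on_def)
    ultimately show ?thesis by (simp add: card_image)
  qed
  have f1: "card {l \<in> K. \<phi> l = i} = card M * L" if "i \<in> N" for i
  proof -
    have "{l \<in> K. \<phi> l = i} = {l \<in> K. fst (h l) = i}" by (auto simp: \<phi>_def)
    then show ?thesis using fibh[of "\<lambda>q. fst q = i"] fib1[OF that] by simp
  qed
  have f2: "card {l \<in> K. \<psi> l = j} = card N * L" if "j \<in> M" for j
  proof -
    have "{l \<in> K. \<psi> l = j} = {l \<in> K. fst (snd (h l)) = j}" by (auto simp: \<psi>_def)
    then show ?thesis using fibh[of "\<lambda>q. fst (snd q) = j"] fib2[OF that] by simp
  qed
  have "\<phi> \<in> K \<rightarrow>\<^sub>E N" "\<psi> \<in> K \<rightarrow>\<^sub>E M"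
    using hQ by (force simp: \<phi>_def \<psi>_def Q_def)+
  then have hom: "\<phi> \<in> finunif_hom K N" "\<psi> \<in> finunif_hom K M"
    using f1 f2 by (auto simp: finunif_hom_def)
  have Kobj: "K \<in> finunif_obj" using K cQ k0 by (auto simp: finunif_obj_def)
  have "(\<Sum>l\<in>K. d (x (\<phi> l)) (y (\<psi> l))) = (\<Sum>l\<in>K. d (x (fst (h l))) (y (fst (snd (h l)))))"
    by (intro sum.cong) (auto simp: \<phi>_def \<psi>_def)
  also have "\<dots> = (\<Sum>q\<in>Q. d (x (fst q)) (y (fst (snd q))))"
    by (rule sum.reindex_bij_betw[OF h])
  also have "\<dots> = (\<Sum>i\<in>N. \<Sum>q\<in>Sigma M (\<lambda>j. {..<m i j}). d (x i) (y (fst q)))"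
    unfolding Q_def using N M by (subst sum.Sigma) (auto intro!: sum.cong)
  also have "\<dots> = (\<Sum>i\<in>N. \<Sum>j\<in>M. \<Sum>l<m i j. d (x i) (y j))"
    using M by (intro sum.cong refl, subst sum.Sigma) (auto intro!: sum.cong)
  also have "\<dots> = (\<Sum>i\<in>N. \<Sum>j\<in>M. real (m i j) * d (x i) (y j))" by simp
  also have "\<dots> \<le> (\<Sum>i\<in>N. \<Sum>j\<in>M. (real k * v i j + real (card M)) * d (x i) (y j))"
    using m(3) by (intro sum_mono mult_right_mono) auto
  also have "\<dots> = real k * (\<Sum>i\<in>N. \<Sum>j\<in>M. v i j * d (x i) (y j)) + real (card M) * S"
    by (simp add: S_def sum.distrib sum_distrib_left ring_distribs mult.assoc)
  finally have sum_le: "(\<Sum>l\<in>K. d (x (\<phi> l)) (y (\<psi> l)))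
      \<le> real k * (\<Sum>i\<in>N. \<Sum>j\<in>M. v i j * d (x i) (y j)) + real (card M) * S" .
  let ?V = "\<Sum>i\<in>N. \<Sum>j\<in>M. v i j * d (x i) (y j)"
  have "(\<Sum>l\<in>K. d (x (\<phi> l)) (y (\<psi> l))) / real (card K) \<le> (real k * ?V + real (card M) * S) / real k"
    using sum_le by (simp add: K cQ divide_right_mono)
  also have "\<dots> = ?V + S / (real (card N) * real L)"
    using k0 N0 L(1) by (simp add: add_divide_distrib k_def)
  also have "S / (real (card N) * real L) \<le> S / real L"
  proof (rule divide_left_mono)
    have "1 \<le> real (card N)" using N by (simp add: Suc_leI card_gt_0_iff)
    then show "real L \<le> real (card N) * real L" using mult_right_mono[of 1 "real (card N)" "real L"] by simp
  qed (use S0 N0 L in auto)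
  also have "?V + S / real L \<le> ?V + e" using L(2) by simp
  finally have le: "(\<Sum>l\<in>K. d (x (\<phi> l)) (y (\<psi> l))) / real (card K) \<le> ?V + e" by simp
  have "?V = (\<Sum>i\<in>N. (\<Sum>j\<in>M. (measure r ({x i} \<times> {y j}) * d (x i) (y j) / cx i) / cy j))"
    by (simp add: v_def mult.commute)
  also have "\<dots> = (\<Sum>i\<in>N. (\<Sum>b\<in>y ` M. measure r ({x i} \<times> {b}) * d (x i) b / cx i))"
    unfolding cy_def using sum_over_fibers[OF M(1), of "\<lambda>b. measure r ({x _} \<times> {b}) * d (x _) b / cx _" y] by simp
  also have "\<dots> = (\<Sum>i\<in>N. (\<Sum>b\<in>y ` M. measure r ({x i} \<times> {b}) * d (x i) b) / cx i)"
    by (simp add: sum_divide_distrib)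
  also have "\<dots> = (\<Sum>a\<in>x ` N. \<Sum>b\<in>y ` M. measure r ({a} \<times> {b}) * d a b)"
    unfolding cx_def using sum_over_fibers[OF N(1), of "\<lambda>a. \<Sum>b\<in>y ` M. measure r ({a} \<times> {b}) * d a b" x] .
  also have "\<dots> = (\<Sum>z\<in>x ` N \<times> y ` M. measure r {z} * d (fst z) (snd z))"
    unfolding sum.cartesian_product by (intro sum.cong) auto
  finally have V: "?V = (\<Sum>z\<in>x ` N \<times> y ` M. measure r {z} * d (fst z) (snd z))" .
  have "ennreal ((\<Sum>l\<in>K. d (x (\<phi> l)) (y (\<psi> l))) / real (card K)) \<le> ennreal (?V + e)"
    using le by (rule ennreal_leI)
  also have "\<dots> = ennreal ?V + ennreal e"
    using e v0 by (intro ennreal_plus) (auto intro!: sum_nonneg)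
  also have "\<dots> \<le> cost r + ennreal e"
    unfolding V using x y N M by (intro add_right_mono sum_le_cost[OF r]) auto
  finally show ?thesis by (rule that[OF Kobj hom])
qed

lemma emp_matching:
  fixes N M :: "'n::infinite set"
  assumes N: "finite N" "N \<noteq> {}" and x: "x \<in> N \<rightarrow> pts X" and M: "finite M" "M \<noteq> {}" and y: "y \<in> M \<rightarrow> pts X"
    and c: "W (emp N x) (emp M y) < c"
  obtains K :: "'n set" and \<phi> \<psi> where "K \<in> finunif_obj" "\<phi> \<in> finunif_hom K N" "\<psi> \<in> finunif_hom K M"
    "(\<Sum>k\<in>K. d (x (\<phi> k)) (y (\<psi> k))) / real (card K) \<le> c"
proof -
  \<comment> \<open>The midpoint leaves one half of the gap for choosing a coupling and the other
    half for the rounding.\<close>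
  define c' where "c' = (W (emp N x) (emp M y) + c) / 2"
  have c': "W (emp N x) (emp M y) < c'" "c' < c" "0 \<le> c'"
    using c order_le_less_trans[OF W_nonneg c] by (simp_all add: c'_def add_nonneg_nonneg less_imp_le)
  obtain r where r: "radon_coupling T T (emp N x) (emp M y) r" "cost r < ennreal c'"
    by (rule W_approx[OF emp_in_PX[OF N x] emp_in_PX[OF M y] c'(1)])
  have "0 < c - c'" using c' by simp
  then obtain K :: "'n set" and \<phi> \<psi> where K: "K \<in> finunif_obj" "\<phi> \<in> finunif_hom K N" "\<psi> \<in> finunif_hom K M"
    "ennreal ((\<Sum>k\<in>K. d (x (\<phi> k)) (y (\<psi> k))) / real (card K)) \<le> cost r + ennreal (c - c')"
    by (rule emp_coupling_matching[OF N x M y r(1)])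
  note K(4)
  also have "cost r + ennreal (c - c') \<le> ennreal c' + ennreal (c - c')" using r(2) by (intro add_right_mono) simp
  also have "\<dots> = ennreal c" using c' by (simp flip: ennreal_plus)
  finally have "(\<Sum>k\<in>K. d (x (\<phi> k)) (y (\<psi> k))) / real (card K) \<le> c"
    using c' by (subst (asm) ennreal_le_iff) auto
  with K(1-3) show ?thesis by (rule that)
qed

end

section \<open>Completeness of the Wasserstein space\<close>

lemma finunif_homD:
  assumes "h \<in> finunif_hom M N"
  shows "h \<in> M \<rightarrow>\<^sub>E N"
    and "\<And>n n'. n \<in> N \<Longrightarrow> n' \<in> N \<Longrightarrow> card {m \<in> M. h m = n} = card {m \<in> M. h m = n'}"
  using assms unfolding finunif_hom_def by blast+

lemma finunif_hom_card_fiber: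
  assumes h: "h \<in> finunif_hom M N" and N: "finite N" and M: "finite M" and n: "n \<in> N"
  shows "card {m \<in> M. h m = n} * card N = card M"
proof -
  note hMN = finunif_homD(1)[OF h]
  have eq: "card {m \<in> M. h m = n'} = card {m \<in> M. h m = n}" if "n' \<in> N" for n'
    by (rule finunif_homD(2)[OF h that n])
  have h': "h ` M \<subseteq> N" using hMN by auto
  have "card M = (\<Sum>m\<in>M. 1)" by simp
  also have "\<dots> = (\<Sum>n'\<in>N. \<Sum>m\<in>{m \<in> M. h m = n'}. 1)"
    by (rule sum.group[symmetric]) (use M N h' in auto)
  also have "\<dots> = (\<Sum>n'\<in>N. card {m \<in> M. h m = n})"
    using eq by (intro sum.cong) auto
  finally show ?thesis by (simp add: mult.commute)
qed

lemma (in metric_omet) emp_hom: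
  assumes "h \<in> finunif_hom M N" "finite N" "N \<noteq> {}" "finite M" "M \<noteq> {}" "x \<in> N \<rightarrow> pts X"
  shows "emp M (\<lambda>m. x (h m)) = emp N x"
proof (rule emp_reindex[OF assms(2,3,6,4,5)])
  show "h \<in> M \<rightarrow> N" using finunif_homD(1)[OF assms(1)] by auto
qed (rule finunif_hom_card_fiber[OF assms(1,2,4)])

text \<open>Listing the fibres one after the other, as blocks of equal length \<open>c\<close>,
  turns a morphism of FinUnif into division by \<open>c\<close>. This is the form that fits the
  subdivision of an interval into equal cells.\<close>

lemma finunif_hom_bij_div:
  assumes h: "h \<in> finunif_hom K {..<N}" and N: "0 < N" and K: "finite K" "K \<noteq> {}"
  obtains c :: nat and g where "0 < c" "card K = N * c" "bij_betw g {..<N * c} K" "\<And>j. j < N * c \<Longrightarrow> h (g j) = j div c"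
proof -
  define c where "c = card {k \<in> K. h k = 0}"
  have cN: "card {k \<in> K. h k = i} = c" if "i < N" for i
    unfolding c_def by (rule finunif_homD(2)[OF h]) (use that N in auto)
  have card: "c * N = card K"
    using finunif_hom_card_fiber[OF h _ K(1), of 0] N by (simp add: c_def)
  then have c0: "0 < c" using K by (cases c) auto
  have "\<forall>i. \<exists>f. i < N \<longrightarrow> bij_betw f {0..<c} {k \<in> K. h k = i}"
  proof
    fix i
    have "finite {k \<in> K. h k = i}" using K(1) by simp
    from ex_bij_betw_nat_finite[OF this] show "\<exists>f. i < N \<longrightarrow> bij_betw f {0..<c} {k \<in> K. h k = i}"
      using cN[of i] by auto
  qed
  from choice[OF this] obtain f where f: "\<And>i. i < N \<Longrightarrow> bij_betw (f i) {0..<c} {k \<in> K. h k = i}" by blast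
  define g where "g j = f (j div c) (j mod c)" for j
  have dv: "j div c < N" "j mod c < c" if "j < N * c" for j
    using that c0 by (simp_all add: less_mult_imp_div_less)
  have gK: "g j \<in> K" "h (g j) = j div c" if "j < N * c" for j
    using bij_betwE[OF f[OF dv(1)[OF that]]] dv(2)[OF that] by (auto simp: g_def)
  have "inj_on g {..<N * c}"
  proof (rule inj_onI)
    fix i j assume ij: "i \<in> {..<N * c}" "j \<in> {..<N * c}" "g i = g j"
    then have d: "i div c = j div c" using gK(2)[of i] gK(2)[of j] by auto
    have "f (i div c) (i mod c) = f (i div c) (j mod c)" using ij(3) by (simp add: g_def d)
    moreover have "i mod c \<in> {0..<c}" "j mod c \<in> {0..<c}" using dv(2) ij by auto
    ultimately have "i mod c = j mod c"
      using f[OF dv(1)[of i]] ij(1) unfolding bij_betw_def inj_on_def by blast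
    with d show "i = j" by (metis div_mult_mod_eq)
  qed
  moreover from this have "card (g ` {..<N * c}) = card K"
    using card by (simp add: card_image mult.commute)
  then have "g ` {..<N * c} = K"
    by (intro card_subset_eq[OF K(1)]) (use gK(1) in auto)
  ultimately have "bij_betw g {..<N * c} K" by (simp add: bij_betw_def)
  then show ?thesis using c0 card gK(2) by (intro that[of c g]) (auto simp: mult.commute)
qed

context metric_omet
begin

text \<open>The old tuple stays as it is, with each entry repeated \<open>c\<close> times, and only
  the new tuple is rearranged. Hence refinements can be iterated without disturbing what was aligned
  before.\<close>

lemma aligned_refinement:
  assumes N: "0 < N" and x: "x \<in> {..<N} \<rightarrow> pts X" and M: "finite M" "M \<noteq> {}" and y: "y \<in> M \<rightarrow> pts X"
    and e: "W (emp {..<N} x) (emp (M :: nat set) y) < e"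
  obtains c x' where "0 < c" "x' \<in> {..<N * c} \<rightarrow> pts X" "emp {..<N * c} x' = emp M y"
    "(\<Sum>j<N * c. d (x (j div c)) (x' j)) / real (N * c) \<le> e"
proof -
  have N': "finite {..<N}" "{..<N} \<noteq> {}" using N by auto
  obtain K :: "nat set" and \<phi> \<psi> where K: "K \<in> finunif_obj" and h: "\<phi> \<in> finunif_hom K {..<N}" "\<psi> \<in> finunif_hom K M"
    and le: "(\<Sum>k\<in>K. d (x (\<phi> k)) (y (\<psi> k))) / real (card K) \<le> e"
    by (rule emp_matching[OF N' x M y e])
  have K': "finite K" "K \<noteq> {}" using K by (auto simp: finunif_obj_def)
  obtain c g where c: "0 < c" "card K = N * c" "bij_betw g {..<N * c} K" "\<And>j. j < N * c \<Longrightarrow> \<phi> (g j) = j div c"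
    using finunif_hom_bij_div[OF h(1) N K'] by blast
  have yk: "(\<lambda>k. y (\<psi> k)) \<in> K \<rightarrow> pts X" using y finunif_homD(1)[OF h(2)] by auto
  show ?thesis
  proof (rule that[of c "\<lambda>j. y (\<psi> (g j))"])
    show "(\<lambda>j. y (\<psi> (g j))) \<in> {..<N * c} \<rightarrow> pts X" using yk bij_betwE[OF c(3)] by auto
    have "emp {..<N * c} (\<lambda>j. y (\<psi> (g j))) = emp K (\<lambda>k. y (\<psi> k))" by (rule emp_bij[OF K' yk c(3)])
    also have "\<dots> = emp M y" by (rule emp_hom[OF h(2) M K' y])
    finally show "emp {..<N * c} (\<lambda>j. y (\<psi> (g j))) = emp M y" .
    have "(\<Sum>j<N * c. d (x (j div c)) (y (\<psi> (g j)))) = (\<Sum>j<N * c. d (x (\<phi> (g j))) (y (\<psi> (g j))))"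
      using c(4) by (intro sum.cong) auto
    also have "\<dots> = (\<Sum>k\<in>K. d (x (\<phi> k)) (y (\<psi> k)))" by (rule sum.reindex_bij_betw[OF c(3)])
    finally show "(\<Sum>j<N * c. d (x (j div c)) (y (\<psi> (g j)))) / real (N * c) \<le> e" using le c(2) by simp
  qed (rule c(1))
qed

text \<open>Each tuple is aligned with the one constructed just before it, so this is a dependent
  choice of pairs consisting of a length and a tuple.\<close>

lemma aligned_sequence:
  fixes M :: "nat \<Rightarrow> nat set"
  assumes M: "\<And>k. finite (M k)" "\<And>k. M k \<noteq> {}" and y: "\<And>k. y k \<in> M k \<rightarrow> pts X"
    and W: "\<And>k. W (emp (M k) (y k)) (emp (M (Suc k)) (y (Suc k))) < (1/2) ^ k"
  obtains N c x where "\<And>k. 0 < N k" "\<And>k. x k \<in> {..<N k} \<rightarrow> pts X" "\<And>k. emp {..<N k} (x k) = emp (M k) (y k)"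
    "\<And>k. 0 < c k" "\<And>k. N (Suc k) = N k * c k"
    "\<And>k. (\<Sum>j<N (Suc k). d (x k (j div c k)) (x (Suc k) j)) / real (N (Suc k)) \<le> (1/2) ^ k"
proof -
  define P where "P k s \<longleftrightarrow> 0 < fst s \<and> snd s \<in> {..<fst s} \<rightarrow> pts X \<and> emp {..<fst s} (snd s) = emp (M k) (y k)"
    for k and s :: "nat \<times> (nat \<Rightarrow> 'a)"
  define Q where "Q k s t \<longleftrightarrow> (\<exists>c. 0 < c \<and> fst t = fst s * c \<and>
      (\<Sum>j<fst t. d (snd s (j div c)) (snd t j)) / real (fst t) \<le> (1/2) ^ k)"
    for k and s t :: "nat \<times> (nat \<Rightarrow> 'a)"
  have "\<exists>f. \<forall>k. P k (f k) \<and> Q k (f k) (f (Suc k))"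
  proof (rule dependent_nat_choice)
    obtain h where h: "bij_betw h {0..<card (M 0)} (M 0)" using ex_bij_betw_nat_finite[OF M(1)] by blast
    have "emp {0..<card (M 0)} (\<lambda>j. y 0 (h j)) = emp (M 0) (y 0)" by (rule emp_bij[OF M y h])
    moreover have "(\<lambda>j. y 0 (h j)) \<in> {..<card (M 0)} \<rightarrow> pts X" using y[of 0] bij_betwE[OF h] by (auto simp: Pi_iff)
    ultimately have "P 0 (card (M 0), \<lambda>j. y 0 (h j))"
      using M[of 0] by (simp add: P_def card_gt_0_iff atLeast0LessThan)
    then show "\<exists>s. P 0 s" by blast
  next
    fix s k assume s: "P k s"
    then have e: "W (emp {..<fst s} (snd s)) (emp (M (Suc k)) (y (Suc k))) < (1/2) ^ k"
      using W[of k] by (simp add: P_def)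
    obtain c x' where c: "0 < c" "x' \<in> {..<fst s * c} \<rightarrow> pts X" "emp {..<fst s * c} x' = emp (M (Suc k)) (y (Suc k))"
      "(\<Sum>j<fst s * c. d (snd s (j div c)) (x' j)) / real (fst s * c) \<le> (1/2) ^ k"
      by (rule aligned_refinement[OF _ _ M y e]) (use s in \<open>auto simp: P_def\<close>)
    then have "P (Suc k) (fst s * c, x')" "Q k s (fst s * c, x')"
      using s unfolding P_def Q_def by auto
    then show "\<exists>t. P (Suc k) t \<and> Q k s t" by blast
  qed
  then obtain f where f: "\<And>k. P k (f k)" "\<And>k. Q k (f k) (f (Suc k))" by blast
  have "\<forall>k. \<exists>c. 0 < c \<and> fst (f (Suc k)) = fst (f k) * c \<and>
      (\<Sum>j<fst (f (Suc k)). d (snd (f k) (j div c)) (snd (f (Suc k)) j)) / real (fst (f (Suc k))) \<le> (1/2) ^ k"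
    using f(2) by (simp add: Q_def)
  from choice[OF this] obtain c where "\<And>k. 0 < c k \<and> fst (f (Suc k)) = fst (f k) * c k \<and>
      (\<Sum>j<fst (f (Suc k)). d (snd (f k) (j div c k)) (snd (f (Suc k)) j)) / real (fst (f (Suc k))) \<le> (1/2) ^ k"
    by blast
  then show ?thesis
    using f(1) unfolding P_def by (intro that[of "\<lambda>k. fst (f k)" "\<lambda>k. snd (f k)" c]) blast+
qed

end

text \<open>The limit lies in an open \<open>U\<close> precisely if the sequence eventually keeps
  some positive distance \<open>1 / (n + 1)\<close> from the complement of \<open>U\<close>. Applied
  in the product topology, this gives measurability for its full Borel sigma-algebra.\<close>

lemma measurable_pointwise_limit:
  assumes S: "metrizable_space S" and f: "\<And>k::nat. f k \<in> measurable P (borel_of S)"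
    and lim: "\<And>t. t \<in> space P \<Longrightarrow> limitin S (\<lambda>k. f k t) (F t) sequentially"
  shows "F \<in> measurable P (borel_of S)"
proof (rule measurable_borel_ofI)
  show "F t \<in> topspace S" if "t \<in> space P" for t using lim[OF that] by (rule limitin_topspace)
  fix U assume U: "openin S U"
  obtain M d where "Metric_space M d" and Seq: "S = Metric_space.mtopology M d"
    using S metrizable_space_def by blast
  interpret Metric_space M d by fact
  \<comment> \<open>The complement \<open>C n\<close> of this set consists of the points at distance
    at least \<open>1 / (n + 1)\<close> from the complement of \<open>U\<close>; it is closed, so
    the limit cannot leave it.\<close>
  define V where "V n = (\<Union>y\<in>M - U. mball y (inverse (Suc n)))" for n :: nat
  define C where "C n = M - V n" for n
  have V: "openin S (V n)" for n by (auto simp: V_def Seq)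
  then have C: "closedin S (C n)" for n unfolding C_def Seq by (simp add: closedin_def double_diff openin_subset[of mtopology, simplified])
  have CU: "C n \<subseteq> U" for n by (auto simp: C_def V_def)
  have UM: "U \<subseteq> M" using openin_subset[OF U] by (simp add: Seq)
  have iff: "F t \<in> U \<longleftrightarrow> (\<exists>n m. \<forall>k\<ge>m. f k t \<in> C n)" if t: "t \<in> space P" for t
  proof
    assume FU: "F t \<in> U"
    then obtain r where r: "r > 0" "mball (F t) r \<subseteq> U" using U by (auto simp: Seq openin_mtopology)
    obtain n where n: "inverse (real (Suc n)) < r / 2" using r(1) reals_Archimedean[of "r/2"] by auto
    have "r/2 > 0" using r(1) by simp
    then obtain m where m: "\<And>k. k \<ge> m \<Longrightarrow> f k t \<in> M \<and> d (f k t) (F t) < r/2"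
      using lim[OF t] unfolding Seq limit_metric_sequentially by blast
    have "f k t \<in> C n" if "k \<ge> m" for k
    proof -
      have "f k t \<notin> mball y (inverse (Suc n))" if y: "y \<in> M - U" for y
      proof
        assume "f k t \<in> mball y (inverse (Suc n))"
        then have "d (F t) y < r"
          using m[OF \<open>k \<ge> m\<close>] n y FU UM triangle''[of "F t" "f k t" y] by (auto simp: commute)
        then have "y \<in> mball (F t) r" using y FU UM by auto
        with r(2) y show False by blast
      qed
      then show ?thesis using m[OF that] by (auto simp: C_def V_def)
    qed
    then show "\<exists>n m. \<forall>k\<ge>m. f k t \<in> C n" by blast
  next
    assume "\<exists>n m. \<forall>k\<ge>m. f k t \<in> C n"
    then obtain n m where "\<forall>k\<ge>m. f k t \<in> C n" by blast
    then have "F t \<in> C n"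
      by (intro limitin_closedin[OF lim[OF t] C[of n]]) (auto simp: eventually_sequentially)
    then show "F t \<in> U" using CU by blast
  qed
  have "F -` U \<inter> space P = (\<Union>n m. \<Inter>k\<in>{m..}. f k -` C n \<inter> space P)" (is "_ = ?rhs")
  proof (rule set_eqI)
    fix t show "t \<in> F -` U \<inter> space P \<longleftrightarrow> t \<in> ?rhs"
    proof (cases "t \<in> space P")
      case True
      then have "t \<in> ?rhs \<longleftrightarrow> (\<exists>n m. \<forall>k\<in>{m..}. f k t \<in> C n)" by auto
      also have "\<dots> \<longleftrightarrow> (\<exists>n m. \<forall>k\<ge>m. f k t \<in> C n)" by (simp only: Ball_def atLeast_iff)
      finally show ?thesis using iff[OF True] True by simp
    next
      case False
      then show ?thesis by auto
    qed
  qed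
  also have "\<dots> \<in> sets P"
  proof (intro sets.countable_UN subsetI)
    fix X assume "X \<in> range (\<lambda>n. \<Union>m. \<Inter>k\<in>{m..}. f k -` C n \<inter> space P)"
    then obtain n where X: "X = (\<Union>m. \<Inter>k\<in>{m..}. f k -` C n \<inter> space P)" by blast
    have "f k -` C n \<inter> space P \<in> sets P" for k
      using f borel_of_closed[OF C] by (rule measurable_sets)
    then have "(\<Inter>k\<in>{m..}. f k -` C n \<inter> space P) \<in> sets P" for m
      by (intro sets.countable_INT') auto
    then show "X \<in> sets P" unfolding X by (intro sets.countable_UN) auto
  qed
  finally show "F -` U \<inter> space P \<in> sets P" .
qed

text \<open>The definition asks for centres inside \<open>S\<close>. A centre outside can be
  replaced by any point of \<open>S\<close> in its ball, at the price of doubling the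
  radius.\<close>

lemma (in Metric_space) mtotally_boundedI:
  assumes S: "S \<subseteq> M" and cov: "\<And>e. 0 < e \<Longrightarrow> \<exists>F. finite F \<and> S \<subseteq> (\<Union>x\<in>F. mball x e)"
  shows "mtotally_bounded S"
  unfolding mtotally_bounded_def
proof (intro allI impI)
  fix e :: real assume "0 < e"
  then obtain F where F: "finite F" "S \<subseteq> (\<Union>x\<in>F. mball x (e/2))" using cov[of "e/2"] by auto
  define F' where "F' = {x \<in> F. S \<inter> mball x (e/2) \<noteq> {}}"
  define g where "g x = (SOME y. y \<in> S \<inter> mball x (e/2))" for x
  have g: "g x \<in> S \<inter> mball x (e/2)" if "x \<in> F'" for x
    using that someI_ex[of "\<lambda>y. y \<in> S \<inter> mball x (e/2)"] unfolding F'_def g_def by blast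
  have "S \<subseteq> (\<Union>x\<in>g ` F'. mball x e)"
  proof
    fix s assume s: "s \<in> S"
    then obtain x where x: "x \<in> F" "s \<in> mball x (e/2)" using F(2) by auto
    then have xF: "x \<in> F'" using s by (auto simp: F'_def)
    have "g x \<in> mball x (e/2)" using g[OF xF] by simp
    then have "d (g x) s < e" using x(2) triangle''[of "g x" x s] by auto
    then have "s \<in> mball (g x) e" using g[OF xF] s S by auto
    then show "s \<in> (\<Union>x\<in>g ` F'. mball x e)" using xF by auto
  qed
  moreover have "finite (g ` F')" "g ` F' \<subseteq> S" using F(1) g by (auto simp: F'_def)
  ultimately show "\<exists>K. finite K \<and> K \<subseteq> S \<and> S \<subseteq> (\<Union>x\<in>K. mball x e)" by blast
qed

section \<open>Step functions on the unit interval\<close>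

lemma nn_integral_finite_valued:
  fixes j :: "'w \<Rightarrow> nat"
  assumes j: "j \<in> measurable P (count_space UNIV)" and jn: "\<And>t. t \<in> space P \<Longrightarrow> j t < n"
  shows "(\<integral>\<^sup>+ t. g (j t) \<partial>P) = (\<Sum>i<n. g i * emeasure P {t \<in> space P. j t = i})"
proof -
  have m: "{t \<in> space P. j t = i} \<in> sets P" for i
    using measurable_sets[OF j, of "{i}"] by (simp add: vimage_def Int_def conj_commute)
  have "(\<integral>\<^sup>+ t. g (j t) \<partial>P) = (\<integral>\<^sup>+ t. (\<Sum>i<n. g i * indicator {t \<in> space P. j t = i} t) \<partial>P)"
  proof (rule nn_integral_cong)
    fix t assume t: "t \<in> space P"
    have "(\<Sum>i<n. g i * indicator {t \<in> space P. j t = i} t) = (\<Sum>i\<in>{j t}. g i * indicator {t \<in> space P. j t = i} t)"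
      using jn[OF t] by (intro sum.mono_neutral_right) (auto simp: indicator_def)
    then show "g (j t) = (\<Sum>i<n. g i * indicator {t \<in> space P. j t = i} t)" using t by simp
  qed
  also have "\<dots> = (\<Sum>i<n. \<integral>\<^sup>+ t. g i * indicator {t \<in> space P. j t = i} t \<partial>P)"
    using m by (intro nn_integral_sum) auto
  also have "\<dots> = (\<Sum>i<n. g i * emeasure P {t \<in> space P. j t = i})"
    using m by (intro sum.cong refl nn_integral_cmult_indicator) auto
  finally show ?thesis .
qed

text \<open>The interval is half-open, so that it splits into \<open>N\<close> half-open cells of
  equal length and \<open>grid_index N\<close> never takes the value \<open>N\<close>.\<close>

definition unit_interval :: "real measure"
  where "unit_interval = restrict_space lborel {0..<1}"

definition grid_index :: "nat \<Rightarrow> real \<Rightarrow> nat"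
  where "grid_index N t = nat \<lfloor>real N * t\<rfloor>"

lemma space_unit_interval [simp]: "space unit_interval = {0..<1}"
  by (simp add: unit_interval_def space_restrict_space)

lemma prob_space_unit_interval: "prob_space unit_interval"
  unfolding unit_interval_def by (rule prob_space_restrict_space) simp_all

lemma grid_index_measurable: "grid_index N \<in> measurable unit_interval (count_space UNIV)"
  unfolding unit_interval_def grid_index_def by (intro measurable_restrict_space1) measurable

lemma grid_index_less: "0 \<le> t \<Longrightarrow> t < 1 \<Longrightarrow> 0 < N \<Longrightarrow> grid_index N t < N"
proof -
  assume t: "0 \<le> t" "t < 1" "0 < N"
  then have "real N * t < real N" "0 \<le> real N * t" by simp_all
  then have "\<lfloor>real N * t\<rfloor> < int N" by linarith
  then show ?thesis using t by (simp add: grid_index_def nat_less_iff)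
qed

text \<open>This is what the alignment by \<open>div\<close> is for: the coarse cell of a point is
  computed from its fine cell in the same way as the old entry is found from the new index.
  Distances of aligned tuples thus become \<open>L1\<close> distances of step functions.\<close>

lemma grid_index_div:
  assumes "0 \<le> t" "0 < c"
  shows "grid_index (N * c) t div c = grid_index N t"
proof -
  have "real N * t = (real (N * c) * t) / real_of_int (int c)" using assms by simp
  then have "\<lfloor>real N * t\<rfloor> = \<lfloor>real (N * c) * t\<rfloor> div int c"
    by (simp only: floor_divide_real_eq_div[of "int c"] of_nat_0_le_iff)
  then show ?thesis using assms by (simp add: grid_index_def nat_div_distrib)
qed

lemma emeasure_grid_index:
  assumes N: "0 < N" and i: "i < N"
  shows "emeasure unit_interval {t \<in> space unit_interval. grid_index N t = i} = ennreal (1 / real N)"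
proof -
  have "{t \<in> space unit_interval. grid_index N t = i} = {real i / real N ..< (real i + 1) / real N}"
  proof (intro set_eqI iffI)
    fix t assume "t \<in> {t \<in> space unit_interval. grid_index N t = i}"
    then have t: "0 \<le> t" "t < 1" "nat \<lfloor>real N * t\<rfloor> = i" by (auto simp: grid_index_def)
    have "0 \<le> real N * t" using t(1) by simp
    then have "\<lfloor>real N * t\<rfloor> = int i" using t(3) by linarith
    then have "real i \<le> real N * t" "real N * t < real i + 1" by linarith+
    then show "t \<in> {real i / real N ..< (real i + 1) / real N}"
      using N by (simp add: pos_divide_le_eq pos_less_divide_eq mult.commute)
  next
    fix t assume t: "t \<in> {real i / real N ..< (real i + 1) / real N}"
    then have t': "real i \<le> real N * t" "real N * t < real i + 1"
      using N by (simp_all add: pos_divide_le_eq pos_less_divide_eq mult.commute)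
    then have "\<lfloor>real N * t\<rfloor> = int i" by linarith
    moreover have "0 \<le> t" using t by (auto intro: order_trans[of 0 "real i / real N"])
    moreover have "t < 1"
    proof -
      have "(real i + 1) / real N \<le> 1" using i N by (simp add: divide_le_eq_1)
      then show ?thesis using t by auto
    qed
    ultimately show "t \<in> {t \<in> space unit_interval. grid_index N t = i}" by (simp add: grid_index_def)
  qed
  moreover have "{real i / real N ..< (real i + 1) / real N} \<subseteq> {0..<1}"
  proof -
    have "(real i + 1) / real N \<le> 1" "0 \<le> real i / real N" using i N by (simp_all add: divide_le_eq_1)
    then show ?thesis by (auto intro: order_trans less_le_trans)
  qed
  ultimately show ?thesis
    using N by (simp add: unit_interval_def emeasure_restrict_space divide_right_mono diff_divide_distrib[symmetric])
qed

context metric_omet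
begin

lemma chain_dist_le:
  assumes "\<And>i. z i \<in> pts X"
  shows "d (z k) (z (n + k)) \<le> (\<Sum>i<n. d (z (i + k)) (z (Suc i + k)))"
proof (induction n)
  case 0
  then show ?case using assms by simp
next
  case (Suc n)
  have "d (z k) (z (Suc n + k)) \<le> d (z k) (z (n + k)) + d (z (n + k)) (z (Suc n + k))"
    by (rule triangle) (rule assms)+
  then show ?case using Suc by simp
qed

lemma summable_chain_MCauchy:
  assumes z: "\<And>i. z i \<in> pts X" and s: "summable (\<lambda>i. d (z i) (z (Suc i)))"
  shows "MCauchy z"
  unfolding MCauchy_def
proof (intro conjI allI impI)
  fix e :: real assume "0 < e"
  then have "0 < e/2" by simp
  have "(\<lambda>k. \<Sum>i. d (z (i + k)) (z (Suc (i + k)))) \<longlonglongrightarrow> 0" by (rule suminf_exist_split2[OF s])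
  from order_tendstoD(2)[OF this \<open>0 < e/2\<close>]
  obtain k where k: "(\<Sum>i. d (z (i + k)) (z (Suc (i + k)))) < e/2"
    by (auto simp: eventually_sequentially)
  have near: "d (z k) (z n) < e/2" if n: "k \<le> n" for n
  proof -
    have "d (z k) (z n) \<le> (\<Sum>i<n - k. d (z (i + k)) (z (Suc (i + k))))"
      using chain_dist_le[of z k "n - k", OF z] n by simp
    also have "\<dots> \<le> (\<Sum>i. d (z (i + k)) (z (Suc (i + k))))"
      by (intro sum_le_suminf summable_ignore_initial_segment[OF s, of k]) auto
    finally show ?thesis using k by simp
  qed
  have "d (z n) (z n') < e" if "k \<le> n" "k \<le> n'" for n n'
  proof -
    have "d (z n) (z n') \<le> d (z k) (z n) + d (z k) (z n')" by (rule triangle'') (rule z)+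
    then show ?thesis using near[OF that(1)] near[OF that(2)] by simp
  qed
  then show "\<exists>N. \<forall>n n'. N \<le> n \<longrightarrow> N \<le> n' \<longrightarrow> d (z n) (z n') < e" by blast
qed (use z in auto)

lemma limitin_dist:
  assumes lim: "limitin mtopology z l sequentially" and z: "\<And>i. z i \<in> pts X" and a: "a \<in> pts X"
  shows "(\<lambda>n. d a (z n)) \<longlonglongrightarrow> d a l"
proof -
  have l: "l \<in> pts X" using lim by (rule limitin_mspace)
  have lim0: "(\<lambda>n. d (z n) l) \<longlonglongrightarrow> 0" using lim by (simp add: limitin_metric_dist_null)
  have le: "norm (d a (z n) - d a l) \<le> d (z n) l" for n
    using mdist_reverse_triangle[OF z a l, of n] by (simp add: commute)
  have "(\<lambda>n. d a (z n) - d a l) \<longlonglongrightarrow> 0"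
    by (rule Lim_null_comparison[OF always_eventually lim0]) (intro allI le)
  then show ?thesis by (simp add: LIM_zero_iff)
qed

end

text \<open>An aligned sequence of tuples is a sequence of step functions on the unit interval with
  summable consecutive \<open>L1\<close> distances. It converges almost everywhere, and the law of its limit is
  the limit of the empirical measures.\<close>

locale aligned_tuples = metric_omet X for X :: "'a omet" +
  fixes N c :: "nat \<Rightarrow> nat" and x :: "nat \<Rightarrow> nat \<Rightarrow> 'a"
  assumes complete: mcomplete
    and N: "\<And>k. 0 < N k" and x: "\<And>k. x k \<in> {..<N k} \<rightarrow> pts X"
    and c: "\<And>k. 0 < c k" "\<And>k. N (Suc k) = N k * c k"
    and close: "\<And>k. (\<Sum>j<N (Suc k). d (x k (j div c k)) (x (Suc k) j)) / real (N (Suc k)) \<le> (1/2) ^ k"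
begin

abbreviation "P \<equiv> unit_interval"

definition "f k t = x k (grid_index (N k) t)"

lemma index_measurable: "grid_index (N k) \<in> measurable P (count_space {..<N k})"
proof (rule measurableI)
  show "grid_index (N k) t \<in> space (count_space {..<N k})" if "t \<in> space P" for t
    using that grid_index_less[of t "N k"] N by simp
  show "grid_index (N k) -` A \<inter> space P \<in> sets P" for A
    using measurable_sets[OF grid_index_measurable, of A "N k"] by simp
qed

lemma f_in: "t \<in> space P \<Longrightarrow> f k t \<in> pts X"
  using measurable_space[OF index_measurable, of t k] x[of k] by (auto simp: f_def)

lemma f_compose_measurable: "g \<in> {..<N k} \<rightarrow> space M \<Longrightarrow> (\<lambda>t. g (grid_index (N k) t)) \<in> measurable P M"
  by (rule measurable_compose[OF index_measurable]) (simp add: measurable_count_space_eq1)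

lemma f_measurable: "f k \<in> measurable P B"
  unfolding f_def[abs_def] using x by (intro f_compose_measurable) simp

text \<open>Pairing two measurable maps only gives measurability for the product of the Borel
  sigma-algebras. Step functions take finitely many values, so the Borel sets of the product
  topology can be treated case by case.\<close>

lemma f_pair_measurable: "(\<lambda>t. (f k t, f l t)) \<in> measurable P B2"
  unfolding f_def
proof (rule measurable_compose_countable'[where f="\<lambda>i t. (x k i, x l (grid_index (N l) t))" and I="{..<N k}"])
  show "(\<lambda>t. (x k i, x l (grid_index (N l) t))) \<in> measurable P B2" if "i \<in> {..<N k}" for i
    using x[of k] x[of l] that by (intro f_compose_measurable) auto
qed (simp_all add: index_measurable)

lemma law_f: "distr P B (f k) = emp {..<N k} (x k)"
proof (rule measure_eqI)
  show "sets (distr P B (f k)) = sets (emp {..<N k} (x k))" by (simp add: emp_def fin_law_def)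
  fix A assume "A \<in> sets (distr P B (f k))"
  then have A: "A \<in> sets B" by simp
  have Nk: "finite {..<N k}" "{..<N k} \<noteq> {}" using N[of k] by auto
  have "emeasure (distr P B (f k)) A = (\<integral>\<^sup>+ y. indicator A y \<partial>distr P B (f k))" using A by simp
  also have "\<dots> = (\<integral>\<^sup>+ t. indicator A (x k (grid_index (N k) t)) \<partial>P)"
    using f_measurable[of k] A by (subst nn_integral_distr) (auto simp: f_def)
  also have "\<dots> = (\<Sum>i<N k. indicator A (x k i) * emeasure P {t \<in> space P. grid_index (N k) t = i})"
    using N[of k] by (intro nn_integral_finite_valued grid_index_measurable grid_index_less) auto
  also have "\<dots> = (\<Sum>i<N k. ennreal (1 / real (N k) * indicator A (x k i)))"
    using N[of k] by (intro sum.cong refl) (simp add: emeasure_grid_index del: space_unit_interval split: split_indicator)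
  also have "\<dots> = ennreal (\<Sum>i<N k. 1 / real (N k) * indicator A (x k i))" by (intro sum_ennreal) simp
  also have "\<dots> = emeasure (emp {..<N k} (x k)) A"
    unfolding emp_def by (subst emeasure_fin_law[OF uniform_weights[OF Nk] x A]) simp
  finally show "emeasure (distr P B (f k)) A = emeasure (emp {..<N k} (x k)) A" .
qed

text \<open>The function \<open>h k\<close> is the length of the path formed by the values
  \<open>f k t\<close>, \<open>f (Suc k) t\<close> and so on. It dominates the distance from
  \<open>f k t\<close> to the limit, and \<open>G\<close> is the set where the whole path has finite
  length.\<close>

definition "D i t = ennreal (d (f i t) (f (Suc i) t))"
definition "h k t = (\<Sum>i. D (i + k) t)"
definition "G = {t \<in> space P. h 0 t \<noteq> \<infinity>}"

lemma D_measurable [measurable]: "D i \<in> borel_measurable P"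
  unfolding D_def[abs_def]
  using measurable_compose[OF f_pair_measurable measurable_compose[OF d_measurable measurable_ennreal]] by simp

lemma h_measurable [measurable]: "h k \<in> borel_measurable P"
  unfolding h_def[abs_def] by measurable

lemma nn_integral_D: "(\<integral>\<^sup>+ t. D k t \<partial>P) \<le> ennreal ((1/2) ^ k)"
proof -
  let ?g = "\<lambda>j. ennreal (d (x k (j div c k)) (x (Suc k) j))"
  have "(\<integral>\<^sup>+ t. D k t \<partial>P) = (\<integral>\<^sup>+ t. ?g (grid_index (N (Suc k)) t) \<partial>P)"
  proof (rule nn_integral_cong)
    fix t assume "t \<in> space P"
    then have "grid_index (N (Suc k)) t div c k = grid_index (N k) t"
      using grid_index_div[of t "c k" "N k"] c by simp
    then show "D k t = ?g (grid_index (N (Suc k)) t)" by (simp add: D_def f_def)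
  qed
  also have "\<dots> = (\<Sum>j<N (Suc k). ?g j * emeasure P {t \<in> space P. grid_index (N (Suc k)) t = j})"
    using N[of "Suc k"] by (intro nn_integral_finite_valued grid_index_measurable grid_index_less) auto
  also have "\<dots> = (\<Sum>j<N (Suc k). ennreal (d (x k (j div c k)) (x (Suc k) j) / real (N (Suc k))))"
    using N[of "Suc k"]
    by (intro sum.cong refl) (simp add: emeasure_grid_index ennreal_mult[symmetric] del: space_unit_interval)
  also have "\<dots> = ennreal ((\<Sum>j<N (Suc k). d (x k (j div c k)) (x (Suc k) j)) / real (N (Suc k)))"
    unfolding sum_divide_distrib by (intro sum_ennreal) simp
  also have "\<dots> \<le> ennreal ((1/2) ^ k)" using close by (rule ennreal_leI)
  finally show ?thesis .
qed

lemma nn_integral_h: "(\<integral>\<^sup>+ t. h k t \<partial>P) \<le> ennreal (2 * (1/2) ^ k)"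
proof -
  have s: "(\<lambda>i. (1/2::real) ^ (i + k)) sums (2 * (1/2) ^ k)"
    using sums_mult2[OF geometric_sums[of "1/2::real"], of "(1/2) ^ k"] by (simp add: power_add)
  have "(\<integral>\<^sup>+ t. h k t \<partial>P) = (\<Sum>i. \<integral>\<^sup>+ t. D (i + k) t \<partial>P)"
    unfolding h_def by (intro nn_integral_suminf) simp
  also have "\<dots> \<le> (\<Sum>i. ennreal ((1/2) ^ (i + k)))"
    using nn_integral_D by (intro suminf_le) auto
  also have "\<dots> = ennreal (2 * (1/2) ^ k)"
    using s by (intro suminf_ennreal_eq) auto
  finally show ?thesis .
qed

lemma G_sets: "G \<in> sets P"
  unfolding G_def by measurable

lemma AE_G: "AE t in P. t \<in> G"
proof -
  have "(\<integral>\<^sup>+ t. h 0 t \<partial>P) \<noteq> \<infinity>" using nn_integral_h[of 0] by (auto simp: top_unique)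
  then have "AE t in P. h 0 t \<noteq> \<infinity>" by (intro nn_integral_PInf_AE) auto
  then show ?thesis using AE_space by eventually_elim (simp add: G_def)
qed

lemma f_convergent:
  assumes t: "t \<in> G"
  shows "\<exists>l. limitin mtopology (\<lambda>k. f k t) l sequentially"
proof -
  have tP: "t \<in> space P" using t by (simp add: G_def)
  have "(\<Sum>i. ennreal (d (f i t) (f (Suc i) t))) \<noteq> \<infinity>" using t by (simp add: G_def h_def D_def)
  then have "summable (\<lambda>i. d (f i t) (f (Suc i) t))" by (intro summable_suminf_not_top) auto
  then have "MCauchy (\<lambda>k. f k t)" by (intro summable_chain_MCauchy f_in[OF tP])
  then show ?thesis using complete by (simp add: mcomplete_def)
qed

definition "a0 = x 0 0"

lemma a0: "a0 \<in> pts X"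
  using x[of 0] N[of 0] by (auto simp: a0_def Pi_iff)

text \<open>Off the set \<open>G\<close>, which has full measure, the constant value
  \<open>a0\<close> keeps \<open>F\<close> inside \<open>X\<close>. On \<open>G\<close> the limit is
  unique, so the choice does not matter.\<close>

definition "F t = (if t \<in> G then SOME l. limitin mtopology (\<lambda>k. f k t) l sequentially else a0)"

lemma F_limit: "t \<in> G \<Longrightarrow> limitin mtopology (\<lambda>k. f k t) (F t) sequentially"
  using someI_ex[OF f_convergent] by (simp add: F_def)

lemma F_in: "F t \<in> pts X"
  using limitin_mspace[OF F_limit, of t] a0 by (cases "t \<in> G") (auto simp: F_def)

lemma dist_f_F:
  assumes t: "t \<in> G"
  shows "ennreal (d (f k t) (F t)) \<le> h k t"
proof -
  have tP: "t \<in> space P" using t by (simp add: G_def)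
  have le: "ennreal (d (f k t) (f (n + k) t)) \<le> h k t" for n
  proof -
    have "d (f k t) (f (n + k) t) \<le> (\<Sum>i<n. d (f (i + k) t) (f (Suc i + k) t))"
      using f_in[OF tP] by (rule chain_dist_le)
    then have "ennreal (d (f k t) (f (n + k) t)) \<le> (\<Sum>i<n. D (i + k) t)"
      unfolding D_def by (subst sum_ennreal) (auto intro: ennreal_leI)
    also have "\<dots> \<le> h k t" unfolding h_def by (intro sum_le_suminf) auto
    finally show ?thesis .
  qed
  have lim: "(\<lambda>n. ennreal (d (f k t) (f (n + k) t))) \<longlonglongrightarrow> ennreal (d (f k t) (F t))"
    using LIMSEQ_ignore_initial_segment[OF limitin_dist[OF F_limit[OF t] f_in[OF tP] f_in[OF tP]], of k k]
    by (intro tendsto_ennrealI) simp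
  show ?thesis by (rule LIMSEQ_le_const2[OF lim]) (intro exI allI impI le)
qed

lemma pair_const_measurable: "a \<in> pts X \<Longrightarrow> (\<lambda>t. (f k t, a)) \<in> measurable P B2"
proof -
  assume "a \<in> pts X"
  then have "continuous_map T (prod_topology T T) (\<lambda>y. (y, a))" by (simp add: continuous_map_paired)
  from measurable_compose[OF f_measurable continuous_map_measurable[OF this]] show ?thesis .
qed

text \<open>The pair is obtained as a limit of the pairs of \<open>f k t\<close> with
  \<open>f l t\<close> for growing \<open>l\<close>. Replacing the second entry by \<open>a0\<close>
  outside \<open>G\<close> makes the convergence hold at every point, as a pointwise limit
  requires.\<close>

lemma f_F_measurable: "(\<lambda>t. (f k t, F t)) \<in> measurable P B2"
proof (rule measurable_pointwise_limit[OF metrizable_T2])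
  let ?g = "\<lambda>l t. if t \<in> G then (f k t, f l t) else (f k t, a0)"
  show "?g l \<in> measurable P B2" for l
    by (rule measurable_If_set[OF f_pair_measurable pair_const_measurable[OF a0]])
       (intro sets.Int G_sets sets.top)
  fix t assume t: "t \<in> space P"
  show "limitin (prod_topology T T) (\<lambda>l. ?g l t) (f k t, F t) sequentially"
  proof (cases "t \<in> G")
    case True
    then show ?thesis using F_limit[OF True] f_in[OF t, of k]
      by (simp add: limitin_pairwise comp_def T_def)
  next
    case False
    then show ?thesis using f_in[OF t, of k] a0 by (simp add: F_def)
  qed
qed

lemma F_measurable: "F \<in> measurable P B"
  using measurable_compose[OF f_F_measurable measurable_snd_borel_of] by simp

definition "p = distr P B F"

lemma prob_space_p: "prob_space p"
  unfolding p_def using prob_space_unit_interval F_measurable by (rule prob_space.prob_space_distr)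

lemma dist_f_F_measurable: "(\<lambda>t. ennreal (d (f k t) (F t))) \<in> borel_measurable P"
  using measurable_compose[OF f_F_measurable measurable_compose[OF d_measurable measurable_ennreal]] by simp

lemma nn_integral_dist_f_F: "(\<integral>\<^sup>+ t. ennreal (d (f k t) (F t)) \<partial>P) \<le> ennreal (2 * (1/2) ^ k)"
proof -
  have "(\<integral>\<^sup>+ t. ennreal (d (f k t) (F t)) \<partial>P) \<le> (\<integral>\<^sup>+ t. h k t \<partial>P)"
    using AE_G dist_f_F by (intro nn_integral_mono_AE) (auto elim: eventually_mono)
  then show ?thesis using nn_integral_h by (rule order_trans)
qed

text \<open>The compact set consists of the points that, for every \<open>n\<close>, are within
  \<open>1 / (n + 1)\<close> of the finitely many values of \<open>f (k n)\<close>. It is closed and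
  totally bounded, hence compact by completeness. A value of \<open>F\<close> outside it is far from
  \<open>f (k n)\<close> for some \<open>n\<close>, which has small probability by Markov's
  inequality.\<close>

lemma tight_p:
  assumes e: "0 < e"
  shows "\<exists>K. compactin T K \<and> measure p (topspace T - K) \<le> e"
proof -
  \<comment> \<open>The factor \<open>Suc n\<close> comes from Markov's inequality with threshold
    \<open>1 / (n + 1)\<close>, and \<open>2 * (1/2) ^ k\<close> bounds the \<open>L1\<close>
    distance to the limit. The stage \<open>k\<close> is taken so late that the bounds over all
    \<open>n\<close> sum to \<open>e\<close>.\<close>
  have ex: "\<forall>n. \<exists>k. real (Suc n) * (2 * (1/2) ^ k) \<le> e * (1/2) ^ Suc n"
  proof
    fix n
    have "0 < e * (1/2) ^ Suc n / (2 * real (Suc n))" using e by simp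
    from real_arch_pow_inv[OF this, of "1/2"] obtain k where "(1/2) ^ k < e * (1/2) ^ Suc n / (2 * real (Suc n))"
      by auto
    then have "real (Suc n) * (2 * (1/2) ^ k) \<le> e * (1/2) ^ Suc n"
      by (simp add: pos_less_divide_eq mult.commute mult.left_commute del: power_Suc of_nat_Suc)
    then show "\<exists>k. real (Suc n) * (2 * (1/2) ^ k) \<le> e * (1/2) ^ Suc n" by blast
  qed
  from choice[OF ex] obtain k where k: "\<And>n. real (Suc n) * (2 * (1/2) ^ k n) \<le> e * (1/2) ^ Suc n" by blast
  define K where "K = (\<Inter>n. \<Union>i<N (k n). mcball (x (k n) i) (inverse (Suc n)))"
  have clK: "closedin mtopology K"
    unfolding K_def by (intro closedin_Inter) (auto intro!: closedin_Union)
  have KM: "K \<subseteq> pts X" using closedin_subset[OF clK] by simp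
  have "mtotally_bounded K"
  proof (rule mtotally_boundedI[OF KM])
    fix \<epsilon> :: real assume "0 < \<epsilon>"
    then obtain n where n: "inverse (real (Suc n)) < \<epsilon>" using reals_Archimedean by blast
    have "K \<subseteq> (\<Union>i<N (k n). mcball (x (k n) i) (inverse (Suc n)))" unfolding K_def by blast
    also have "\<dots> \<subseteq> (\<Union>i<N (k n). mball (x (k n) i) \<epsilon>)"
      using n by (intro UN_mono order_refl mcball_subset_mball_concentric) auto
    finally show "\<exists>F. finite F \<and> K \<subseteq> (\<Union>a\<in>F. mball a \<epsilon>)"
      by (intro exI[of _ "x (k n) ` {..<N (k n)}"]) auto
  qed
  then have cK: "compactin T K"
    using mtotally_bounded_eq_compact_closure_of[OF complete] closure_of_closedin[OF clK] by (simp add: T_def)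
  define Bd where "Bd n = {t \<in> space P. 1 \<le> ennreal (real (Suc n)) * ennreal (d (f (k n) t) (F t))}" for n
  have Bd: "Bd n \<in> sets P" for n unfolding Bd_def using dist_f_F_measurable[of "k n"] by measurable
  have mBd: "emeasure P (Bd n) \<le> ennreal (e * (1/2) ^ Suc n)" for n
  proof -
    have "emeasure P (Bd n) \<le> ennreal (real (Suc n)) * (\<integral>\<^sup>+ t. ennreal (d (f (k n) t) (F t)) * indicator (space P) t \<partial>P)"
      unfolding Bd_def
      by (intro nn_integral_Markov_inequality borel_measurable_times_ennreal borel_measurable_indicator
          sets.top dist_f_F_measurable)
    also have "(\<integral>\<^sup>+ t. ennreal (d (f (k n) t) (F t)) * indicator (space P) t \<partial>P) = (\<integral>\<^sup>+ t. ennreal (d (f (k n) t) (F t)) \<partial>P)"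
      by (intro nn_integral_cong) (simp del: space_unit_interval)
    also have "\<dots> \<le> ennreal (2 * (1/2) ^ k n)" by (rule nn_integral_dist_f_F)
    also have "ennreal (real (Suc n)) * ennreal (2 * (1/2) ^ k n) = ennreal (real (Suc n) * (2 * (1/2) ^ k n))"
      by (simp add: ennreal_mult)
    also have "\<dots> \<le> ennreal (e * (1/2) ^ Suc n)" using k by (rule ennreal_leI)
    finally show ?thesis by (simp add: mult_left_mono)
  qed
  have "topspace T - K \<in> sets B"
    using sets.compl_sets[OF borel_of_compact[OF metrizable_T cK]] by simp
  then have "emeasure p (topspace T - K) = emeasure P (F -` (topspace T - K) \<inter> space P)"
    unfolding p_def using F_measurable by (simp add: emeasure_distr)
  also have "\<dots> \<le> emeasure P (\<Union>n. Bd n)"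
  proof (rule emeasure_mono)
    show "(\<Union>n. Bd n) \<in> sets P" using Bd by auto
    show "F -` (topspace T - K) \<inter> space P \<subseteq> (\<Union>n. Bd n)"
    proof
      fix t assume t: "t \<in> F -` (topspace T - K) \<inter> space P"
      then have "F t \<notin> K" by simp
      then obtain n where n: "F t \<notin> (\<Union>i<N (k n). mcball (x (k n) i) (inverse (Suc n)))" unfolding K_def by blast
      have tP: "t \<in> space P" using t by simp
      have i: "grid_index (N (k n)) t < N (k n)" using measurable_space[OF index_measurable tP, of "k n"] by simp
      have "\<not> d (f (k n) t) (F t) \<le> inverse (Suc n)"
      proof
        assume "d (f (k n) t) (F t) \<le> inverse (Suc n)"
        then have "F t \<in> mcball (x (k n) (grid_index (N (k n)) t)) (inverse (Suc n))"
          using f_in[OF tP, of "k n"] F_in[of t] by (simp add: f_def)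
        with i n show False by blast
      qed
      then have "1 \<le> real (Suc n) * d (f (k n) t) (F t)"
        by (simp add: field_simps del: of_nat_Suc)
      then have "1 \<le> ennreal (real (Suc n)) * ennreal (d (f (k n) t) (F t))"
        by (metis ennreal_1 ennreal_leI ennreal_mult nonneg of_nat_0_le_iff)
      then show "t \<in> (\<Union>n. Bd n)" using tP unfolding Bd_def by blast
    qed
  qed
  also have "\<dots> \<le> (\<Sum>n. emeasure P (Bd n))" using Bd by (intro emeasure_subadditive_countably) auto
  also have "\<dots> \<le> (\<Sum>n. ennreal (e * (1/2) ^ Suc n))" using mBd by (intro suminf_le) auto
  also have "\<dots> = ennreal e"
    using sums_mult[OF power_half_series, of e] e by (intro suminf_ennreal_eq) auto
  finally have "measure p (topspace T - K) \<le> e"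
    using e by (simp add: measure_def enn2real_leI)
  with cK show ?thesis by blast
qed

lemma radon_p: "radon_prob T p"
  by (rule tight_imp_radon_prob[OF metrizable_T _ prob_space_p tight_p]) (simp_all add: p_def)

lemma emp_in: "emp {..<N k} (x k) \<in> PX"
  using N[of k] by (intro emp_in_PX x) auto

lemma p_in: "p \<in> PX"
proof (rule PX_I[OF radon_p a0])
  have da: "(\<lambda>y. ennreal (d a0 y)) \<in> borel_measurable B" using dist_measurable[OF a0] by simp
  have "(\<integral>\<^sup>+ y. ennreal (d a0 y) \<partial>p) = (\<integral>\<^sup>+ t. ennreal (d a0 (F t)) \<partial>P)"
    unfolding p_def using F_measurable da by (subst nn_integral_distr) auto
  also have "\<dots> \<le> (\<integral>\<^sup>+ t. ennreal (d a0 (f 0 t)) + ennreal (d (f 0 t) (F t)) \<partial>P)"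
  proof (rule nn_integral_mono)
    fix t assume "t \<in> space P"
    then have "d a0 (F t) \<le> d a0 (f 0 t) + d (f 0 t) (F t)" by (intro triangle a0 f_in F_in)
    then show "ennreal (d a0 (F t)) \<le> ennreal (d a0 (f 0 t)) + ennreal (d (f 0 t) (F t))"
      by (simp flip: ennreal_plus)
  qed
  also have "\<dots> = (\<integral>\<^sup>+ t. ennreal (d a0 (f 0 t)) \<partial>P) + (\<integral>\<^sup>+ t. ennreal (d (f 0 t) (F t)) \<partial>P)"
    using measurable_compose[OF f_measurable da] dist_f_F_measurable by (intro nn_integral_add)
  also have "\<dots> < top"
  proof -
    have "(\<integral>\<^sup>+ t. ennreal (d a0 (f 0 t)) \<partial>P) = (\<integral>\<^sup>+ y. ennreal (d a0 y) \<partial>emp {..<N 0} (x 0))"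
      unfolding law_f[symmetric] using f_measurable da by (subst nn_integral_distr) auto
    also have "\<dots> < top"
      using PX_D(1,2)[OF emp_in[of 0]] a0 by (simp add: finite_first_moment_iff)
    finally show ?thesis
      using nn_integral_dist_f_F[of 0] by (auto simp: less_top[symmetric] top_unique)
  qed
  finally show "(\<integral>\<^sup>+ y. ennreal (d a0 y) \<partial>p) < top" .
qed

lemma W_emp_p: "W (emp {..<N k} (x k)) p \<le> 2 * (1/2) ^ k"
proof -
  let ?R = "distr P B2 (\<lambda>t. (f k t, F t))"
  have R: "radon_coupling T T (emp {..<N k} (x k)) p ?R"
    unfolding radon_coupling_def
    using metrizable_T PX_D(1)[OF emp_in[of k]] radon_p f_F_measurable[of k]
      measurable_fst_borel_of[of T T] measurable_snd_borel_of[of T T] law_f[of k]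
      prob_space.prob_space_distr[OF prob_space_unit_interval]
    by (auto simp: distr_distr comp_def p_def)
  have "ennreal (W (emp {..<N k} (x k)) p) \<le> cost ?R" by (rule W_le[OF emp_in p_in R])
  also have "\<dots> = (\<integral>\<^sup>+ t. ennreal (d (f k t) (F t)) \<partial>P)"
    using f_F_measurable measurable_compose[OF d_measurable measurable_ennreal]
    by (subst nn_integral_distr) simp_all
  also have "\<dots> \<le> ennreal (2 * (1/2) ^ k)" by (rule nn_integral_dist_f_F)
  finally show ?thesis by (subst (asm) ennreal_le_iff) auto
qed

end

section \<open>Limits of Cauchy sequences of arbitrary measures\<close>

context metric_omet
begin

lemma emp_sequence_convergent:
  fixes M :: "nat \<Rightarrow> nat set"
  assumes complete: mcomplete and M: "\<And>k. finite (M k)" "\<And>k. M k \<noteq> {}" and y: "\<And>k. y k \<in> M k \<rightarrow> pts X"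
    and W: "\<And>k. W (emp (M k) (y k)) (emp (M (Suc k)) (y (Suc k))) < (1/2) ^ k"
  obtains p where "p \<in> PX" "\<And>k. W (emp (M k) (y k)) p \<le> 2 * (1/2) ^ k"
proof -
  obtain N c x where al: "\<And>k. 0 < N k" "\<And>k. x k \<in> {..<N k} \<rightarrow> pts X" "\<And>k. emp {..<N k} (x k) = emp (M k) (y k)"
    "\<And>k. 0 < c k" "\<And>k. N (Suc k) = N k * c k"
    "\<And>k. (\<Sum>j<N (Suc k). d (x k (j div c k)) (x (Suc k) j)) / real (N (Suc k)) \<le> (1/2) ^ k"
  proof (rule aligned_sequence[OF M y W])
    fix N c x
    assume "\<And>k. 0 < N k" "\<And>k. x k \<in> {..<N k} \<rightarrow> pts X" "\<And>k. emp {..<N k} (x k) = emp (M k) (y k)"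
      "\<And>k. 0 < c k" "\<And>k. N (Suc k) = N k * c k"
      "\<And>k. (\<Sum>j<N (Suc k). d (x k (j div c k)) (x (Suc k) j)) / real (N (Suc k)) \<le> (1/2) ^ k"
    then show thesis by (rule that)
  qed
  interpret aligned_tuples X N c x
    by unfold_locales (rule complete al)+
  show ?thesis using that[OF p_in] W_emp_p al(3) by simp
qed

text \<open>Each term of a thinned Cauchy sequence is replaced by an empirical measure so close that
  consecutive distances still decay geometrically; the limit of these measures is then the limit of
  the original sequence. The index sets here are sets of natural numbers, in which the alignment is
  carried out.\<close>

theorem mcomplete_W:
  assumes complete: mcomplete
  shows "Metric_space.mcomplete PX W"
proof -
  interpret P: Metric_space PX W by (rule Metric_space_W)
  show ?thesis
    unfolding P.mcomplete_def
  proof (intro allI impI)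
    fix \<sigma> assume \<sigma>: "P.MCauchy \<sigma>"
    have \<sigma>P: "\<sigma> n \<in> PX" for n using \<sigma> by (auto simp: P.MCauchy_def)
    \<comment> \<open>A quarter, because a step between consecutive empirical measures consists of
      three such distances: down to the sequence, along it, and up again.\<close>
    have ex: "\<forall>k. \<exists>n. \<forall>m m'. n \<le> m \<longrightarrow> n \<le> m' \<longrightarrow> W (\<sigma> m) (\<sigma> m') < (1/2) ^ k / 4"
    proof
      fix k
      have "(0::real) < (1/2) ^ k / 4" by simp
      with \<sigma> show "\<exists>n. \<forall>m m'. n \<le> m \<longrightarrow> n \<le> m' \<longrightarrow> W (\<sigma> m) (\<sigma> m') < (1/2) ^ k / 4"
        unfolding P.MCauchy_def by blast
    qed
    from choice[OF ex] obtain g where g: "\<And>k m m'. g k \<le> m \<Longrightarrow> g k \<le> m' \<Longrightarrow> W (\<sigma> m) (\<sigma> m') < (1/2) ^ k / 4"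
      by blast
    \<comment> \<open>Partial sums are at least \<open>g k\<close> and, unlike \<open>g\<close>
      itself, increase with \<open>k\<close>.\<close>
    define n where "n k = (\<Sum>i\<le>k. g i)" for k
    have gn: "g k \<le> n k" for k unfolding n_def by (rule member_le_sum) auto
    have nS: "n k \<le> n (Suc k)" for k by (simp add: n_def)
    define Pr where "Pr k z \<longleftrightarrow> finite (fst z) \<and> fst z \<noteq> {} \<and> snd z \<in> fst z \<rightarrow> pts X \<and>
        W (\<sigma> (n k)) (emp (fst z) (snd z)) < (1/2) ^ k / 4" for k and z :: "nat set \<times> (nat \<Rightarrow> 'a)"
    have "\<forall>k. \<exists>z. Pr k z"
    proof
      fix k
      have pX: "pts X \<in> sets B" "emeasure (\<sigma> (n k)) (pts X - pts X) = 0"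
        using sets.top[of B] by simp_all
      have "(0::real) < (1/2) ^ k / 4" by simp
      then obtain N :: "nat set" and x where "finite N" "N \<noteq> {}" "x \<in> N \<rightarrow>\<^sub>E pts X" "W (\<sigma> (n k)) (emp N x) < (1/2) ^ k / 4"
        by (rule emp_dense[OF \<sigma>P pX])
      then have "Pr k (N, x)" by (auto simp: Pr_def)
      then show "\<exists>z. Pr k z" by blast
    qed
    from choice[OF this] obtain z where "\<And>k. Pr k (z k)" by blast
    then have z: "\<And>k. finite (fst (z k))" "\<And>k. fst (z k) \<noteq> {}" "\<And>k. snd (z k) \<in> fst (z k) \<rightarrow> pts X"
      "\<And>k. W (\<sigma> (n k)) (emp (fst (z k)) (snd (z k))) < (1/2) ^ k / 4"
      unfolding Pr_def by blast+
    define E where "E k = emp (fst (z k)) (snd (z k))" for k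
    have EP: "E k \<in> PX" for k unfolding E_def by (rule emp_in_PX[OF z(1-3)])
    have WE: "W (\<sigma> (n k)) (E k) < (1/2) ^ k / 4" for k using z(4) by (simp add: E_def)
    have step: "W (E k) (E (Suc k)) < (1/2) ^ k" for k
    proof -
      have "W (E k) (E (Suc k)) \<le> W (E k) (\<sigma> (n k)) + W (\<sigma> (n k)) (E (Suc k))" by (rule W_triangle[OF EP \<sigma>P EP])
      also have "W (\<sigma> (n k)) (E (Suc k)) \<le> W (\<sigma> (n k)) (\<sigma> (n (Suc k))) + W (\<sigma> (n (Suc k))) (E (Suc k))"
        by (rule W_triangle[OF \<sigma>P \<sigma>P EP])
      finally have "W (E k) (E (Suc k)) \<le> W (\<sigma> (n k)) (E k) + W (\<sigma> (n k)) (\<sigma> (n (Suc k))) + W (\<sigma> (n (Suc k))) (E (Suc k))"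
        by (simp add: W_commute)
      moreover have "W (\<sigma> (n k)) (\<sigma> (n (Suc k))) < (1/2) ^ k / 4"
        using gn[of k] nS[of k] by (intro g) auto
      moreover have "W (\<sigma> (n (Suc k))) (E (Suc k)) < (1/2) ^ k / 4"
        using WE[of "Suc k"] by (rule order_less_le_trans) simp
      ultimately show ?thesis using WE[of k] zero_less_power[of "1/2::real" k] by linarith
    qed
    obtain p where p: "p \<in> PX" "\<And>k. W (E k) p \<le> 2 * (1/2) ^ k"
      using emp_sequence_convergent[OF complete z(1-3), folded E_def, OF step] by blast
    have "limitin P.mtopology \<sigma> p sequentially"
      unfolding P.limit_metric_sequentially
    proof (intro conjI allI impI)
      fix e :: real assume e: "0 < e"
      \<comment> \<open>The three distances that are added below amount to at most
        \<open>1/4 + 1/4 + 2\<close> times \<open>(1/2) ^ k\<close>, which is less than three times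
        that power.\<close>
      then have "0 < e/3" by simp
      from real_arch_pow_inv[OF this, of "1/2"] obtain k where k: "(1/2) ^ k < e/3" by auto
      have "W (\<sigma> m) p < e" if m: "n k \<le> m" for m
      proof -
        have "W (\<sigma> m) p \<le> W (\<sigma> m) (\<sigma> (n k)) + W (\<sigma> (n k)) p" by (rule W_triangle[OF \<sigma>P \<sigma>P p(1)])
        also have "W (\<sigma> (n k)) p \<le> W (\<sigma> (n k)) (E k) + W (E k) p" by (rule W_triangle[OF \<sigma>P EP p(1)])
        finally have "W (\<sigma> m) p \<le> W (\<sigma> m) (\<sigma> (n k)) + W (\<sigma> (n k)) (E k) + W (E k) p" by simp
        moreover have "W (\<sigma> m) (\<sigma> (n k)) < (1/2) ^ k / 4" using gn[of k] m by (intro g) auto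
        ultimately show ?thesis using WE[of k] p(2)[of k] k e by linarith
      qed
      then show "\<exists>N. \<forall>n\<ge>N. \<sigma> n \<in> PX \<and> W (\<sigma> n) p < e" using \<sigma>P by blast
    qed (rule p(1))
    then show "\<exists>p. limitin P.mtopology \<sigma> p sequentially" by blast
  qed
qed

end

section \<open>The power functor\<close>

lemma (in metric_omet) closedin_prod_sequentially:
  "closedin (prod_topology T T) L \<longleftrightarrow> L \<subseteq> pts X \<times> pts X \<and>
    (\<forall>\<sigma> \<tau> a b. (\<forall>k. (\<sigma> k, \<tau> k) \<in> L) \<longrightarrow> limitin mtopology \<sigma> a sequentially \<longrightarrow>
      limitin mtopology \<tau> b sequentially \<longrightarrow> (a, b) \<in> L)"
proof -
  interpret XX: Metric_space12 "pts X" d "pts X" d ..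
  show ?thesis
    unfolding T_def XX.mtopology_prod_metric[symmetric] XX.Prod_metric.metric_closedin_iff_sequentially_closed
    unfolding XX.mtopology_prod_metric
  proof (intro conj_cong refl iffI allI impI)
    fix \<sigma> \<tau> a b
    assume *: "\<forall>\<rho> l. range \<rho> \<subseteq> L \<and> limitin (prod_topology mtopology mtopology) \<rho> l sequentially \<longrightarrow> l \<in> L"
      and "\<forall>k. (\<sigma> k, \<tau> k) \<in> L" "limitin mtopology \<sigma> a sequentially" "limitin mtopology \<tau> b sequentially"
    then show "(a, b) \<in> L"
      using *[rule_format, of "\<lambda>k. (\<sigma> k, \<tau> k)" "(a, b)"] by (auto simp: limitin_pairwise comp_def)
  next
    fix \<rho> l
    assume *: "\<forall>\<sigma> \<tau> a b. (\<forall>k. (\<sigma> k, \<tau> k) \<in> L) \<longrightarrow> limitin mtopology \<sigma> a sequentially \<longrightarrow>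
        limitin mtopology \<tau> b sequentially \<longrightarrow> (a, b) \<in> L"
      and \<rho>: "range \<rho> \<subseteq> L \<and> limitin (prod_topology mtopology mtopology) \<rho> l sequentially"
    have "(fst l, snd l) \<in> L"
    proof (rule *[rule_format])
      show "(fst (\<rho> k), snd (\<rho> k)) \<in> L" for k using \<rho> by auto
      show "limitin mtopology (\<lambda>k. fst (\<rho> k)) (fst l) sequentially"
        "limitin mtopology (\<lambda>k. snd (\<rho> k)) (snd l) sequentially"
        using \<rho> by (simp_all add: limitin_pairwise comp_def)
    qed
    then show "l \<in> L" by simp
  qed
qed

lemma complete_ordered_metric_space_iff:
  "complete_ordered_metric_space X \<longleftrightarrow> ordered_omet X \<and> Metric_space.mcomplete (pts X) (dst X)"
  by (auto simp: complete_ordered_metric_space_def ordered_metric_space_def ordered_omet_def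
      metric_omet_def ordered_omet_axioms_def)

lemma omet_power_simps [simp]:
  "pts (omet_power X N) = N \<rightarrow>\<^sub>E pts X"
  "dst (omet_power X N) x y = (\<Sum>n\<in>N. dst X (x n) (y n)) / real (card N)"
  "(x, y) \<in> leq (omet_power X N) \<longleftrightarrow>
    x \<in> N \<rightarrow>\<^sub>E pts X \<and> y \<in> N \<rightarrow>\<^sub>E pts X \<and> (\<forall>n\<in>N. (x n, y n) \<in> leq X)"
  by (simp_all add: omet_power_def)

lemma wasserstein_space_simps [simp]:
  "pts (wasserstein_space X) = wasserstein_pts X"
  "dst (wasserstein_space X) = wasserstein_dist X"
  "leq (wasserstein_space X) = stochastic_order X"
  by (simp_all add: wasserstein_space_def)

lemma finunif_obj_iff: "N \<in> finunif_obj \<longleftrightarrow> finite N \<and> N \<noteq> {}"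
  by (simp add: finunif_obj_def)

context metric_omet
begin

lemma metric_omet_power:
  assumes N: "finite N" "N \<noteq> {}"
  shows "metric_omet (omet_power X N)"
proof
  show "0 \<le> dst (omet_power X N) x y" for x y by (simp add: sum_nonneg)
  show "dst (omet_power X N) x y = dst (omet_power X N) y x" for x y
    using commute by (auto intro!: arg_cong[of _ _ "\<lambda>s. s / real (card N)"] sum.cong)
  have c: "0 < real (card N)" using N by (simp add: card_gt_0_iff)
  show "dst (omet_power X N) x y = 0 \<longleftrightarrow> x = y" if "x \<in> pts (omet_power X N)" "y \<in> pts (omet_power X N)" for x y
  proof -
    have "dst (omet_power X N) x y = 0 \<longleftrightarrow> (\<forall>n\<in>N. d (x n) (y n) = 0)"
      using c N by (simp add: sum_nonneg_eq_0_iff)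
    also have "\<dots> \<longleftrightarrow> (\<forall>n\<in>N. x n = y n)"
      using that by (intro ball_cong refl zero) auto
    also have "\<dots> \<longleftrightarrow> x = y"
      using that by (auto intro: PiE_ext)
    finally show ?thesis .
  qed
  show "dst (omet_power X N) x z \<le> dst (omet_power X N) x y + dst (omet_power X N) y z"
    if "x \<in> pts (omet_power X N)" "y \<in> pts (omet_power X N)" "z \<in> pts (omet_power X N)" for x y z
  proof -
    have "(\<Sum>n\<in>N. d (x n) (z n)) \<le> (\<Sum>n\<in>N. d (x n) (y n) + d (y n) (z n))"
      using that by (intro sum_mono triangle) auto
    then show ?thesis
      using c by (simp add: sum.distrib add_divide_distrib[symmetric] divide_right_mono)
  qed
qed

lemma coord_le_power_dist:
  assumes N: "finite N" and n: "n \<in> N"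
  shows "d (x n) (y n) \<le> real (card N) * dst (omet_power X N) x y"
proof -
  have "card N \<noteq> 0" using assms by auto
  then show ?thesis using member_le_sum[of n N "\<lambda>n. d (x n) (y n)"] assms by simp
qed

lemma limitin_power_iff:
  assumes N: "finite N" "N \<noteq> {}" and \<sigma>: "\<And>k. \<sigma> k \<in> N \<rightarrow>\<^sub>E pts X" and l: "l \<in> N \<rightarrow>\<^sub>E pts X"
  shows "limitin (Metric_space.mtopology (pts (omet_power X N)) (dst (omet_power X N))) \<sigma> l sequentially \<longleftrightarrow>
    (\<forall>n\<in>N. limitin mtopology (\<lambda>k. \<sigma> k n) (l n) sequentially)"
proof -
  interpret P: metric_omet "omet_power X N" by (rule metric_omet_power[OF N])
  have "limitin P.mtopology \<sigma> l sequentially \<longleftrightarrow> (\<lambda>k. dst (omet_power X N) (\<sigma> k) l) \<longlonglongrightarrow> 0"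
    unfolding P.limitin_metric_dist_null using \<sigma> l by simp
  also have "\<dots> \<longleftrightarrow> (\<forall>n\<in>N. (\<lambda>k. d (\<sigma> k n) (l n)) \<longlonglongrightarrow> 0)"
  proof (intro iffI ballI)
    fix n assume n: "n \<in> N" and lim: "(\<lambda>k. dst (omet_power X N) (\<sigma> k) l) \<longlonglongrightarrow> 0"
    have lim': "(\<lambda>k. real (card N) * dst (omet_power X N) (\<sigma> k) l) \<longlonglongrightarrow> 0"
      using tendsto_mult_right_zero[OF lim] .
    show "(\<lambda>k. d (\<sigma> k n) (l n)) \<longlonglongrightarrow> 0"
      by (rule tendsto_sandwich[OF _ _ tendsto_const lim'])
         (simp_all only: coord_le_power_dist[OF N(1) n] nonneg eventually_True)
  next
    assume "\<forall>n\<in>N. (\<lambda>k. d (\<sigma> k n) (l n)) \<longlonglongrightarrow> 0"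
    then have "(\<lambda>k. \<Sum>n\<in>N. d (\<sigma> k n) (l n)) \<longlonglongrightarrow> (\<Sum>n\<in>N. 0)" by (intro tendsto_sum) auto
    then show "(\<lambda>k. dst (omet_power X N) (\<sigma> k) l) \<longlonglongrightarrow> 0"
      by (simp add: tendsto_divide_zero)
  qed
  also have "\<dots> \<longleftrightarrow> (\<forall>n\<in>N. limitin mtopology (\<lambda>k. \<sigma> k n) (l n) sequentially)"
    using \<sigma> l by (auto simp: limitin_metric_dist_null PiE_iff)
  finally show ?thesis .
qed

lemma mcomplete_power:
  assumes complete: mcomplete and N: "finite N" "N \<noteq> {}"
  shows "Metric_space.mcomplete (pts (omet_power X N)) (dst (omet_power X N))"
proof -
  interpret P: metric_omet "omet_power X N" by (rule metric_omet_power[OF N])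
  show ?thesis
    unfolding P.mcomplete_def
  proof (intro allI impI)
    fix \<sigma> assume \<sigma>: "P.MCauchy \<sigma>"
    have \<sigma>P: "\<sigma> k \<in> N \<rightarrow>\<^sub>E pts X" for k using \<sigma> unfolding P.MCauchy_def by auto
    have c: "0 < real (card N)" using N by (simp add: card_gt_0_iff)
    have "\<forall>n. \<exists>l. n \<in> N \<longrightarrow> limitin mtopology (\<lambda>k. \<sigma> k n) l sequentially"
    proof
      fix n
      have "MCauchy (\<lambda>k. \<sigma> k n)" if n: "n \<in> N"
        unfolding MCauchy_def
      proof (intro conjI allI impI)
        show "range (\<lambda>k. \<sigma> k n) \<subseteq> pts X" using \<sigma>P n by auto
        fix e :: real assume "0 < e"
        then have "0 < e / real (card N)" using c by simp
        then obtain k0 where k0: "\<And>k k'. k0 \<le> k \<Longrightarrow> k0 \<le> k' \<Longrightarrow> dst (omet_power X N) (\<sigma> k) (\<sigma> k') < e / real (card N)"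
          using \<sigma> unfolding P.MCauchy_def by blast
        have "d (\<sigma> k n) (\<sigma> k' n) < e" if "k0 \<le> k" "k0 \<le> k'" for k k'
        proof -
          have "d (\<sigma> k n) (\<sigma> k' n) \<le> real (card N) * dst (omet_power X N) (\<sigma> k) (\<sigma> k')"
            by (rule coord_le_power_dist[OF N(1) n])
          also have "\<dots> < real (card N) * (e / real (card N))"
            using k0[OF that] c by (rule mult_strict_left_mono)
          finally show ?thesis using c by simp
        qed
        then show "\<exists>k0. \<forall>k k'. k0 \<le> k \<longrightarrow> k0 \<le> k' \<longrightarrow> d (\<sigma> k n) (\<sigma> k' n) < e" by blast
      qed
      then show "\<exists>l. n \<in> N \<longrightarrow> limitin mtopology (\<lambda>k. \<sigma> k n) l sequentially"
        using complete by (auto simp: mcomplete_def)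
    qed
    from choice[OF this] obtain l where l: "\<And>n. n \<in> N \<Longrightarrow> limitin mtopology (\<lambda>k. \<sigma> k n) (l n) sequentially"
      by blast
    have lP: "restrict l N \<in> N \<rightarrow>\<^sub>E pts X" using limitin_mspace[OF l] by auto
    have "limitin P.mtopology \<sigma> (restrict l N) sequentially"
      using l by (subst limitin_power_iff[OF N \<sigma>P lP]) simp
    then show "\<exists>l. limitin P.mtopology \<sigma> l sequentially" by blast
  qed
qed

end

lemma (in ordered_omet) ordered_omet_power:
  assumes N: "finite N" "N \<noteq> {}"
  shows "ordered_omet (omet_power X N)"
proof -
  interpret P: metric_omet "omet_power X N" by (rule metric_omet_power[OF N])
  have "partial_order_on (pts (omet_power X N)) (leq (omet_power X N))"
    unfolding partial_order_on_def preorder_on_def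
  proof (intro conjI)
    show "leq (omet_power X N) \<subseteq> pts (omet_power X N) \<times> pts (omet_power X N)" by auto
    show "refl_on (pts (omet_power X N)) (leq (omet_power X N))"
      by (auto simp: refl_on_def intro!: leq_refl)
    show "trans (leq (omet_power X N))" 
      by (rule transI, simp) (blast intro: leq_trans)
    show "antisym (leq (omet_power X N))"
    proof (rule antisymI)
      fix x y assume "(x, y) \<in> leq (omet_power X N)" "(y, x) \<in> leq (omet_power X N)"
      then show "x = y"
        by (intro PiE_ext[of x N "\<lambda>_. pts X" y]) (auto intro: leq_antisym)
    qed
  qed
  moreover have "closedin (prod_topology (omet_topology (omet_power X N)) (omet_topology (omet_power X N)))
      (leq (omet_power X N))"
    unfolding P.closedin_prod_sequentially
  proof (intro conjI allI impI)
    show "leq (omet_power X N) \<subseteq> pts (omet_power X N) \<times> pts (omet_power X N)" by auto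
    fix \<sigma> \<tau> a b
    assume leq: "\<forall>k. (\<sigma> k, \<tau> k) \<in> leq (omet_power X N)"
      and lim: "limitin P.mtopology \<sigma> a sequentially" "limitin P.mtopology \<tau> b sequentially"
    have ab: "a \<in> N \<rightarrow>\<^sub>E pts X" "b \<in> N \<rightarrow>\<^sub>E pts X" using lim[THEN P.limitin_mspace] by simp_all
    have \<sigma>: "\<And>k. \<sigma> k \<in> N \<rightarrow>\<^sub>E pts X" "\<And>k. \<tau> k \<in> N \<rightarrow>\<^sub>E pts X" using leq by simp_all
    have "(a n, b n) \<in> leq X" if n: "n \<in> N" for n
    proof -
      have "limitin mtopology (\<lambda>k. \<sigma> k n) (a n) sequentially" "limitin mtopology (\<lambda>k. \<tau> k n) (b n) sequentially"
        using lim n limitin_power_iff[OF N \<sigma>(1) ab(1)] limitin_power_iff[OF N \<sigma>(2) ab(2)] by auto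
      moreover have "\<forall>k. (\<sigma> k n, \<tau> k n) \<in> leq X" using leq n by simp
      ultimately show ?thesis
        using conjunct2[OF closed_leq[unfolded closedin_prod_sequentially], rule_format,
            of "\<lambda>k. \<sigma> k n" "\<lambda>k. \<tau> k n"] by blast
    qed
    then show "(a, b) \<in> leq (omet_power X N)" using ab by simp
  qed
  ultimately show ?thesis
    by (intro ordered_omet.intro P.metric_omet_axioms ordered_omet_axioms.intro)
qed

lemma omet_power_map_apply:
  "x \<in> N \<rightarrow>\<^sub>E pts X \<Longrightarrow> omet_power_map X M N \<phi> x = (\<lambda>m\<in>M. x (\<phi> m))"
  by (simp add: omet_power_map_def)

lemma omet_power_map_in:
  assumes "\<phi> \<in> M \<rightarrow>\<^sub>E N" "x \<in> N \<rightarrow>\<^sub>E pts X"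
  shows "omet_power_map X M N \<phi> x \<in> M \<rightarrow>\<^sub>E pts X"
  using assms by (auto simp: omet_power_map_apply)

text \<open>Here the uniform fibres enter: pulling back repeats every coordinate equally often, and
  an average does not change under this. In particular the maps of the power functor preserve
  distances.\<close>

lemma finunif_hom_average:
  fixes f :: "'n \<Rightarrow> real"
  assumes \<phi>: "\<phi> \<in> finunif_hom M N" and N: "finite N" "N \<noteq> {}" and M: "finite M" "M \<noteq> {}"
  shows "(\<Sum>m\<in>M. f (\<phi> m)) / real (card M) = (\<Sum>n\<in>N. f n) / real (card N)"
proof -
  have \<phi>N: "\<phi> ` M \<subseteq> N" using finunif_homD(1)[OF \<phi>] by auto
  have c: "real (card {m \<in> M. \<phi> m = n}) * real (card N) = real (card M)" if "n \<in> N" for n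
    using finunif_hom_card_fiber[OF \<phi> N(1) M(1) that] by (metis of_nat_mult)
  have c0: "0 < real (card M)" "0 < real (card N)" using N M by (simp_all add: card_gt_0_iff)
  have "(\<Sum>m\<in>M. f (\<phi> m)) = (\<Sum>n\<in>N. \<Sum>m\<in>{m \<in> M. \<phi> m = n}. f (\<phi> m))"
    using M(1) N(1) \<phi>N by (rule sum.group[symmetric])
  also have "\<dots> = (\<Sum>n\<in>N. real (card {m \<in> M. \<phi> m = n}) * f n)" by (intro sum.cong refl) simp
  also have "\<dots> = (\<Sum>n\<in>N. real (card M) / real (card N) * f n)"
    using c c0 by (intro sum.cong refl) (simp add: field_simps)
  also have "\<dots> = real (card M) / real (card N) * (\<Sum>n\<in>N. f n)" by (simp add: sum_distrib_left)
  finally show ?thesis using c0 by simp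
qed

lemma omet_power_map_hom:
  assumes \<phi>: "\<phi> \<in> finunif_hom M N" and N: "finite N" "N \<noteq> {}" and M: "finite M" "M \<noteq> {}"
  shows "omet_power_map X M N \<phi> \<in> comet_hom (omet_power X N) (omet_power X M)"
proof -
  note \<phi>E = finunif_homD(1)[OF \<phi>]
  have "omet_power_map X M N \<phi> \<in> pts (omet_power X N) \<rightarrow>\<^sub>E pts (omet_power X M)"
  proof (rule PiE_I)
    show "omet_power_map X M N \<phi> x \<in> pts (omet_power X M)" if "x \<in> pts (omet_power X N)" for x
      using omet_power_map_in[OF \<phi>E] that by simp
  qed (simp add: omet_power_map_def)
  moreover have "dst (omet_power X M) (omet_power_map X M N \<phi> x) (omet_power_map X M N \<phi> y) \<le> dst (omet_power X N) x y"
    if "x \<in> pts (omet_power X N)" "y \<in> pts (omet_power X N)" for x y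
    using that finunif_hom_average[OF \<phi> N M, of "\<lambda>n. dst X (x n) (y n)"] by (simp add: omet_power_map_apply)
  moreover have "(omet_power_map X M N \<phi> x, omet_power_map X M N \<phi> y) \<in> leq (omet_power X M)"
    if "(x, y) \<in> leq (omet_power X N)" for x y
    using that omet_power_map_in[OF \<phi>E] \<phi>E by (auto simp: omet_power_map_apply)
  ultimately show ?thesis unfolding comet_hom_def by blast
qed

lemma finunif_op_functor_power:
  assumes X: "complete_ordered_metric_space X"
  shows "finunif_op_functor (omet_power X :: 'n set \<Rightarrow> ('n \<Rightarrow> 'a) omet) (omet_power_map X)"
proof -
  interpret ordered_omet X using X by (simp add: complete_ordered_metric_space_iff)
  have complete: mcomplete using X by (simp add: complete_ordered_metric_space_iff)
  have "complete_ordered_metric_space (omet_power X N)" if "N \<in> finunif_obj" for N :: "'n set"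
    using that ordered_omet_power[of N] mcomplete_power[OF complete, of N]
    unfolding complete_ordered_metric_space_iff finunif_obj_iff by blast
  moreover have "omet_power_map X M N \<phi> \<in> comet_hom (omet_power X N) (omet_power X M)"
    if "M \<in> finunif_obj" "N \<in> finunif_obj" "\<phi> \<in> finunif_hom M N" for M N :: "'n set" and \<phi>
    using that by (intro omet_power_map_hom) (simp_all add: finunif_obj_iff)
  moreover have "omet_power_map X N N (\<lambda>n\<in>N. n) = (\<lambda>x\<in>pts (omet_power X N). x)" for N :: "'n set"
    by (rule ext) (auto simp: omet_power_map_def restrict_def PiE_def extensional_def)
  moreover have "omet_power_map X L N (compose L \<phi> \<psi>)
      = compose (pts (omet_power X N)) (omet_power_map X L M \<psi>) (omet_power_map X M N \<phi>)"
    if "\<psi> \<in> finunif_hom L M" "\<phi> \<in> finunif_hom M N" for L M N :: "'n set" and \<phi> \<psi>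
  proof (rule ext)
    fix x
    have \<psi>: "\<psi> l \<in> M" if "l \<in> L" for l using finunif_homD(1)[OF \<open>\<psi> \<in> finunif_hom L M\<close>] that by auto
    show "omet_power_map X L N (compose L \<phi> \<psi>) x
        = compose (pts (omet_power X N)) (omet_power_map X L M \<psi>) (omet_power_map X M N \<phi>) x"
    proof (cases "x \<in> N \<rightarrow>\<^sub>E pts X")
      case True
      then show ?thesis
        using omet_power_map_in[OF finunif_homD(1)[OF that(2)] True] \<psi>
        by (auto simp: compose_def omet_power_map_apply restrict_def)
    next
      case False
      then show ?thesis by (simp add: compose_def omet_power_map_def)
    qed
  qed
  ultimately show ?thesis unfolding finunif_op_functor_def by blast
qed

section \<open>The universal property\<close>

context metric_omet
begin

lemma empirical_eq: "N \<in> finunif_obj \<Longrightarrow> x \<in> N \<rightarrow>\<^sub>E pts X \<Longrightarrow> empirical X N x = emp N x"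
  by (rule empirical_eq_emp) (simp_all add: finunif_obj_iff)

lemma emp_restrict: "N \<in> finunif_obj \<Longrightarrow> x \<in> N \<rightarrow> pts X \<Longrightarrow> emp N (restrict x N) = emp N x"
  unfolding emp_def finunif_obj_iff
  by (rule fin_law_eqI) (auto intro!: uniform_weights)

lemma wasserstein_cocone:
  assumes X: "complete_ordered_metric_space X"
  shows "comet_cocone (omet_power X :: 'n set \<Rightarrow> ('n \<Rightarrow> 'a) omet) (omet_power_map X) (wasserstein_space X) (empirical X)"
proof -
  interpret ordered_omet X using X by (simp add: complete_ordered_metric_space_iff)
  have complete: mcomplete using X by (simp add: complete_ordered_metric_space_iff)
  have "ordered_omet (wasserstein_space X)"
    using Metric_space_W partial_order_stochastic closed_stochastic
    by (simp add: ordered_omet_def metric_omet_def ordered_omet_axioms_def omet_topology_def)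
  then have "complete_ordered_metric_space (wasserstein_space X)"
    using mcomplete_W[OF complete] by (simp add: complete_ordered_metric_space_iff)
  moreover have "empirical X N \<in> comet_hom (omet_power X N) (wasserstein_space X)" if N: "N \<in> finunif_obj" for N :: "'n set"
    unfolding comet_hom_def mem_Collect_eq
  proof (intro conjI ballI impI)
    note N' = N[unfolded finunif_obj_iff, THEN conjunct1] N[unfolded finunif_obj_iff, THEN conjunct2]
    show "empirical X N \<in> pts (omet_power X N) \<rightarrow>\<^sub>E pts (wasserstein_space X)"
    proof (rule PiE_I)
      show "empirical X N x \<in> pts (wasserstein_space X)" if "x \<in> pts (omet_power X N)" for x
        using that N' by (simp add: empirical_eq[OF N] emp_in_PX PiE_iff Pi_iff)
    qed (simp add: empirical_def)
    fix x y assume xy: "x \<in> pts (omet_power X N)" "y \<in> pts (omet_power X N)"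
    then have xy': "x \<in> N \<rightarrow> pts X" "y \<in> N \<rightarrow> pts X" by auto
    show "dst (wasserstein_space X) (empirical X N x) (empirical X N y) \<le> dst (omet_power X N) x y"
      using xy W_emp_le[OF N' xy'] by (simp add: empirical_eq[OF N])
    assume leq: "(x, y) \<in> leq (omet_power X N)"
    note c = fin_law_coupling(1,3)[OF uniform_weights[OF N'] xy', folded emp_def]
    show "(empirical X N x, empirical X N y) \<in> leq (wasserstein_space X)"
      using xy leq c emp_in_PX[OF N' xy'(1)] emp_in_PX[OF N' xy'(2)] leq_sets
      by (auto simp: empirical_eq[OF N] stochastic_order_iff)
  qed
  moreover have "compose (pts (omet_power X N)) (empirical X M) (omet_power_map X M N \<phi>) = empirical X N"
    if MN: "M \<in> finunif_obj" "N \<in> finunif_obj" and \<phi>: "\<phi> \<in> finunif_hom M N" for M N :: "'n set" and \<phi>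
  proof (rule ext)
    fix x
    show "compose (pts (omet_power X N)) (empirical X M) (omet_power_map X M N \<phi>) x = empirical X N x"
    proof (cases "x \<in> N \<rightarrow>\<^sub>E pts X")
      case True
      have xp: "(\<lambda>m. x (\<phi> m)) \<in> M \<rightarrow> pts X" using True finunif_homD(1)[OF \<phi>] by auto
      have "empirical X M (omet_power_map X M N \<phi> x) = emp M (\<lambda>m\<in>M. x (\<phi> m))"
        using omet_power_map_in[OF finunif_homD(1)[OF \<phi>] True]
        by (simp add: empirical_eq[OF MN(1)] omet_power_map_apply[OF True])
      also have "\<dots> = emp M (\<lambda>m. x (\<phi> m))" by (rule emp_restrict[OF MN(1) xp])
      also have "\<dots> = emp N x"
        using MN True by (intro emp_hom[OF \<phi>]) (auto simp: finunif_obj_iff)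
      also have "\<dots> = empirical X N x" using empirical_eq[OF MN(2) True] by simp
      finally show ?thesis using True by (simp add: compose_def)
    next
      case False
      then show ?thesis by (simp add: compose_def empirical_def)
    qed
  qed
  ultimately show ?thesis unfolding comet_cocone_def by blast
qed

end

text \<open>Couplings are pushed forward along \<open>h\<close> in both coordinates, and a short
  \<open>h\<close> does not increase their cost. It is applied to the two projections of a space of
  pairs, which carry an approximation of a coupling to approximations of both marginals.\<close>

lemma W_distr_le:
  fixes Z :: "'b omet" and X :: "'a omet"
  assumes Z: "metric_omet Z" and X: "metric_omet X"
    and h: "continuous_map (omet_topology Z) (omet_topology X) h"
    and short: "\<And>a b. a \<in> pts Z \<Longrightarrow> b \<in> pts Z \<Longrightarrow> dst X (h a) (h b) \<le> dst Z a b"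
    and pq: "p \<in> wasserstein_pts Z" "q \<in> wasserstein_pts Z"
    and pq': "distr p (borel_of (omet_topology X)) h \<in> wasserstein_pts X"
      "distr q (borel_of (omet_topology X)) h \<in> wasserstein_pts X"
  shows "wasserstein_dist X (distr p (borel_of (omet_topology X)) h) (distr q (borel_of (omet_topology X)) h)
    \<le> wasserstein_dist Z p q"
proof -
  interpret Z: metric_omet Z by (rule Z)
  interpret X: metric_omet X by (rule X)
  let ?p = "distr p X.B h" and ?q = "distr q X.B h"
  have hm: "h \<in> measurable Z.B X.B" by (rule continuous_map_measurable[OF h])
  let ?hh = "\<lambda>z. (h (fst z), h (snd z))"
  have "continuous_map (prod_topology Z.T Z.T) (prod_topology X.T X.T) ?hh"
    using continuous_map_compose[OF continuous_map_fst h, of Z.T] continuous_map_compose[OF continuous_map_snd h, of Z.T]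
    by (simp add: continuous_map_paired comp_def)
  then have hh: "?hh \<in> measurable Z.B2 X.B2" by (rule continuous_map_measurable)
  show ?thesis
  proof (rule field_le_epsilon)
    fix e :: real assume "0 < e"
    then have "Z.W p q < Z.W p q + e" by simp
    then obtain R where R: "radon_coupling Z.T Z.T p q R" "Z.cost R < ennreal (Z.W p q + e)"
      by (rule Z.W_approx[OF pq])
    note D = radon_couplingD[OF R(1)]
    have hR: "?hh \<in> measurable R X.B2" using hh by (simp add: D(5) cong: measurable_cong_sets)
    have "distr (distr R X.B2 ?hh) X.B fst = distr (distr R Z.B fst) X.B h"
      using hR hm D(10) measurable_fst_borel_of[of X.T X.T] by (simp add: distr_distr comp_def)
    moreover have "distr (distr R X.B2 ?hh) X.B snd = distr (distr R Z.B snd) X.B h"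
      using hR hm D(11) measurable_snd_borel_of[of X.T X.T] by (simp add: distr_distr comp_def)
    ultimately have "radon_coupling X.T X.T ?p ?q (distr R X.B2 ?hh)"
      using D hR X.metrizable_T X.PX_D(1)[OF pq'(1)] X.PX_D(1)[OF pq'(2)]
      by (simp add: radon_coupling_def prob_space.prob_space_distr)
    then have "ennreal (X.W ?p ?q) \<le> X.cost (distr R X.B2 ?hh)" by (rule X.W_le[OF pq'])
    also have "\<dots> = (\<integral>\<^sup>+ z. ennreal (dst X (h (fst z)) (h (snd z))) \<partial>R)"
      using hR measurable_compose[OF X.d_measurable measurable_ennreal]
      by (subst nn_integral_distr) simp_all
    also have "\<dots> \<le> Z.cost R"
      using short by (intro nn_integral_mono ennreal_leI) (auto simp: D(9))
    also have "\<dots> \<le> ennreal (Z.W p q + e)" using R(2) by simp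
    finally show "X.W ?p ?q \<le> Z.W p q + e"
      using \<open>0 < e\<close> Z.W_nonneg[of p q] by (subst (asm) ennreal_le_iff) (auto simp del: Z.W_nonneg)
  qed
qed

text \<open>A coupling supported on the order is approximated, as a measure on the product, by empirical
  measures of tuples of comparable pairs.\<close>

lemma (in ordered_omet) stochastic_order_approx:
  fixes e :: real
  assumes pq: "(p, q) \<in> stochastic_order X" and e: "0 < e"
  obtains N :: "'n::infinite set" and x y where "N \<in> finunif_obj" "(x, y) \<in> leq (omet_power X N)"
    "W p (emp N x) < e" "W q (emp N y) < e"
proof -
  \<comment> \<open>The topology of \<open>prod_dist d d\<close> is the product topology and both
    projections are short for it. The coupling thereby becomes a point of a Wasserstein space of its
    own, in which empirical measures are dense.\<close>
  define XX where "XX = \<lparr>pts = pts X \<times> pts X, dst = prod_dist d d, leq = {}\<rparr>"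
  have XX [simp]: "pts XX = pts X \<times> pts X" "dst XX = prod_dist d d" by (simp_all add: XX_def)
  interpret M: Metric_space12 "pts X" d "pts X" d ..
  have mXX: "metric_omet XX"
    unfolding metric_omet_def XX by (rule M.Prod_metric.Metric_space_axioms)
  interpret Z: metric_omet XX by (rule mXX)
  have TXX: "Z.T = prod_topology T T"
    using M.mtopology_prod_metric by (simp add: omet_topology_def)
  obtain r where P: "p \<in> PX" "q \<in> PX" and r: "radon_coupling T T p q r" "AE z in r. z \<in> leq X"
    using pq by (auto simp: stochastic_order_iff)
  note D = radon_couplingD[OF r(1)]
  obtain a where a: "a \<in> pts X" using PX_nonempty[OF P(1)] by auto
  have rP: "r \<in> Z.PX"
  proof (rule Z.PX_I)
    show "radon_prob Z.T r" using radon_coupling_radon[OF r(1)] by (simp add: TXX)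
    show "(a, a) \<in> pts XX" using a by simp
    have m: "(\<lambda>x. ennreal (d a x)) \<in> borel_measurable B" using a by simp
    have "(\<integral>\<^sup>+ z. ennreal (dst XX (a, a) z) \<partial>r) \<le> (\<integral>\<^sup>+ z. ennreal (d a (fst z)) + ennreal (d a (snd z)) \<partial>r)"
    proof (rule nn_integral_mono)
      fix z assume "z \<in> space r"
      then have "prod_dist d d (a, a) z \<le> d a (fst z) + d a (snd z)"
        using M.prod_metric_le_components[of a "fst z" a "snd z"] a by (auto simp: D(9))
      then show "ennreal (dst XX (a, a) z) \<le> ennreal (d a (fst z)) + ennreal (d a (snd z))"
        by (simp flip: ennreal_plus)
    qed
    also have "\<dots> = (\<integral>\<^sup>+ z. ennreal (d a (fst z)) \<partial>r) + (\<integral>\<^sup>+ z. ennreal (d a (snd z)) \<partial>r)"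
      using measurable_compose[OF D(10) m] measurable_compose[OF D(11) m] by (intro nn_integral_add) auto
    also have "(\<integral>\<^sup>+ z. ennreal (d a (fst z)) \<partial>r) = (\<integral>\<^sup>+ x. ennreal (d a x) \<partial>p)"
      unfolding D(7)[symmetric] using D(10) m by (subst nn_integral_distr) auto
    also have "(\<integral>\<^sup>+ z. ennreal (d a (snd z)) \<partial>r) = (\<integral>\<^sup>+ x. ennreal (d a x) \<partial>q)"
      unfolding D(8)[symmetric] using D(11) m by (subst nn_integral_distr) auto
    also have "(\<integral>\<^sup>+ x. ennreal (d a x) \<partial>p) + (\<integral>\<^sup>+ x. ennreal (d a x) \<partial>q) < top"
      using PX_D(1,2)[OF P(1)] PX_D(1,2)[OF P(2)] a by (simp add: finite_first_moment_iff)
    finally show "(\<integral>\<^sup>+ z. ennreal (dst XX (a, a) z) \<partial>r) < top" .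
  qed
  have L: "leq X \<in> sets Z.B" "emeasure r (pts XX - leq X) = 0"
    using leq_sets AE_leq_iff[OF r(1)] r(2) by (simp_all add: TXX)
  \<comment> \<open>The order has full measure for the coupling, so density holds with atoms taken
    from it: the entries of \<open>z\<close> are comparable pairs.\<close>
  obtain N :: "'n set" and z where z: "finite N" "N \<noteq> {}" "z \<in> N \<rightarrow>\<^sub>E leq X" "Z.W r (Z.emp N z) < e"
    by (rule Z.emp_dense[OF rP L e])
  have zX: "z \<in> N \<rightarrow> pts XX" using z(3) leq_sub by auto
  have N: "N \<in> finunif_obj" using z by (simp add: finunif_obj_iff)
  have ZE: "Z.emp N z \<in> Z.PX" by (rule Z.emp_in_PX[OF z(1,2) zX])
  have push: "W (distr r B h) (emp N (\<lambda>n\<in>N. h (z n))) < e"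
    if h: "continuous_map (prod_topology T T) T h" and hP: "distr r B h \<in> PX"
      and short: "\<And>a b. a \<in> pts X \<times> pts X \<Longrightarrow> b \<in> pts X \<times> pts X \<Longrightarrow> d (h a) (h b) \<le> prod_dist d d a b" for h
  proof -
    have hm: "h \<in> measurable Z.B B" using continuous_map_measurable[OF h] by (simp add: TXX)
    have hz: "(\<lambda>n. h (z n)) \<in> N \<rightarrow> pts X"
      using continuous_map_funspace[OF h] zX by (auto simp: Pi_iff)
    have "z \<in> measurable (point_measure N (\<lambda>n. ennreal (1 / real (card N)))) Z.B"
      using zX by (intro point_measure_measurable) simp
    then have "distr (Z.emp N z) B h = emp N (\<lambda>n. h (z n))"
      using hm unfolding Z.emp_def Z.fin_law_def emp_def fin_law_def by (simp add: distr_distr comp_def)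
    then have eq: "distr (Z.emp N z) B h = emp N (\<lambda>n\<in>N. h (z n))"
      using emp_restrict[OF N hz] by simp
    have "W (distr r B h) (distr (Z.emp N z) B h) \<le> Z.W r (Z.emp N z)"
    proof (rule W_distr_le[OF mXX metric_omet_axioms _ _ rP ZE hP])
      show "continuous_map Z.T T h" using h by (simp add: TXX)
      show "d (h a) (h b) \<le> dst XX a b" if "a \<in> pts XX" "b \<in> pts XX" for a b using short that by simp
      show "distr (Z.emp N z) B h \<in> PX"
        using emp_in_PX[OF z(1,2) hz] emp_restrict[OF N hz] eq by simp
    qed
    then show ?thesis using z(4) eq by simp
  qed
  define x where "x = (\<lambda>n\<in>N. fst (z n))"
  define y where "y = (\<lambda>n\<in>N. snd (z n))"
  have zl: "z n \<in> leq X" if "n \<in> N" for n using z(3) that by auto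
  have "(x, y) \<in> leq (omet_power X N)"
    using zl zX by (auto simp: x_def y_def Pi_iff mem_Times_iff)
  moreover have "W p (emp N x) < e"
    unfolding x_def D(7)[symmetric] using P(1) D(7) M.component_le_prod_metric(1)
    by (intro push continuous_map_fst) auto
  moreover have "W q (emp N y) < e"
    unfolding y_def D(8)[symmetric] using P(2) D(8) M.component_le_prod_metric(2)
    by (intro push continuous_map_snd) auto
  ultimately show ?thesis using N by (intro that)
qed

section \<open>The mediating map of a given cocone\<close>

locale wasserstein_test = ordered_omet X + Y: ordered_omet Y for X :: "'a omet" and Y :: "'y omet" +
  fixes g :: "'n::infinite set \<Rightarrow> ('n \<Rightarrow> 'a) \<Rightarrow> 'y"
  assumes Y_complete: Y.mcomplete
    and cocone: "comet_cocone (omet_power X) (omet_power_map X) Y g"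
begin

lemma g_hom: "N \<in> finunif_obj \<Longrightarrow> g N \<in> comet_hom (omet_power X N) Y"
  using cocone by (simp add: comet_cocone_def)

lemma g_in: "N \<in> finunif_obj \<Longrightarrow> x \<in> N \<rightarrow>\<^sub>E pts X \<Longrightarrow> g N x \<in> pts Y"
  using g_hom by (force simp: comet_hom_def)

lemma g_natural:
  assumes "M \<in> finunif_obj" "N \<in> finunif_obj" "\<phi> \<in> finunif_hom M N" "x \<in> N \<rightarrow>\<^sub>E pts X"
  shows "g M (\<lambda>m\<in>M. x (\<phi> m)) = g N x"
proof -
  have "compose (pts (omet_power X N)) (g M) (omet_power_map X M N \<phi>) x = g N x"
    using cocone assms(1-3) by (simp add: comet_cocone_def)
  then show ?thesis using assms(4) by (simp add: compose_def omet_power_map_apply)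
qed

text \<open>Naturality allows both tuples to be pulled back to the index set \<open>K\<close> of a
  nearly optimal matching without changing the values of \<open>g\<close>. There shortness for the
  average distance applies, and that distance is almost the Wasserstein distance.\<close>

lemma g_short_W:
  assumes N: "N \<in> finunif_obj" and x: "x \<in> N \<rightarrow>\<^sub>E pts X" and M: "M \<in> finunif_obj" and y: "y \<in> M \<rightarrow>\<^sub>E pts X"
  shows "dst Y (g N x) (g M y) \<le> W (emp N x) (emp M y)"
proof (rule field_le_epsilon)
  fix e :: real assume "0 < e"
  have N': "finite N" "N \<noteq> {}" and M': "finite M" "M \<noteq> {}" using N M by (simp_all add: finunif_obj_iff)
  have x': "x \<in> N \<rightarrow> pts X" and y': "y \<in> M \<rightarrow> pts X" using x y by auto
  have "W (emp N x) (emp M y) < W (emp N x) (emp M y) + e" using \<open>0 < e\<close> by simp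
  then obtain K :: "'n set" and \<phi> \<psi> where K: "K \<in> finunif_obj" "\<phi> \<in> finunif_hom K N" "\<psi> \<in> finunif_hom K M"
    "(\<Sum>k\<in>K. d (x (\<phi> k)) (y (\<psi> k))) / real (card K) \<le> W (emp N x) (emp M y) + e"
    by (rule emp_matching[OF N' x' M' y'])
  let ?x = "\<lambda>k\<in>K. x (\<phi> k)" and ?y = "\<lambda>k\<in>K. y (\<psi> k)"
  have xy: "?x \<in> pts (omet_power X K)" "?y \<in> pts (omet_power X K)"
    using x y finunif_homD(1)[OF K(2)] finunif_homD(1)[OF K(3)] by auto
  have "dst Y (g N x) (g M y) = dst Y (g K ?x) (g K ?y)"
    using g_natural[OF K(1) N K(2) x] g_natural[OF K(1) M K(3) y] by simp
  also have "\<dots> \<le> dst (omet_power X K) ?x ?y"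
    using g_hom[OF K(1)] xy unfolding comet_hom_def by blast
  also have "\<dots> \<le> W (emp N x) (emp M y) + e" using K(4) by simp
  finally show "dst Y (g N x) (g M y) \<le> W (emp N x) (emp M y) + e" .
qed

text \<open>The value at \<open>p\<close> is characterized by its distances to all values of
  \<open>g\<close> at once, not by a chosen approximating sequence. By density at most one
  \<open>v\<close> qualifies, and the inequality directly yields both agreement with
  \<open>g\<close> and shortness.\<close>

definition extends :: "'a measure \<Rightarrow> 'y \<Rightarrow> bool" where
  "extends p v \<longleftrightarrow> v \<in> pts Y \<and>
    (\<forall>N\<in>finunif_obj. \<forall>x\<in>N \<rightarrow>\<^sub>E pts X. dst Y (g N x) v \<le> W (emp N x) p)"

lemma dense:
  assumes "p \<in> PX" "0 < e"
  obtains N :: "'n set" and x where "N \<in> finunif_obj" "x \<in> N \<rightarrow>\<^sub>E pts X" "W (emp N x) p < e"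
proof -
  have pX: "pts X \<in> sets B" "emeasure p (pts X - pts X) = 0" using sets.top[of B] by simp_all
  obtain N :: "'n set" and x where "finite N" "N \<noteq> {}" "x \<in> N \<rightarrow>\<^sub>E pts X" "W p (emp N x) < e"
    by (rule emp_dense[OF assms(1) pX assms(2)])
  then show ?thesis by (intro that[of N x]) (simp_all add: finunif_obj_iff W_commute)
qed

lemma emp_PX: "N \<in> finunif_obj \<Longrightarrow> x \<in> N \<rightarrow>\<^sub>E pts X \<Longrightarrow> emp N x \<in> PX"
  by (rule emp_in_PX) (auto simp: finunif_obj_iff)

text \<open>Since \<open>g\<close> is short for \<open>W\<close>, it maps a sequence of empirical
  measures converging to \<open>p\<close> to a Cauchy sequence in \<open>Y\<close>; the inequality
  for its limit follows from the triangle inequality and continuity of the distance.\<close>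

lemma extends_exists:
  assumes p: "p \<in> PX"
  shows "\<exists>v. extends p v"
proof -
  have ex: "\<forall>k. \<exists>z. fst z \<in> finunif_obj \<and> snd z \<in> fst z \<rightarrow>\<^sub>E pts X \<and> W (emp (fst z :: 'n set) (snd z)) p < inverse (Suc k)"
  proof
    fix k
    have "0 < inverse (real (Suc k))" by simp
    then obtain N :: "'n set" and x where "N \<in> finunif_obj" "x \<in> N \<rightarrow>\<^sub>E pts X" "W (emp N x) p < inverse (Suc k)"
      by (rule dense[OF p])
    then show "\<exists>z. fst z \<in> finunif_obj \<and> snd z \<in> fst z \<rightarrow>\<^sub>E pts X \<and> W (emp (fst z :: 'n set) (snd z)) p < inverse (Suc k)"
      by (intro exI[of _ "(N, x)"]) simp
  qed
  from choice[OF ex] obtain z where z: "\<And>k. fst (z k) \<in> finunif_obj" "\<And>k. snd (z k) \<in> fst (z k) \<rightarrow>\<^sub>E pts X"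
    "\<And>k. W (emp (fst (z k) :: 'n set) (snd (z k))) p < inverse (Suc k)" by blast
  define E where "E k = emp (fst (z k)) (snd (z k))" for k
  define v where "v k = g (fst (z k)) (snd (z k))" for k
  have EP: "E k \<in> PX" for k unfolding E_def by (rule emp_PX[OF z(1,2)])
  have Ep: "W (E k) p < inverse (Suc k)" for k using z(3) by (simp add: E_def)
  have vY: "v k \<in> pts Y" for k unfolding v_def by (rule g_in[OF z(1,2)])
  have dv: "dst Y (g N x) (v k) \<le> W (emp N x) (E k)" if "N \<in> finunif_obj" "x \<in> N \<rightarrow>\<^sub>E pts X" for N x k
    unfolding v_def E_def by (rule g_short_W[OF that z(1,2)])
  have "Y.MCauchy v"
    unfolding Y.MCauchy_def
  proof (intro conjI allI impI)
    show "range v \<subseteq> pts Y" using vY by auto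
    fix e :: real assume "0 < e"
    then obtain k0 where k0: "inverse (real (Suc k0)) < e/2" using reals_Archimedean[of "e/2"] by auto
    have "W (E k) p < e/2" if "k0 \<le> k" for k
    proof -
      have "inverse (real (Suc k)) \<le> inverse (real (Suc k0))" using that by simp
      then show ?thesis using Ep[of k] k0 by linarith
    qed
    then have "dst Y (v k) (v k') < e" if "k0 \<le> k" "k0 \<le> k'" for k k'
    proof -
      have "dst Y (v k) (v k') \<le> W (E k) (E k')"
        using dv[OF z(1,2), of k k'] by (simp add: v_def E_def)
      also have "\<dots> \<le> W (E k) p + W p (E k')" by (rule W_triangle[OF EP p EP])
      also have "\<dots> < e"
        using \<open>\<And>k. k0 \<le> k \<Longrightarrow> W (E k) p < e/2\<close>[OF that(1)] \<open>\<And>k. k0 \<le> k \<Longrightarrow> W (E k) p < e/2\<close>[OF that(2)]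
        by (simp add: W_commute[of p])
      finally show ?thesis .
    qed
    then show "\<exists>k0. \<forall>k k'. k0 \<le> k \<longrightarrow> k0 \<le> k' \<longrightarrow> dst Y (v k) (v k') < e" by blast
  qed
  then obtain l where l: "limitin Y.mtopology v l sequentially" using Y_complete by (auto simp: Y.mcomplete_def)
  have "dst Y (g N x) l \<le> W (emp N x) p" if N: "N \<in> finunif_obj" and x: "x \<in> N \<rightarrow>\<^sub>E pts X" for N x
  proof (rule LIMSEQ_le)
    show "(\<lambda>k. dst Y (g N x) (v k)) \<longlonglongrightarrow> dst Y (g N x) l" by (rule Y.limitin_dist[OF l vY g_in[OF N x]])
    show "(\<lambda>k. W (emp N x) p + inverse (real (Suc k))) \<longlonglongrightarrow> W (emp N x) p"
      using tendsto_add[OF tendsto_const LIMSEQ_inverse_real_of_nat] by simp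
    have "dst Y (g N x) (v k) \<le> W (emp N x) p + inverse (real (Suc k))" for k
      using dv[OF N x, of k] W_triangle[OF emp_PX[OF N x] p EP, of k] Ep[of k] by (simp add: W_commute[of p])
    then show "\<exists>N0. \<forall>k\<ge>N0. dst Y (g N x) (v k) \<le> W (emp N x) p + inverse (real (Suc k))" by blast
  qed
  then have "extends p l" using Y.limitin_mspace[OF l] by (simp add: extends_def)
  then show ?thesis ..
qed

definition extension :: "'a measure \<Rightarrow> 'y" where
  "extension = (\<lambda>p\<in>PX. SOME v. extends p v)"

lemma extension_extends: "p \<in> PX \<Longrightarrow> extends p (extension p)"
  using someI_ex[OF extends_exists] by (simp add: extension_def)

lemma extension_in: "p \<in> PX \<Longrightarrow> extension p \<in> pts Y"
  using extension_extends by (simp add: extends_def)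

lemma extension_le: "p \<in> PX \<Longrightarrow> N \<in> finunif_obj \<Longrightarrow> x \<in> N \<rightarrow>\<^sub>E pts X \<Longrightarrow> dst Y (g N x) (extension p) \<le> W (emp N x) p"
  using extension_extends by (simp add: extends_def)

lemma extension_emp:
  assumes N: "N \<in> finunif_obj" and x: "x \<in> N \<rightarrow>\<^sub>E pts X"
  shows "extension (emp N x) = g N x"
proof -
  have "dst Y (g N x) (extension (emp N x)) \<le> 0"
    using extension_le[OF emp_PX[OF N x] N x] W_self[OF emp_PX[OF N x]] by simp
  then have "dst Y (g N x) (extension (emp N x)) = 0" by (simp add: order_antisym)
  then show ?thesis using g_in[OF N x] extension_in[OF emp_PX[OF N x]] by simp
qed

lemma extension_short:
  assumes p: "p \<in> PX" and q: "q \<in> PX"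
  shows "dst Y (extension p) (extension q) \<le> W p q"
proof (rule field_le_epsilon)
  fix e :: real assume "0 < e"
  then have "0 < e/2" by simp
  then obtain N :: "'n set" and x where N: "N \<in> finunif_obj" "x \<in> N \<rightarrow>\<^sub>E pts X" "W (emp N x) p < e/2"
    by (rule dense[OF p])
  have "dst Y (extension p) (extension q) \<le> dst Y (g N x) (extension p) + dst Y (g N x) (extension q)"
    by (rule Y.triangle'') (intro extension_in p q g_in N(1,2))+
  also have "\<dots> \<le> W (emp N x) p + W (emp N x) q"
    by (intro add_mono extension_le p q N(1,2))
  also have "W (emp N x) q \<le> W (emp N x) p + W p q"
    by (rule W_triangle[OF emp_PX[OF N(1,2)] p q])
  finally show "dst Y (extension p) (extension q) \<le> W p q + e" using N(3) by simp
qed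

text \<open>Each \<open>g N\<close> is monotone, so comparable tuples approximating \<open>p\<close>
  and \<open>q\<close> have comparable images. These converge to the two extended values, and the
  order of \<open>Y\<close> is closed.\<close>

lemma extension_mono:
  assumes pq: "(p, q) \<in> stochastic_order X"
  shows "(extension p, extension q) \<in> leq Y"
proof -
  have p: "p \<in> PX" and q: "q \<in> PX" using pq by (auto simp: stochastic_order_def)
  have "\<forall>k. \<exists>s t. (s, t) \<in> leq Y \<and> dst Y s (extension p) < inverse (Suc k) \<and> dst Y t (extension q) < inverse (Suc k)"
  proof
    fix k
    have "0 < inverse (real (Suc k))" by simp
    then obtain N :: "'n set" and x y where N: "N \<in> finunif_obj" and xy: "(x, y) \<in> leq (omet_power X N)"
      and Wx: "W p (emp N x) < inverse (Suc k)" and Wy: "W q (emp N y) < inverse (Suc k)"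
      by (rule stochastic_order_approx[OF pq])
    have x: "x \<in> N \<rightarrow>\<^sub>E pts X" "y \<in> N \<rightarrow>\<^sub>E pts X" using xy by simp_all
    have "(g N x, g N y) \<in> leq Y"
      using g_hom[OF N] xy x unfolding comet_hom_def by simp
    moreover have "dst Y (g N x) (extension p) < inverse (Suc k)" "dst Y (g N y) (extension q) < inverse (Suc k)"
      using extension_le[OF p N x(1)] extension_le[OF q N x(2)] Wx Wy by (simp_all add: W_commute[of p] W_commute[of q])
    ultimately show "\<exists>s t. (s, t) \<in> leq Y \<and> dst Y s (extension p) < inverse (Suc k) \<and> dst Y t (extension q) < inverse (Suc k)"
      by blast
  qed
  from choice[OF this] obtain s where "\<forall>k. \<exists>t. (s k, t) \<in> leq Y \<and> dst Y (s k) (extension p) < inverse (Suc k) \<and> dst Y t (extension q) < inverse (Suc k)"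
    by blast
  from choice[OF this] obtain t where st: "\<And>k. (s k, t k) \<in> leq Y" "\<And>k. dst Y (s k) (extension p) < inverse (Suc k)"
    "\<And>k. dst Y (t k) (extension q) < inverse (Suc k)" by blast
  have lim: "limitin Y.mtopology a l sequentially"
    if a: "\<And>k. a k \<in> pts Y" and l: "l \<in> pts Y" and le: "\<And>k. dst Y (a k) l < inverse (Suc k)" for a l
    unfolding Y.limitin_metric_dist_null
  proof (intro conjI l always_eventually allI a)
    show "(\<lambda>k. dst Y (a k) l) \<longlonglongrightarrow> 0"
      by (rule tendsto_sandwich[OF _ _ tendsto_const LIMSEQ_inverse_real_of_nat])
         (intro always_eventually allI less_imp_le[OF le] Y.nonneg)+
  qed
  have sY: "\<And>k. s k \<in> pts Y" "\<And>k. t k \<in> pts Y" using st(1) Y.leq_sub by blast+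
  show ?thesis
    using conjunct2[OF Y.closed_leq[unfolded Y.closedin_prod_sequentially], rule_format, OF st(1)
        lim[OF sY(1) extension_in[OF p] st(2)] lim[OF sY(2) extension_in[OF q] st(3)]] .
qed

lemma extension_hom: "extension \<in> comet_hom (wasserstein_space X) Y"
  unfolding comet_hom_def mem_Collect_eq
proof (intro conjI ballI impI)
  show "extension \<in> pts (wasserstein_space X) \<rightarrow>\<^sub>E pts Y"
  proof (rule PiE_I)
    show "extension p \<in> pts Y" if "p \<in> pts (wasserstein_space X)" for p using extension_in that by simp
  qed (simp add: extension_def)
qed (simp_all add: extension_short extension_mono)

lemma extension_factor:
  assumes N: "N \<in> finunif_obj"
  shows "compose (pts (omet_power X N)) extension (empirical X N) = g N"
proof (rule HOL.ext)
  fix x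
  show "compose (pts (omet_power X N)) extension (empirical X N) x = g N x"
  proof (cases "x \<in> N \<rightarrow>\<^sub>E pts X")
    case True
    then show ?thesis by (simp add: compose_def empirical_eq[OF N] extension_emp[OF N])
  next
    case False
    moreover have "g N x = undefined" using g_hom[OF N] False by (auto simp: comet_hom_def PiE_def extensional_def)
    ultimately show ?thesis by (simp add: compose_def)
  qed
qed

text \<open>Any mediating map is short and agrees with \<open>g\<close> on empirical measures, and
  these are dense.\<close>

lemma extension_unique:
  assumes u: "u \<in> comet_hom (wasserstein_space X) Y"
    and fac: "\<And>N. N \<in> finunif_obj \<Longrightarrow> compose (pts (omet_power X N)) u (empirical X N) = g N"
  shows "u = extension"
proof (rule HOL.ext)
  fix p
  show "u p = extension p"
  proof (cases "p \<in> PX")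
    case p: True
    have uY: "u p \<in> pts Y" if "p \<in> PX" for p using u that by (auto simp: comet_hom_def)
    have short: "dst Y (u p) (u q) \<le> W p q" if "p \<in> PX" "q \<in> PX" for p q
      using u that by (simp add: comet_hom_def)
    have "dst Y (u p) (extension p) \<le> 0 + e" if "0 < e" for e
    proof -
      have "0 < e/2" using that by simp
      then obtain N :: "'n set" and x where N: "N \<in> finunif_obj" "x \<in> N \<rightarrow>\<^sub>E pts X" "W (emp N x) p < e/2"
        by (rule dense[OF p])
      have gu: "u (emp N x) = g N x"
        using fun_cong[OF fac[OF N(1)], of x] N(2) by (simp add: compose_def empirical_eq[OF N(1)])
      have "dst Y (u p) (extension p) \<le> dst Y (g N x) (u p) + dst Y (g N x) (extension p)"
        by (rule Y.triangle'') (intro uY extension_in p g_in N(1,2))+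
      also have "dst Y (g N x) (u p) \<le> W (emp N x) p"
        using short[OF emp_PX[OF N(1,2)] p] gu by simp
      also have "dst Y (g N x) (extension p) \<le> W (emp N x) p" by (rule extension_le[OF p N(1,2)])
      finally show ?thesis using N(3) by simp
    qed
    then have "dst Y (u p) (extension p) \<le> 0" by (rule field_le_epsilon)
    then have "dst Y (u p) (extension p) = 0" by (simp add: order_antisym)
    then show ?thesis using uY[OF p] extension_in[OF p] by simp
  next
    case False
    moreover have "u p = undefined" using u False by (auto simp: comet_hom_def PiE_def extensional_def)
    ultimately show ?thesis by (simp add: extension_def)
  qed
qed

end

text \<open>As \<open>'n\<close> is infinite, every finite nonempty set is in bijection with one in
  \<open>'n\<close>, so the diagram is indexed by a category equivalent to all of FinUnif. The free
  type \<open>'y\<close> lets the universal property be tested against spaces of any type.\<close>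

theorem corollary3p3p2:
  fixes X :: "'a omet"
  assumes "complete_ordered_metric_space X"
  shows "finunif_op_functor (omet_power X :: 'n::infinite set \<Rightarrow> ('n \<Rightarrow> 'a) omet) (omet_power_map X) \<and>
         comet_colimit TYPE('y) (omet_power X :: 'n set \<Rightarrow> ('n \<Rightarrow> 'a) omet) (omet_power_map X)
           (wasserstein_space X) (empirical X)"
proof
  show "finunif_op_functor (omet_power X :: 'n set \<Rightarrow> ('n \<Rightarrow> 'a) omet) (omet_power_map X)"
    by (rule finunif_op_functor_power[OF assms])
  have X: "ordered_omet X" using assms by (simp add: complete_ordered_metric_space_iff)
  then interpret ordered_omet X .
  show "comet_colimit TYPE('y) (omet_power X :: 'n set \<Rightarrow> ('n \<Rightarrow> 'a) omet) (omet_power_map X)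
      (wasserstein_space X) (empirical X)"
    unfolding comet_colimit_def
  proof (intro conjI allI impI)
    show "comet_cocone (omet_power X :: 'n set \<Rightarrow> ('n \<Rightarrow> 'a) omet) (omet_power_map X) (wasserstein_space X) (empirical X)"
      by (rule wasserstein_cocone[OF assms])
    fix Y :: "'y omet" and g :: "'n set \<Rightarrow> ('n \<Rightarrow> 'a) \<Rightarrow> 'y"
    assume g: "comet_cocone (omet_power X) (omet_power_map X) Y g"
    then have Y: "ordered_omet Y" "Metric_space.mcomplete (pts Y) (dst Y)"
      by (simp_all add: comet_cocone_def complete_ordered_metric_space_iff)
    interpret Y: wasserstein_test X Y g
      by (intro wasserstein_test.intro wasserstein_test_axioms.intro X Y g)
    show "\<exists>!u. u \<in> comet_hom (wasserstein_space X) Y \<and>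
        (\<forall>N\<in>finunif_obj. compose (pts (omet_power X N)) u (empirical X N) = g N)"
    proof (rule ex1I[of _ Y.extension])
      show "Y.extension \<in> comet_hom (wasserstein_space X) Y \<and>
          (\<forall>N\<in>finunif_obj. compose (pts (omet_power X N)) Y.extension (empirical X N) = g N)"
        using Y.extension_hom Y.extension_factor by blast
    qed (use Y.extension_unique in blast)
  qed
qed

end
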